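(* Let $f\in\mathcal M^\flat$ be a phase-free coefficient germ whose canonical continuation $f(z)$ is holomorphic in a neighborhood of the closed right half-plane $\Re z\ge0$. Assume that for every $A>0$ there is a constant $C_A$ such that for $j=0,1,2$ $$\left|\frac{\partial^j}{\partial t^j}f(\sigma+it)\right|\le\frac{C_A}{(1+|t|)^3}\qquad(0\le\sigma\le A,\ t\in\mathbb R),$$ and that $|f(N+1)|/|f(N)|\to\infty$ as $N\to\infty$. Write $\Phi(u):=\mathcal B[f](u)$ for the Bromwich transform of $f$, and assume moreover that there exists $\rho>0$ with $$\int_{-\infty}^\infty|\Phi(u)|e^{\rho e^u}\,du<\infty.$$ Define $a_n:=(-1)^nf(n)$ for $n\ge0$ and let $\widehat A(t):=\sum_{n=0}^\infty a_nt^n/n!$ be the ordinary Borel transform. Then $\widehat A$ is represented near $t=0$ by $$\widehat A(t)=\int_{-\infty}^\infty\Phi(u)e^{-te^u}\,du,$$ this representation defines $\widehat A$ on the positive real axis $t\ge 0$ and hence the Borel-Laplace integral there, and $$C\left(\sum_{n=0}^\infty a_n\right)=\int_0^\infty e^{-t}\widehat A(t)\,dt,$$ where the left side is the $C$-sum of $\sum a_n$.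
   Context: **Germs and log-exp monomials.** Functions are germs at $+\infty$ on the positive real axis: two are identified if they agree for all sufficiently large real $x$. Put $\ell_0(x)=x$, $\ell_{j+1}(x)=\log\ell_j(x)$. $\mathcal P$ is the group of germs $\prod_{j=0}^r\ell_j(x)^{\alpha_j}$, $\alpha_j\in\mathbb R$. Let $\mathcal L_0=\mathcal P$. Given $\mathcal L_{\le h}=\bigcup_{q=0}^h\mathcal L_q$, a reduced exponent of height at most $h$ is a finite (possibly empty) sum $\Phi=\sum_\nu c_\nu M_\nu$ with $c_\nu\in\mathbb R\setminus\{0\}$, the $M_\nu\in\mathcal L_{\le h}$ distinct, each $M_\nu(x)\to+\infty$, and no $M_\nu$ equal to an iterated logarithm $\ell_j$ with $j\ge1$. $\mathcal L_{h+1}$ is the set of germs $\exp(\Phi(x))P(x)$ with $P\in\mathcal P$ and $\Phi$ a reduced exponent of height at most $h$; $\mathcal L=\bigcup_{h\ge0}\mathcal L_h$. The reduced expression is part of the data of an element of $\mathcal L$. Write $f\prec g$ (or $g\succ f$) if $f(x)/g(x)\to0$ as $x\to+\infty$. Let $\mathcal L_{<x}=\{L\in\mathcal L:\log L(x)=o(x)\}$. $L\in\mathcal L$ is gamma-resonant if there are $\lambda\in\mathbb R$, $H\in\mathcal L_{<x}$, $\kappa>0$ and $C\in\mathbb R_{>0}$ with $L(x)/(e^{\lambda x}H(x)\Gamma(\kappa x+1))\to C$. **Growth monomials, $\mathcal M$, $\mathcal M^\flat$.** A growth monomial is either a pure log-exp germ $L\in\mathcal L$ that is not gamma-resonant, or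 a gamma-type germ $e^{\lambda x}H(x)\Gamma(\kappa x+1)$ with $\lambda\in\mathbb R$, $H\in\mathcal L_{<x}$, $\kappa>0$. $\mathcal M$ consists of the zero germ and all finite sums $\sum_{j=1}^r(A_j+B_je^{i\pi x})M_j(x)$ with growth monomials $M_1\succ\cdots\succ M_r$ and $(A_j,B_j)\in\mathbb C^2\setminus\{(0,0)\}$. $\mathcal M^\flat$ (phase-free germs) consists of the zero germ and all finite sums $\sum_{j=1}^rC_jM_j(x)$ with growth monomials $M_1\succ\cdots\succ M_r$ and $C_j\in\mathbb C\setminus\{0\}$. The phase split of $c=\sum_j(A_j+B_je^{i\pi x})M_j\in\mathcal M$ is $c=c^{(+)}+e^{i\pi x}c^{(-)}$ with $c^{(+)}=\sum_jA_jM_j$, $c^{(-)}=\sum_jB_jM_j\in\mathcal M^\flat$. **Canonical continuation.** A growth monomial is continued to some right half-plane by replacing $x$ by $z$ in its reduced expression (principal branches of iterated logarithms and powers; for gamma-type, $M(z)=e^{\lambda z}H(z)\Gamma(\kappa z+1)$). $a=\sum C_jM_j\in\mathcal M^\flat$ is continued by $a(z)=\sum C_jM_j(z)$; the zero germ by $0$. Values $f(n)$ at integers are values of the continuation. **Bromwich transform.** $a\in\mathcal M^\flat$ is Bromwich-admissible if there is $\sigma_0\in\mathbb R$ such that for every $\sigma>\sigma_0$: (1) $\mathcal B[a](u)=\frac1{2\pi i}\int_{\sigma-i\infty}^{\sigma+i\infty}a(z)e^{-uz}\,dz$ converges absolutely for almost every $u\in\mathbb R$; (2) $\mathcal B[a](u)$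 does not depend on $\sigma>\sigma_0$; (3) for every sufficiently large integer $N$, $\int_{-\infty}^\infty\mathcal B[a](u)e^{Nu}\,du$ converges absolutely and equals $a(N)$. **Selectors.** For Bromwich-admissible $a$, $\mathcal S_+[a](N)=PV\int_{-\infty}^\infty\frac{\mathcal B[a](u)e^{Nu}}{1-e^u}du$, whenever the integral converges absolutely away from $u=0$ and the principal value $\lim_{\varepsilon\to0^+}\int_{|u|>\varepsilon}$ exists; $\mathcal S_-[a](N)=\int_{-\infty}^\infty\frac{\mathcal B[a](u)e^{Nu}}{1+e^u}du$, whenever it converges absolutely. $c\in\mathcal M$ admits a canonical selector if $c^{(\pm)}$ are Bromwich-admissible and $\mathcal S_+[c^{(+)}](N)$, $\mathcal S_-[c^{(-)}](N)$ exist for all sufficiently large $N$; then $U_c(N)=\mathcal S_+[c^{(+)}](N)+(-1)^N\mathcal S_-[c^{(-)}](N)$. **Admissibility and finite part.** A sequence $U$ (defined for large $N$) is shift-nonresonant if either $U_N\to0$ or there are $\varepsilon>0$, $N_0$ with $|U_N-U_{N+1}|\ge\varepsilon|U_N|$ for $N\ge N_0$. For a complex sequence $R=(R_N)_{N\ge0}$ put $c_N=R_N-R_{N+1}$. $R$ is $\mathcal M$-admissible if either $c_N=0$ for all large $N$, or there is $c\in\mathcal M$ with $c(N)=c_N$ for all large integers $N$ which admits a canonical selector $U_c$ that is shift-nonresonant (such $c$ is unique). For $\mathcal M$-admissible $R$, $\mathrm{FP}_\infty(R)$ is the eventual constant value of $R_N$ if $c_N=0$ eventually, and otherwise the eventual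 constant value of $R_N-U_c(N)$. **$C$-summation.** A recurrence presentation of a formal series $\sum_{k\ge0}c_k$ consists of $n_0\in\mathbb N$, functions $a,b:\mathbb N\to\mathbb C$ with $a(n),b(n)\ne0$ for $n\ge n_0$, and complex $\mu_n$ such that $c_k=(-1)^k\mu_{n_0+k}\prod_{j=0}^{k-1}\frac{b(n_0+j)}{a(n_0+j+1)}$ for all $k\ge0$ (empty product $=1$). Put $P(n,n_0)=\prod_{k=n_0}^{n-1}(-a(k)/b(k))$. For a solution $(I_n)_{n\ge n_0}$ of $a(n)I_n+b(n)I_{n+1}=\mu_n$ the normalized tail is $R_N=a(n_0)I_{n_0+N}/P(n_0+N,n_0)$. The series is $C$-summable if some presentation has a solution with $\mathcal M$-admissible normalized tail $R$; its $C$-sum is then $C(\sum c_k)=a(n_0)I_{n_0}-\mathrm{FP}_\infty(R)$ (a value independent of the presentation and solution). *)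

theory Defs
  imports "HOL-Complex_Analysis.Complex_Analysis" "HOL-Library.Landau_Symbols"
begin

section \<open>Log-exp monomials\<close>

text \<open>
  Every germ below comes with its reduced expression, so monomials are represented by
  expressions.  All evaluation functions are polymorphic: at type \<open>real\<close> (for large arguments) they
  give the germ at $+\infty$, and at type \<open>complex\<close>, on a sufficiently far right half-plane, they
  give its canonical continuation, because \<open>ln\<close> and \<open>powr\<close> on \<open>complex\<close> are the principal branches.
\<close>

primrec iter_ln :: "nat \<Rightarrow> 'a::ln \<Rightarrow> 'a" where
  "iter_ln 0 x = x"
| "iter_ln (Suc j) x = ln (iter_ln j x)"

text \<open>
  \<open>LogExp [(c\<^sub>1, M\<^sub>1), \<dots>] [\<alpha>\<^sub>0, \<dots>, \<alpha>\<^sub>r]\<close> stands for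
  $\exp(\sum_\nu c_\nu M_\nu)\prod_{j=0}^r \ell_j^{\alpha_j}$.
\<close>

datatype logexp = LogExp "(real \<times> logexp) list" "real list"

fun logexp_eval :: "logexp \<Rightarrow> 'a::{real_normed_field, banach, ln} \<Rightarrow> 'a" where
  "logexp_eval (LogExp \<Phi> \<alpha>) x =
     exp (\<Sum>(c, M)\<leftarrow>\<Phi>. of_real c * logexp_eval M x) *
     (\<Prod>j<length \<alpha>. iter_ln j x powr of_real (\<alpha> ! j))"

definition germ_eq :: "(real \<Rightarrow> real) \<Rightarrow> (real \<Rightarrow> real) \<Rightarrow> bool" where
  "germ_eq f g \<longleftrightarrow> (\<forall>\<^sub>F x in at_top. f x = g x)"

text \<open>\<open>is_logexp_height h L\<close> says that \<open>L\<close> is a reduced expression of an element of $\mathcal L_h$.\<close>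

inductive is_logexp_height :: "nat \<Rightarrow> logexp \<Rightarrow> bool" where
  zero: "is_logexp_height 0 (LogExp [] \<alpha>)"
| Suc: "is_logexp_height (Suc h) (LogExp \<Phi> \<alpha>)"
    if "\<And>c M. (c, M) \<in> set \<Phi> \<Longrightarrow> c \<noteq> 0"
      and "\<And>c M. (c, M) \<in> set \<Phi> \<Longrightarrow> \<exists>q\<le>h. is_logexp_height q M"
      and "\<And>c M. (c, M) \<in> set \<Phi> \<Longrightarrow> filterlim (logexp_eval M :: real \<Rightarrow> real) at_top at_top"
      and "\<And>c M j. (c, M) \<in> set \<Phi> \<Longrightarrow> j \<ge> 1 \<Longrightarrow> \<not> germ_eq (logexp_eval M) (iter_ln j)"
      and "sorted_wrt (\<lambda>M M'. \<not> germ_eq (logexp_eval M) (logexp_eval M')) (map snd \<Phi>)"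

definition is_logexp :: "logexp \<Rightarrow> bool" where
  "is_logexp L \<longleftrightarrow> (\<exists>h. is_logexp_height h L)"

definition is_logexp_sublinear :: "logexp \<Rightarrow> bool" where
  "is_logexp_sublinear L \<longleftrightarrow> is_logexp L \<and> (\<lambda>x::real. ln (logexp_eval L x)) \<in> o[at_top](\<lambda>x. x)"

section \<open>Growth monomials and the classes of coefficient germs\<close>

text \<open>\<open>GammaType \<theta> H \<kappa>\<close> stands for $e^{\theta x}H(x)\Gamma(\kappa x+1)$.\<close>

datatype growth = Pure logexp | GammaType real logexp real

fun growth_eval :: "growth \<Rightarrow> 'a::{Gamma, banach, ln} \<Rightarrow> 'a" where
  "growth_eval (Pure L) x = logexp_eval L x"
| "growth_eval (GammaType \<theta> H \<kappa>) x =
     exp (of_real \<theta> * x) * logexp_eval H x * Gamma (of_real \<kappa> * x + 1)"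

definition gamma_resonant :: "logexp \<Rightarrow> bool" where
  "gamma_resonant L \<longleftrightarrow>
     (\<exists>\<theta> H \<kappa> C. is_logexp_sublinear H \<and> \<kappa> > 0 \<and> C > 0 \<and>
        ((\<lambda>x::real. logexp_eval L x / growth_eval (GammaType \<theta> H \<kappa>) x) \<longlongrightarrow> C) at_top)"

fun is_growth :: "growth \<Rightarrow> bool" where
  "is_growth (Pure L) \<longleftrightarrow> is_logexp L \<and> \<not> gamma_resonant L"
| "is_growth (GammaType \<theta> H \<kappa>) \<longleftrightarrow> is_logexp_sublinear H \<and> \<kappa> > 0"

definition dominates :: "growth \<Rightarrow> growth \<Rightarrow> bool" (infix "\<succ>" 50) where
  "M \<succ> M' \<longleftrightarrow> ((\<lambda>x::real. growth_eval M' x / growth_eval M x) \<longlongrightarrow> 0) at_top"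

text \<open>
  An element $\sum_j C_jM_j$ of $\mathcal M^\flat$ is the list of the pairs \<open>(C\<^sub>j, M\<^sub>j)\<close>, an element
  $\sum_j (A_j+B_je^{i\pi x})M_j$ of $\mathcal M$ the list of the triples \<open>(A\<^sub>j, B\<^sub>j, M\<^sub>j)\<close>; the empty
  list is the zero germ.
\<close>

type_synonym flat_germ = "(complex \<times> growth) list"
type_synonym phase_germ = "(complex \<times> complex \<times> growth) list"

definition is_flat_germ :: "flat_germ \<Rightarrow> bool" where
  "is_flat_germ a \<longleftrightarrow>
     (\<forall>(C, M)\<in>set a. C \<noteq> 0 \<and> is_growth M) \<and> sorted_wrt (\<lambda>(_, M) (_, M'). M \<succ> M') a"

definition is_phase_germ :: "phase_germ \<Rightarrow> bool" where
  "is_phase_germ c \<longleftrightarrow>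
     (\<forall>(A, B, M)\<in>set c. (A, B) \<noteq> (0, 0) \<and> is_growth M) \<and>
     sorted_wrt (\<lambda>(_, _, M) (_, _, M'). M \<succ> M') c"

definition flat_eval :: "flat_germ \<Rightarrow> complex \<Rightarrow> complex" where
  "flat_eval a z = (\<Sum>(C, M)\<leftarrow>a. C * growth_eval M z)"

definition phase_eval :: "phase_germ \<Rightarrow> complex \<Rightarrow> complex" where
  "phase_eval c z = (\<Sum>(A, B, M)\<leftarrow>c. (A + B * exp (\<i> * pi * z)) * growth_eval M z)"

definition phase_plus :: "phase_germ \<Rightarrow> flat_germ" where
  "phase_plus c = [(A, M). (A, B, M) \<leftarrow> c, A \<noteq> 0]"

definition phase_minus :: "phase_germ \<Rightarrow> flat_germ" where
  "phase_minus c = [(B, M). (A, B, M) \<leftarrow> c, B \<noteq> 0]"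

section \<open>Bromwich transform and selectors\<close>

text \<open>The line $\Re z=\sigma$ is parametrised by $z=\sigma+it$, $dz=i\,dt$.\<close>

definition bromwich_integrand :: "flat_germ \<Rightarrow> real \<Rightarrow> real \<Rightarrow> real \<Rightarrow> complex" where
  "bromwich_integrand a \<sigma> u t =
     flat_eval a (Complex \<sigma> t) * exp (- (of_real u * Complex \<sigma> t)) * \<i>"

definition bromwich_line :: "flat_germ \<Rightarrow> real \<Rightarrow> real \<Rightarrow> complex" where
  "bromwich_line a \<sigma> u = 1 / (2 * pi * \<i>) * (LINT t|lborel. bromwich_integrand a \<sigma> u t)"

text \<open>The common value for all large \<open>\<sigma>\<close>; meaningful when the line integrals do not depend on \<open>\<sigma>\<close>.\<close>

definition bromwich :: "flat_germ \<Rightarrow> real \<Rightarrow> complex" where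
  "bromwich a u = (THE w. \<forall>\<^sub>F \<sigma> in at_top. bromwich_line a \<sigma> u = w)"

text \<open>
  The modulus of the integrand is $|a(\sigma+it)|e^{-u\sigma}$, so absolute convergence for almost
  every \<open>u\<close> is absolute convergence for every \<open>u\<close>; hence the second condition ranges over all \<open>u\<close>.
\<close>

definition bromwich_admissible :: "flat_germ \<Rightarrow> bool" where
  "bromwich_admissible a \<longleftrightarrow> (\<exists>\<sigma>\<^sub>0. \<forall>\<sigma>>\<sigma>\<^sub>0.
     (AE u in lborel. integrable lborel (bromwich_integrand a \<sigma> u)) \<and>
     (\<forall>u. bromwich_line a \<sigma> u = bromwich a u) \<and>
     (\<forall>\<^sub>F N in sequentially.
        integrable lborel (\<lambda>u. bromwich a u * exp (of_nat N * of_real u)) \<and>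
        (LINT u|lborel. bromwich a u * exp (of_nat N * of_real u)) = flat_eval a (of_nat N)))"

definition sel_plus_integrand :: "flat_germ \<Rightarrow> nat \<Rightarrow> real \<Rightarrow> complex" where
  "sel_plus_integrand a N u = bromwich a u * exp (of_nat N * of_real u) / (1 - exp (of_real u))"

definition sel_plus_trunc :: "flat_germ \<Rightarrow> nat \<Rightarrow> real \<Rightarrow> complex" where
  "sel_plus_trunc a N \<epsilon> = (LINT u:{u. \<bar>u\<bar> > \<epsilon>}|lborel. sel_plus_integrand a N u)"

definition sel_plus_exists :: "flat_germ \<Rightarrow> nat \<Rightarrow> bool" where
  "sel_plus_exists a N \<longleftrightarrow>
     (\<forall>\<epsilon>>0. set_integrable lborel {u. \<bar>u\<bar> > \<epsilon>} (sel_plus_integrand a N)) \<and>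
     (\<exists>l. (sel_plus_trunc a N \<longlongrightarrow> l) (at_right 0))"

definition sel_plus :: "flat_germ \<Rightarrow> nat \<Rightarrow> complex" where
  "sel_plus a N = Lim (at_right 0) (sel_plus_trunc a N)"

definition sel_minus_integrand :: "flat_germ \<Rightarrow> nat \<Rightarrow> real \<Rightarrow> complex" where
  "sel_minus_integrand a N u = bromwich a u * exp (of_nat N * of_real u) / (1 + exp (of_real u))"

definition sel_minus_exists :: "flat_germ \<Rightarrow> nat \<Rightarrow> bool" where
  "sel_minus_exists a N \<longleftrightarrow> integrable lborel (sel_minus_integrand a N)"

definition sel_minus :: "flat_germ \<Rightarrow> nat \<Rightarrow> complex" where
  "sel_minus a N = (LINT u|lborel. sel_minus_integrand a N u)"

definition admits_selector :: "phase_germ \<Rightarrow> bool" where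
  "admits_selector c \<longleftrightarrow>
     bromwich_admissible (phase_plus c) \<and> bromwich_admissible (phase_minus c) \<and>
     (\<forall>\<^sub>F N in sequentially. sel_plus_exists (phase_plus c) N \<and> sel_minus_exists (phase_minus c) N)"

definition selector :: "phase_germ \<Rightarrow> nat \<Rightarrow> complex" where
  "selector c N = sel_plus (phase_plus c) N + (-1) ^ N * sel_minus (phase_minus c) N"

section \<open>Admissible sequences and finite part\<close>

definition shift_nonresonant :: "(nat \<Rightarrow> complex) \<Rightarrow> bool" where
  "shift_nonresonant U \<longleftrightarrow>
     U \<longlonglongrightarrow> 0 \<or>
     (\<exists>\<epsilon>>0. \<forall>\<^sub>F N in sequentially. norm (U N - U (N + 1)) \<ge> \<epsilon> * norm (U N))"

definition eventually_const :: "(nat \<Rightarrow> complex) \<Rightarrow> bool" where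
  "eventually_const R \<longleftrightarrow> (\<forall>\<^sub>F N in sequentially. R N - R (N + 1) = 0)"

definition admissible_by :: "(nat \<Rightarrow> complex) \<Rightarrow> phase_germ \<Rightarrow> bool" where
  "admissible_by R c \<longleftrightarrow>
     is_phase_germ c \<and>
     (\<forall>\<^sub>F N in sequentially. phase_eval c (of_nat N) = R N - R (N + 1)) \<and>
     admits_selector c \<and> shift_nonresonant (selector c)"

definition admissible :: "(nat \<Rightarrow> complex) \<Rightarrow> bool" where
  "admissible R \<longleftrightarrow> eventually_const R \<or> (\<exists>c. admissible_by R c)"

definition finite_part :: "(nat \<Rightarrow> complex) \<Rightarrow> complex" where
  "finite_part R =
     (if eventually_const R then THE v. \<forall>\<^sub>F N in sequentially. R N = v
      else THE v. \<exists>c. admissible_by R c \<and> (\<forall>\<^sub>F N in sequentially. R N - selector c N = v))"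

section \<open>C-summation\<close>

definition recurrence_presentation ::
    "nat \<Rightarrow> (nat \<Rightarrow> complex) \<Rightarrow> (nat \<Rightarrow> complex) \<Rightarrow> (nat \<Rightarrow> complex) \<Rightarrow> (nat \<Rightarrow> complex) \<Rightarrow> bool" where
  "recurrence_presentation n\<^sub>0 a b \<mu> c \<longleftrightarrow>
     (\<forall>n\<ge>n\<^sub>0. a n \<noteq> 0 \<and> b n \<noteq> 0) \<and>
     (\<forall>k. c k = (-1) ^ k * \<mu> (n\<^sub>0 + k) * (\<Prod>j<k. b (n\<^sub>0 + j) / a (n\<^sub>0 + j + 1)))"

definition recurrence_solution ::
    "nat \<Rightarrow> (nat \<Rightarrow> complex) \<Rightarrow> (nat \<Rightarrow> complex) \<Rightarrow> (nat \<Rightarrow> complex) \<Rightarrow> (nat \<Rightarrow> complex) \<Rightarrow> bool" where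
  "recurrence_solution n\<^sub>0 a b \<mu> I \<longleftrightarrow> (\<forall>n\<ge>n\<^sub>0. a n * I n + b n * I (n + 1) = \<mu> n)"

definition normalized_tail ::
    "nat \<Rightarrow> (nat \<Rightarrow> complex) \<Rightarrow> (nat \<Rightarrow> complex) \<Rightarrow> (nat \<Rightarrow> complex) \<Rightarrow> nat \<Rightarrow> complex" where
  "normalized_tail n\<^sub>0 a b I N = a n\<^sub>0 * I (n\<^sub>0 + N) / (\<Prod>k=n\<^sub>0..<n\<^sub>0 + N. - a k / b k)"

definition C_summation_data ::
    "(nat \<Rightarrow> complex) \<Rightarrow> nat \<Rightarrow> (nat \<Rightarrow> complex) \<Rightarrow> (nat \<Rightarrow> complex) \<Rightarrow> (nat \<Rightarrow> complex) \<Rightarrow>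
     (nat \<Rightarrow> complex) \<Rightarrow> bool" where
  "C_summation_data c n\<^sub>0 a b \<mu> I \<longleftrightarrow>
     recurrence_presentation n\<^sub>0 a b \<mu> c \<and> recurrence_solution n\<^sub>0 a b \<mu> I \<and>
     admissible (normalized_tail n\<^sub>0 a b I)"

definition C_summable :: "(nat \<Rightarrow> complex) \<Rightarrow> bool" where
  "C_summable c \<longleftrightarrow> (\<exists>n\<^sub>0 a b \<mu> I. C_summation_data c n\<^sub>0 a b \<mu> I)"

definition C_sum :: "(nat \<Rightarrow> complex) \<Rightarrow> complex" where
  "C_sum c = (THE s. \<exists>n\<^sub>0 a b \<mu> I. C_summation_data c n\<^sub>0 a b \<mu> I \<and>
     s = a n\<^sub>0 * I n\<^sub>0 - finite_part (normalized_tail n\<^sub>0 a b I))"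

end

theory Submission
  imports Defs "HOL-Real_Asymp.Real_Asymp" "HOL-Probability.Probability"
begin

text \<open>
  With the constant presentation $a = b = 1$, $\mu_n = f(n)$, the recurrence $I_n + I_{n+1} = f(n)$ is
  solved by $I_n = \mathcal S_-[f](n)$, because Fourier inversion on vertical lines gives
  $f(n) = \int \Phi(u) e^{nu}\,du$ for all $n \ge 0$.  Its normalized tail is $(-1)^n I_n$, which is
  the selector of $e^{i\pi x} f$, so the finite part vanishes and the sum is
  $I_0 = \int \Phi(u)/(1+e^u)\,du$; by Fubini this is the Borel--Laplace integral.

  The sum does not depend on the presentation because a phase germ is determined by its values at
  large integers.  Any two growth monomials either have equal germs or are separated by an infinite
  ratio: the logarithm of the quotient of two log-exp monomials is a linear combination of monomials
  of smaller height and iterated logarithms, hence by induction it vanishes or tends to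
  $\pm\infty$; Stirling's formula brings in the gamma-type monomials.  So a combination
  $\sum_j (A_j + (-1)^N B_j) M_j(N)$ vanishing for large $N$ is trivial on the real axis, and by
  the identity theorem its continuation is trivial as well.
\<close>

section \<open>Comparability of log-exp monomials\<close>

text \<open>The values \<open>bromwich\<close>, \<open>finite_part\<close> and \<open>C_sum\<close>
  are definite descriptions, so using them takes uniqueness proofs, the deepest being that of the
  selector. For any presentation the normalized tail R and the selector U have the same increments
  a_N. So R - U is constant from N = 0 on, the finite part is R_0 - U_0, and subtracting it from
  R_0, the leading value in the definition of the sum, leaves U_0.

  A selector is computed from values on vertical lines, while admissibility fixes values at integers
  only; this is why the comparison passes from integers to the real axis and then to a half-plane.
  The obstacle is cancellation: two monomials whose quotient tends to a nonzero constant without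
  being equal could combine to a remainder of unknown size. Hence \<open>germ_cmp\<close> admits
  equal growth only for equal germs, a property that survives the passage to logarithms.

  In the variable u, the weight exp (\<rho> exp u) dominates, up to a constant, exp (x u) for every
  x >= 0 and exp (-t exp u) for norm t <= \<rho>. This makes the moments, the selector and the Borel
  integral converge.\<close>

definition germ_cmp :: "(real \<Rightarrow> real) \<Rightarrow> (real \<Rightarrow> real) \<Rightarrow> bool" where
  "germ_cmp f g \<longleftrightarrow>
     germ_eq f g \<or> ((\<lambda>x. f x / g x) \<longlongrightarrow> 0) at_top \<or> ((\<lambda>x. g x / f x) \<longlongrightarrow> 0) at_top"

lemma germ_eq_refl [simp]: "germ_eq f f"
  by (simp add: germ_eq_def)

lemma germ_eq_sym: "germ_eq f g \<Longrightarrow> germ_eq g f"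
  by (auto simp: germ_eq_def elim: eventually_mono)

lemma germ_cmp_refl [simp]: "germ_cmp f f"
  by (simp add: germ_cmp_def)

lemma germ_cmp_sym: "germ_cmp f g \<Longrightarrow> germ_cmp g f"
  by (auto simp: germ_cmp_def germ_eq_sym)

lemma germ_cmp_cong:
  assumes "germ_eq f f'" "germ_eq g g'" "germ_cmp f g"
  shows "germ_cmp f' g'"
proof -
  have eq: "\<forall>\<^sub>F x in at_top. f x = f' x \<and> g x = g' x"
    using assms(1,2) by (auto simp: germ_eq_def eventually_conj)
  have 1: "germ_eq f g = germ_eq f' g'"
    unfolding germ_eq_def by (intro eventually_cong[OF eq]) auto
  have 2: "((\<lambda>x. f x / g x) \<longlongrightarrow> 0) at_top = ((\<lambda>x. f' x / g' x) \<longlongrightarrow> 0) at_top"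
    using eq by (intro tendsto_cong) (auto elim: eventually_mono)
  have 3: "((\<lambda>x. g x / f x) \<longlongrightarrow> 0) at_top = ((\<lambda>x. g' x / f' x) \<longlongrightarrow> 0) at_top"
    using eq by (intro tendsto_cong) (auto elim: eventually_mono)
  show ?thesis using assms(3) 1 2 3 by (simp add: germ_cmp_def)
qed

text \<open>Growth is a total preorder on a family that is pairwise comparable, so a finite family
  has a maximum; a new germ either is dominated by the old maximum or takes its place.\<close>

lemma exists_dominant_germ:
  fixes m :: "'i \<Rightarrow> real \<Rightarrow> real"
  assumes "finite I" "I \<noteq> {}" "\<And>i. i \<in> I \<Longrightarrow> \<forall>\<^sub>F x in at_top. m i x > 0"
    and "\<And>i j. i \<in> I \<Longrightarrow> j \<in> I \<Longrightarrow> germ_cmp (m i) (m j)"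
  shows "\<exists>i\<in>I. \<forall>j\<in>I. germ_eq (m j) (m i) \<or> ((\<lambda>x. m j x / m i x) \<longlongrightarrow> 0) at_top"
  using assms
proof (induction I rule: finite_ne_induct)
  case (singleton i)
  then show ?case by simp
next
  case (insert k I)
  then obtain i where i: "i \<in> I"
    and dom: "\<And>j. j \<in> I \<Longrightarrow> germ_eq (m j) (m i) \<or> ((\<lambda>x. m j x / m i x) \<longlongrightarrow> 0) at_top"
    by (metis insertCI)
  consider "germ_eq (m k) (m i) \<or> ((\<lambda>x. m k x / m i x) \<longlongrightarrow> 0) at_top"
    | "((\<lambda>x. m i x / m k x) \<longlongrightarrow> 0) at_top"
    using insert.prems(2)[of k i] i by (auto simp: germ_cmp_def)
  then show ?case
  proof cases
    case 1
    then show ?thesis using i dom by blast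
  next
    case 2
    have "((\<lambda>x. m j x / m k x) \<longlongrightarrow> 0) at_top" if j: "j \<in> I" for j
      using dom[OF j]
    proof
      assume "germ_eq (m j) (m i)"
      then have "\<forall>\<^sub>F x in at_top. m i x / m k x = m j x / m k x"
        by (auto simp: germ_eq_def elim: eventually_mono)
      with 2 show ?thesis by (rule Lim_transform_eventually)
    next
      assume "((\<lambda>x. m j x / m i x) \<longlongrightarrow> 0) at_top"
      from tendsto_mult[OF this 2] have "((\<lambda>x. m j x / m i x * (m i x / m k x)) \<longlongrightarrow> 0) at_top"
        by simp
      moreover have "\<forall>\<^sub>F x in at_top. m j x / m i x * (m i x / m k x) = m j x / m k x"
        using insert.prems(1)[of i] i by (auto elim: eventually_mono)
      ultimately show ?thesis by (rule Lim_transform_eventually)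
    qed
    then show ?thesis by auto
  qed
qed

text \<open>Induction that discards one growth class at a time. The members equal to the dominant
  germ share one total coefficient: if it is nonzero it is the limit, otherwise the class cancels
  and a smaller family remains. Coefficients are vectors so that both phases of a germ can later be
  treated together.\<close>

lemma leading_term:
  fixes m :: "'i \<Rightarrow> real \<Rightarrow> real" and a :: "'i \<Rightarrow> 'v::real_normed_vector"
  assumes "finite I" "\<And>i. i \<in> I \<Longrightarrow> \<forall>\<^sub>F x in at_top. m i x > 0"
    and "\<And>i j. i \<in> I \<Longrightarrow> j \<in> I \<Longrightarrow> germ_cmp (m i) (m j)"
  shows "(\<forall>\<^sub>F x in at_top. (\<Sum>i\<in>I. m i x *\<^sub>R a i) = 0) \<or>
     (\<exists>i\<in>I. \<exists>v. v \<noteq> 0 \<and> ((\<lambda>x. (\<Sum>j\<in>I. m j x *\<^sub>R a j) /\<^sub>R m i x) \<longlongrightarrow> v) at_top)"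
  using assms
proof (induction I rule: finite_psubset_induct)
  case (psubset I)
  show ?case
  proof (cases "I = {}")
    case True
    then show ?thesis by simp
  next
    case False
    have "\<exists>i\<in>I. \<forall>j\<in>I. germ_eq (m j) (m i) \<or> ((\<lambda>x. m j x / m i x) \<longlongrightarrow> 0) at_top"
      by (rule exists_dominant_germ[OF psubset.hyps(1) False psubset.prems])
    then obtain i where i: "i \<in> I"
      and dom: "\<And>j. j \<in> I \<Longrightarrow> germ_eq (m j) (m i) \<or> ((\<lambda>x. m j x / m i x) \<longlongrightarrow> 0) at_top"
      by blast
    define E where "E = {j \<in> I. germ_eq (m j) (m i)}"
    define A where "A = (\<Sum>j\<in>E. a j)"
    have E: "E \<subseteq> I" "i \<in> E" "finite E" using i psubset.hyps(1) by (auto simp: E_def)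
    have pos: "\<forall>\<^sub>F x in at_top. m i x > 0" by (rule psubset.prems(1)[OF i])
    have "((\<lambda>x. (m j x / m i x) *\<^sub>R a j) \<longlongrightarrow> (if j \<in> E then 1 else 0) *\<^sub>R a j) at_top" if j: "j \<in> I" for j
    proof (cases "j \<in> E")
      case True
      then have "\<forall>\<^sub>F x in at_top. m j x = m i x" by (simp add: E_def germ_eq_def)
      with pos have "\<forall>\<^sub>F x in at_top. 1 = m j x / m i x" by eventually_elim auto
      with tendsto_const have "((\<lambda>x. m j x / m i x) \<longlongrightarrow> 1) at_top" by (rule Lim_transform_eventually)
      from tendsto_scaleR[OF this tendsto_const] True show ?thesis by simp
    next
      case False
      with dom[OF j] j have "((\<lambda>x. m j x / m i x) \<longlongrightarrow> 0) at_top" by (simp add: E_def)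
      from tendsto_scaleR[OF this tendsto_const] False show ?thesis by simp
    qed
    then have "((\<lambda>x. \<Sum>j\<in>I. (m j x / m i x) *\<^sub>R a j) \<longlongrightarrow> (\<Sum>j\<in>I. (if j \<in> E then 1 else 0) *\<^sub>R a j)) at_top"
      by (rule tendsto_sum)
    also have "(\<Sum>j\<in>I. (if j \<in> E then 1 else 0) *\<^sub>R a j) = A"
      unfolding A_def using E psubset.hyps(1) by (intro sum.mono_neutral_cong_right) auto
    also have "(\<lambda>x. \<Sum>j\<in>I. (m j x / m i x) *\<^sub>R a j) = (\<lambda>x. (\<Sum>j\<in>I. m j x *\<^sub>R a j) /\<^sub>R m i x)"
      by (simp add: scaleR_sum_right divide_inverse_commute)
    finally have lim: "((\<lambda>x. (\<Sum>j\<in>I. m j x *\<^sub>R a j) /\<^sub>R m i x) \<longlongrightarrow> A) at_top" .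
    show ?thesis
    proof (cases "A = 0")
      case False
      with lim i show ?thesis by blast
    next
      case True
      \<comment> \<open>Members of \<open>E\<close> are eventually equal to \<open>m i\<close>, so a
        vanishing coefficient sum removes them exactly; a quotient merely tending to 1 would leave a
        remainder.\<close>
      have "\<forall>\<^sub>F x in at_top. \<forall>j\<in>E. m j x = m i x"
        using E(3) by (rule eventually_ball_finite) (auto simp: E_def germ_eq_def)
      then have ev: "\<forall>\<^sub>F x in at_top. (\<Sum>j\<in>I. m j x *\<^sub>R a j) = (\<Sum>j\<in>I - E. m j x *\<^sub>R a j)"
      proof eventually_elim
        case (elim x)
        have "(\<Sum>j\<in>E. m j x *\<^sub>R a j) = m i x *\<^sub>R A"
          using elim by (simp add: A_def scaleR_sum_right)
        with True have "(\<Sum>j\<in>E. m j x *\<^sub>R a j) = 0" by simp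
        then show ?case using sum.subset_diff[OF E(1) psubset.hyps(1), of "\<lambda>j. m j x *\<^sub>R a j"] by simp
      qed
      have "I - E \<subset> I" using E by blast
      then have "(\<forall>\<^sub>F x in at_top. (\<Sum>i\<in>I - E. m i x *\<^sub>R a i) = 0) \<or>
        (\<exists>i\<in>I - E. \<exists>v. v \<noteq> 0 \<and> ((\<lambda>x. (\<Sum>j\<in>I - E. m j x *\<^sub>R a j) /\<^sub>R m i x) \<longlongrightarrow> v) at_top)"
        by (rule psubset.IH) (auto intro: psubset.prems)
      then consider "\<forall>\<^sub>F x in at_top. (\<Sum>i\<in>I - E. m i x *\<^sub>R a i) = 0"
        | k v where "k \<in> I - E" "v \<noteq> 0" "((\<lambda>x. (\<Sum>j\<in>I - E. m j x *\<^sub>R a j) /\<^sub>R m k x) \<longlongrightarrow> v) at_top"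
        by blast
      then show ?thesis
      proof cases
        case 1
        with ev have "\<forall>\<^sub>F x in at_top. (\<Sum>j\<in>I. m j x *\<^sub>R a j) = 0" by eventually_elim simp
        then show ?thesis by blast
      next
        case 2
        have "\<forall>\<^sub>F x in at_top. (\<Sum>j\<in>I - E. m j x *\<^sub>R a j) /\<^sub>R m k x = (\<Sum>j\<in>I. m j x *\<^sub>R a j) /\<^sub>R m k x"
          using ev by eventually_elim simp
        with 2(3) have "((\<lambda>x. (\<Sum>j\<in>I. m j x *\<^sub>R a j) /\<^sub>R m k x) \<longlongrightarrow> v) at_top"
          by (rule Lim_transform_eventually)
        with 2 show ?thesis by blast
      qed
    qed
  qed
qed

text \<open>A list may repeat a monomial, so the positions in the list serve as index set.\<close>

lemma leading_term_list:
  fixes xs :: "((real \<Rightarrow> real) \<times> 'v::real_normed_vector) list"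
  assumes pos: "\<And>m. m \<in> fst ` set xs \<Longrightarrow> \<forall>\<^sub>F x in at_top. m x > 0"
    and cmp: "\<And>m m'. m \<in> fst ` set xs \<Longrightarrow> m' \<in> fst ` set xs \<Longrightarrow> germ_cmp m m'"
  shows "(\<forall>\<^sub>F x in at_top. (\<Sum>(m, a)\<leftarrow>xs. m x *\<^sub>R a) = 0) \<or>
     (\<exists>m\<in>fst ` set xs. \<exists>v. v \<noteq> 0 \<and> ((\<lambda>x. (\<Sum>(m, a)\<leftarrow>xs. m x *\<^sub>R a) /\<^sub>R m x) \<longlongrightarrow> v) at_top)"
proof -
  have eq: "(\<Sum>(m, a)\<leftarrow>xs. m x *\<^sub>R a) = (\<Sum>i<length xs. fst (xs ! i) x *\<^sub>R snd (xs ! i))" for x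
    unfolding sum_list_sum_nth by (rule sum.cong) (auto simp: case_prod_unfold)
  have fst: "fst (xs ! i) \<in> fst ` set xs" if "i \<in> {..<length xs}" for i
    using that by simp
  have "(\<forall>\<^sub>F x in at_top. (\<Sum>i<length xs. fst (xs ! i) x *\<^sub>R snd (xs ! i)) = 0) \<or>
     (\<exists>i\<in>{..<length xs}. \<exists>v. v \<noteq> 0 \<and>
       ((\<lambda>x. (\<Sum>j<length xs. fst (xs ! j) x *\<^sub>R snd (xs ! j)) /\<^sub>R fst (xs ! i) x) \<longlongrightarrow> v) at_top)"
    by (rule leading_term) (use pos[OF fst] cmp[OF fst fst] in auto)
  then consider (zero) "\<forall>\<^sub>F x in at_top. (\<Sum>i<length xs. fst (xs ! i) x *\<^sub>R snd (xs ! i)) = 0"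
    | (lead) i v where "i \<in> {..<length xs}" "v \<noteq> 0"
       "((\<lambda>x. (\<Sum>j<length xs. fst (xs ! j) x *\<^sub>R snd (xs ! j)) /\<^sub>R fst (xs ! i) x) \<longlongrightarrow> v) at_top"
    by (elim disjE bexE exE conjE)
  then show ?thesis
  proof cases
    case zero
    then show ?thesis unfolding eq by (rule disjI1)
  next
    case lead
    from lead(2,3) fst[OF lead(1)] show ?thesis unfolding eq
      by (intro disjI2 bexI[of _ "fst (xs ! i)"] exI[of _ v] conjI)
  qed
qed

section \<open>Finite linear combinations of germs up to eventual equality\<close>

definition germ_span :: "((real \<Rightarrow> real) \<Rightarrow> bool) \<Rightarrow> (real \<Rightarrow> real) \<Rightarrow> bool" where
  "germ_span P f \<longleftrightarrow> (\<exists>xs :: ((real \<Rightarrow> real) \<times> real) list.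
     (\<forall>m\<in>fst ` set xs. P m) \<and> (\<forall>\<^sub>F x in at_top. f x = (\<Sum>(m, c)\<leftarrow>xs. m x * c)))"

lemma germ_span_mono: "germ_span P f \<Longrightarrow> (\<And>m. P m \<Longrightarrow> Q m) \<Longrightarrow> germ_span Q f"
  unfolding germ_span_def by fast

lemma germ_span_cong:
  assumes "germ_span P f" "\<forall>\<^sub>F x in at_top. g x = f x"
  shows "germ_span P g"
proof -
  from assms(1) obtain xs :: "((real \<Rightarrow> real) \<times> real) list" where P: "\<forall>m\<in>fst ` set xs. P m"
    and f: "\<forall>\<^sub>F x in at_top. f x = (\<Sum>(m, c)\<leftarrow>xs. m x * c)"
    unfolding germ_span_def by (elim exE conjE)
  from assms(2) f have "\<forall>\<^sub>F x in at_top. g x = (\<Sum>(m, c)\<leftarrow>xs. m x * c)"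
    by eventually_elim simp
  with P show ?thesis unfolding germ_span_def by (intro exI conjI)
qed

lemma germ_span_zero: "germ_span P (\<lambda>_. 0)"
  unfolding germ_span_def by (rule exI[of _ "[]"]) simp

lemma germ_span_base: "P m \<Longrightarrow> germ_span P m"
  unfolding germ_span_def by (rule exI[of _ "[(m, 1)]"]) simp

lemma germ_span_add:
  assumes "germ_span P f" "germ_span P g"
  shows "germ_span P (\<lambda>x. f x + g x)"
proof -
  from assms(1) obtain xs :: "((real \<Rightarrow> real) \<times> real) list" where xs: "\<forall>m\<in>fst ` set xs. P m"
    and f: "\<forall>\<^sub>F x in at_top. f x = (\<Sum>(m, c)\<leftarrow>xs. m x * c)"
    unfolding germ_span_def by (elim exE conjE)
  from assms(2) obtain ys :: "((real \<Rightarrow> real) \<times> real) list" where ys: "\<forall>m\<in>fst ` set ys. P m"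
    and g: "\<forall>\<^sub>F x in at_top. g x = (\<Sum>(m, c)\<leftarrow>ys. m x * c)"
    unfolding germ_span_def by (elim exE conjE)
  from f g have "\<forall>\<^sub>F x in at_top. f x + g x = (\<Sum>(m, c)\<leftarrow>xs @ ys. m x * c)"
    by eventually_elim simp
  moreover have "\<forall>m\<in>fst ` set (xs @ ys). P m" using xs ys by auto
  ultimately show ?thesis unfolding germ_span_def by (intro exI conjI)
qed

lemma germ_span_cmult:
  assumes "germ_span P f"
  shows "germ_span P (\<lambda>x. c * f x)"
proof -
  from assms obtain xs :: "((real \<Rightarrow> real) \<times> real) list" where xs: "\<forall>m\<in>fst ` set xs. P m"
    and f: "\<forall>\<^sub>F x in at_top. f x = (\<Sum>(m, c)\<leftarrow>xs. m x * c)"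
    unfolding germ_span_def by (elim exE conjE)
  let ?ys = "map (\<lambda>(m, d). (m, c * d)) xs"
  have "c * (\<Sum>(m, d)\<leftarrow>xs. m x * d) = (\<Sum>(m, d)\<leftarrow>?ys. m x * d)" for x
    by (induction xs) (auto simp: algebra_simps)
  with f have "\<forall>\<^sub>F x in at_top. c * f x = (\<Sum>(m, d)\<leftarrow>?ys. m x * d)"
    by (auto elim!: eventually_mono)
  moreover have "\<forall>m\<in>fst ` set ?ys. P m" using xs by force
  ultimately show ?thesis unfolding germ_span_def by (intro exI conjI)
qed

lemma germ_span_diff:
  assumes "germ_span P f" "germ_span P g"
  shows "germ_span P (\<lambda>x. f x - g x)"
  using germ_span_add[OF assms(1) germ_span_cmult[OF assms(2), of "-1"]] by simp

lemma germ_span_sum_list: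
  "(\<And>y. y \<in> set ys \<Longrightarrow> germ_span P (f y)) \<Longrightarrow> germ_span P (\<lambda>x. \<Sum>y\<leftarrow>ys. f y x)"
  by (induction ys) (auto intro!: germ_span_add germ_span_zero)

lemma germ_span_sum:
  "finite I \<Longrightarrow> (\<And>i. i \<in> I \<Longrightarrow> germ_span P (f i)) \<Longrightarrow> germ_span P (\<lambda>x. \<Sum>i\<in>I. f i x)"
  by (induction I rule: finite_induct) (auto intro!: germ_span_add germ_span_zero)

text \<open>A combination that is not eventually 0 behaves like v m with v nonzero and m in the
  family; as m tends to infinity, the sign of v decides the direction.\<close>

lemma germ_span_trichotomy:
  assumes lim: "\<And>m. P m \<Longrightarrow> filterlim m at_top at_top"
    and cmp: "\<And>m m'. P m \<Longrightarrow> P m' \<Longrightarrow> germ_cmp m m'"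
    and D: "germ_span P D"
  shows "(\<forall>\<^sub>F x in at_top. D x = 0) \<or> filterlim D at_top at_top \<or> filterlim D at_bot at_top"
proof -
  from D obtain xs :: "((real \<Rightarrow> real) \<times> real) list" where P: "\<And>m. m \<in> fst ` set xs \<Longrightarrow> P m"
    and D: "\<forall>\<^sub>F x in at_top. D x = (\<Sum>(m, c)\<leftarrow>xs. m x * c)"
    unfolding germ_span_def by auto
  have pos: "\<forall>\<^sub>F x in at_top. m x > 0" if "m \<in> fst ` set xs" for m
    using lim[OF P[OF that]] by (simp add: filterlim_at_top_dense)
  have "(\<forall>\<^sub>F x in at_top. (\<Sum>(m, c)\<leftarrow>xs. m x *\<^sub>R c) = 0) \<or>
     (\<exists>m\<in>fst ` set xs. \<exists>v. v \<noteq> 0 \<and> ((\<lambda>x. (\<Sum>(m, c)\<leftarrow>xs. m x *\<^sub>R c) /\<^sub>R m x) \<longlongrightarrow> v) at_top)"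
    by (rule leading_term_list[OF pos cmp[OF P P]])
  then show ?thesis
  proof (elim disjE bexE exE conjE)
    assume "\<forall>\<^sub>F x in at_top. (\<Sum>(m, c)\<leftarrow>xs. m x *\<^sub>R c) = 0"
    with D have "\<forall>\<^sub>F x in at_top. D x = 0" by eventually_elim simp
    then show ?thesis by (rule disjI1)
  next
    fix m v
    assume m: "m \<in> fst ` set xs" and v: "v \<noteq> 0"
      and m_lim: "((\<lambda>x. (\<Sum>(m, c)\<leftarrow>xs. m x *\<^sub>R c) /\<^sub>R m x) \<longlongrightarrow> v) at_top"
    have "\<forall>\<^sub>F x in at_top. (\<Sum>(m, c)\<leftarrow>xs. m x *\<^sub>R c) /\<^sub>R m x * m x = D x"
      using D pos[OF m] by eventually_elim simp
    then have ev: "filterlim (\<lambda>x. (\<Sum>(m, c)\<leftarrow>xs. m x *\<^sub>R c) /\<^sub>R m x * m x) F at_top = filterlim D F at_top" for F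
      by (rule filterlim_cong[OF refl refl])
    show ?thesis
    proof (cases "v > 0")
      case True
      from filterlim_tendsto_pos_mult_at_top[OF m_lim True lim[OF P[OF m]]]
      have "filterlim D at_top at_top" by (simp only: ev)
      then show ?thesis by (intro disjI2 disjI1)
    next
      case False
      with v have "v < 0" by simp
      from filterlim_tendsto_neg_mult_at_bot[OF m_lim this lim[OF P[OF m]]]
      have "filterlim D at_bot at_top" by (simp only: ev)
      then show ?thesis by (intro disjI2)
    qed
  qed
qed

text \<open>An infinite gap between logarithms becomes an infinite ratio, and an exact tie becomes
  equality of germs.\<close>

lemma germ_cmp_of_ln_diff:
  assumes pos: "\<forall>\<^sub>F x in at_top. f x > 0" "\<forall>\<^sub>F x in at_top. g x > 0"
    and D: "(\<forall>\<^sub>F x in at_top. ln (f x) - ln (g x) = 0) \<or> filterlim (\<lambda>x. ln (f x) - ln (g x)) at_top at_top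
      \<or> filterlim (\<lambda>x. ln (f x) - ln (g x)) at_bot at_top"
  shows "germ_cmp f g"
proof -
  have e: "\<forall>\<^sub>F x in at_top. exp (ln (f x) - ln (g x)) = f x / g x"
    "\<forall>\<^sub>F x in at_top. exp (- (ln (f x) - ln (g x))) = g x / f x"
    using pos by (eventually_elim, simp add: exp_diff)+
  from D consider "\<forall>\<^sub>F x in at_top. ln (f x) - ln (g x) = 0"
    | "filterlim (\<lambda>x. ln (f x) - ln (g x)) at_top at_top"
    | "filterlim (\<lambda>x. ln (f x) - ln (g x)) at_bot at_top" by blast
  then show ?thesis
  proof cases
    case 1
    with pos have "\<forall>\<^sub>F x in at_top. f x = g x" by eventually_elim simp
    then show ?thesis by (simp add: germ_cmp_def germ_eq_def)
  next
    case 2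
    then have "filterlim (\<lambda>x. - (ln (f x) - ln (g x))) at_bot at_top"
      by (simp add: filterlim_uminus_at_top)
    with exp_at_bot have "((\<lambda>x. exp (- (ln (f x) - ln (g x)))) \<longlongrightarrow> 0) at_top"
      by (rule filterlim_compose)
    with e(2) show ?thesis by (auto simp: germ_cmp_def intro: Lim_transform_eventually)
  next
    case 3
    with exp_at_bot have "((\<lambda>x. exp (ln (f x) - ln (g x))) \<longlongrightarrow> 0) at_top"
      by (rule filterlim_compose)
    with e(1) show ?thesis by (auto simp: germ_cmp_def intro: Lim_transform_eventually)
  qed
qed

section \<open>Iterated logarithms\<close>

lemma iter_ln_at_top: "filterlim (iter_ln j :: real \<Rightarrow> real) at_top at_top"
proof (induction j)
  case 0
  then show ?case by (simp add: filterlim_ident)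
next
  case (Suc j)
  from filterlim_compose[OF ln_at_top this] show ?case by simp
qed

lemma eventually_iter_ln_gt: "\<forall>\<^sub>F x::real in at_top. iter_ln j x > c"
  using iter_ln_at_top by (simp add: filterlim_at_top_dense)

lemma iter_ln_add: "iter_ln (i + j) x = iter_ln i (iter_ln j x)"
  by (induction i) auto

lemma iter_ln_over_id: "((\<lambda>x::real. iter_ln (Suc j) x / x) \<longlongrightarrow> 0) at_top"
proof (induction j)
  case 0
  have "((\<lambda>x::real. ln x / x) \<longlongrightarrow> 0) at_top" by real_asymp
  then show ?case by simp
next
  case (Suc j)
  have "((\<lambda>x::real. ln x / x) \<longlongrightarrow> 0) at_top" by real_asymp
  from filterlim_compose[OF this iter_ln_at_top[of "Suc j"]]
  have "((\<lambda>x::real. ln (iter_ln (Suc j) x) / iter_ln (Suc j) x) \<longlongrightarrow> 0) at_top" .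
  from tendsto_mult[OF this Suc]
  have "((\<lambda>x::real. ln (iter_ln (Suc j) x) / iter_ln (Suc j) x * (iter_ln (Suc j) x / x)) \<longlongrightarrow> 0) at_top"
    by simp
  moreover have "\<forall>\<^sub>F x::real in at_top. ln (iter_ln (Suc j) x) / iter_ln (Suc j) x * (iter_ln (Suc j) x / x)
      = iter_ln (Suc (Suc j)) x / x"
    using eventually_iter_ln_gt[of 0 "Suc j"] by eventually_elim simp
  ultimately show ?case by (rule Lim_transform_eventually)
qed

lemma iter_ln_cmp: "germ_cmp (iter_ln i) (iter_ln j)"
proof -
  have *: "germ_cmp (iter_ln i) (iter_ln j)" if "i < j" for i j
  proof -
    have "\<exists>k. j = Suc k + i" using that by presburger
    then obtain k where "j = Suc k + i" by (elim exE)
    with filterlim_compose[OF iter_ln_over_id[of k] iter_ln_at_top[of i]]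
    have "((\<lambda>x. iter_ln j x / iter_ln i x :: real) \<longlongrightarrow> 0) at_top"
      by (simp only: iter_ln_add)
    then show ?thesis by (simp add: germ_cmp_def)
  qed
  show ?thesis using *[of i j] germ_cmp_sym[OF *[of j i]] by (cases i j rule: linorder_cases) auto
qed

text \<open>Logarithms of monomials bring in bare iterated logarithms. Written as monomials of
  height 0, these can be compared with other monomials inside the height induction.\<close>

lemma iter_ln_as_logexp:
  obtains L where "is_logexp_height 0 L" "germ_eq (iter_ln j) (logexp_eval L)"
proof
  let ?L = "LogExp [] (replicate j 0 @ [1])"
  show "is_logexp_height 0 ?L" by (rule is_logexp_height.zero)
  \<comment> \<open>Since \<open>0 powr 0 = 0\<close>, the factors with exponent 0 are 1 only where
    the lower iterated logarithms do not vanish.\<close>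
  have "\<forall>\<^sub>F x::real in at_top. \<forall>i\<in>{..j}. iter_ln i x > 0"
    by (rule eventually_ball_finite) (auto intro: eventually_iter_ln_gt)
  then have "\<forall>\<^sub>F x::real in at_top. iter_ln j x = logexp_eval ?L x"
  proof eventually_elim
    case (elim x)
    have nz: "iter_ln i x \<noteq> 0" "iter_ln i x > 0" if "i \<le> j" for i
      using bspec[OF elim, of i] that by simp_all
    have "(\<Prod>i<j. iter_ln i x powr ((replicate j 0 @ [1]) ! i)) = 1"
      by (intro prod.neutral) (auto simp: nth_append nz)
    then show ?case using nz(2)[of j] by (simp add: nth_append)
  qed
  then show "germ_eq (iter_ln j) (logexp_eval ?L)" by (simp add: germ_eq_def)
qed

section \<open>Logarithms of log-exp monomials and induction on the height\<close>

lemma logexp_pos: "\<forall>\<^sub>F x::real in at_top. logexp_eval L x > 0"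
proof (cases L)
  case (LogExp \<Phi> \<alpha>)
  have "\<forall>\<^sub>F x::real in at_top. \<forall>i\<in>{..<length \<alpha>}. iter_ln i x > 0"
    by (rule eventually_ball_finite) (auto intro: eventually_iter_ln_gt)
  then show ?thesis
    by eventually_elim (auto simp: LogExp intro!: mult_pos_pos prod_pos dest: bspec)
qed

lemma ln_logexp_span:
  assumes c: "\<And>c M. (c, M) \<in> set \<Phi> \<Longrightarrow> P (logexp_eval M)" and l: "\<And>j. P (iter_ln j)"
  shows "germ_span P (\<lambda>x. ln (logexp_eval (LogExp \<Phi> \<alpha>) x))"
proof (rule germ_span_cong)
  show "germ_span P (\<lambda>x. (\<Sum>y\<leftarrow>\<Phi>. fst y * logexp_eval (snd y) x) +
      (\<Sum>j<length \<alpha>. \<alpha> ! j * iter_ln (Suc j) x))"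
    using c by (intro germ_span_add germ_span_sum_list germ_span_sum germ_span_cmult germ_span_base l) auto
  have "\<forall>\<^sub>F x::real in at_top. \<forall>i\<in>{..<length \<alpha>}. iter_ln i x > 0"
    by (rule eventually_ball_finite) (auto intro: eventually_iter_ln_gt)
  then show "\<forall>\<^sub>F x in at_top. ln (logexp_eval (LogExp \<Phi> \<alpha>) x) =
      (\<Sum>y\<leftarrow>\<Phi>. fst y * logexp_eval (snd y) x) + (\<Sum>j<length \<alpha>. \<alpha> ! j * iter_ln (Suc j) x)"
  proof eventually_elim
    case (elim x)
    have nz: "iter_ln i x \<noteq> 0" "iter_ln i x > 0" if "i < length \<alpha>" for i
      using bspec[OF elim, of i] that by simp_all
    have "ln (\<Prod>j<length \<alpha>. iter_ln j x powr \<alpha> ! j) = (\<Sum>j<length \<alpha>. ln (iter_ln j x powr \<alpha> ! j))"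
      by (intro ln_prod) (auto simp: nz)
    also have "\<dots> = (\<Sum>j<length \<alpha>. \<alpha> ! j * iter_ln (Suc j) x)"
      by (intro sum.cong) (auto simp: ln_powr nz)
    finally have "ln (\<Prod>j<length \<alpha>. iter_ln j x powr \<alpha> ! j) = (\<Sum>j<length \<alpha>. \<alpha> ! j * iter_ln (Suc j) x)" .
    moreover have "(\<Prod>j<length \<alpha>. iter_ln j x powr \<alpha> ! j) > 0"
      by (intro prod_pos) (auto simp: nz)
    moreover have "ln (exp S * Q) = S + ln Q" if "Q > 0" for S Q :: real
      using that by (subst ln_mult) simp_all
    ultimately show ?case by (simp only: logexp_eval.simps of_real_eq_id id_apply case_prod_unfold)
  qed
qed

definition lower_monomial :: "nat \<Rightarrow> (real \<Rightarrow> real) \<Rightarrow> bool" where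
  "lower_monomial n m \<longleftrightarrow> filterlim m at_top at_top \<and>
     ((\<exists>j. m = iter_ln j) \<or> (\<exists>p M. p < n \<and> is_logexp_height p M \<and> m = logexp_eval M))"

lemma lower_monomial_mono: "lower_monomial p m \<Longrightarrow> p \<le> n \<Longrightarrow> lower_monomial n m"
  unfolding lower_monomial_def by (auto dest: less_le_trans)

lemma ln_logexp_lower_span:
  assumes "is_logexp_height q L"
  shows "germ_span (lower_monomial q) (\<lambda>x. ln (logexp_eval L x))"
  using assms
proof cases
  case (zero \<alpha>)
  show ?thesis unfolding zero
    by (rule ln_logexp_span) (auto simp: lower_monomial_def intro: iter_ln_at_top)
next
  case (Suc \<Phi> h \<alpha>)
  show ?thesis unfolding Suc(2)
  proof (rule ln_logexp_span)
    show "lower_monomial q (iter_ln j)" for j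
      by (auto simp: lower_monomial_def intro: iter_ln_at_top)
    fix c M assume M: "(c, M) \<in> set \<Phi>"
    from Suc(4)[OF M] obtain p where "p \<le> h" and p: "is_logexp_height p M" by (elim exE conjE)
    then have "p < q" using Suc(1) by simp
    with p show "lower_monomial q (logexp_eval M)"
      unfolding lower_monomial_def by (intro conjI[OF Suc(5)[OF M]] disjI2 exI[of _ p] exI[of _ M] conjI) simp_all
  qed
qed

lemma logexp_height_cmp:
  assumes "is_logexp_height q L" "is_logexp_height q' L'" "q \<le> n" "q' \<le> n"
  shows "germ_cmp (logexp_eval L) (logexp_eval L')"
  using assms
proof (induction n arbitrary: q q' L L' rule: less_induct)
  case (less n)
  note IH = less.IH
  \<comment> \<open>As \<open>p < n\<close>, the induction hypothesis at \<open>p\<close> covers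
    this pair once \<open>iter_ln j\<close> is replaced by a monomial of height 0. Two iterated
    logarithms are compared directly instead, because at n = 0 no induction hypothesis is
    available.\<close>
  have mixed: "germ_cmp (iter_ln j) (logexp_eval M)" if M: "p < n" "is_logexp_height p M" for j p M
  proof -
    obtain K where K: "is_logexp_height 0 K" "germ_eq (iter_ln j) (logexp_eval K)"
      by (rule iter_ln_as_logexp)
    have "germ_cmp (logexp_eval K) (logexp_eval M)" by (rule IH[OF M(1) K(1) M(2)]) simp_all
    then show ?thesis by (rule germ_cmp_cong[OF germ_eq_sym[OF K(2)] germ_eq_refl])
  qed
  have cmp: "germ_cmp m m'" if m: "lower_monomial n m" "lower_monomial n m'" for m m'
    using m[THEN lower_monomial_def[THEN iffD1], THEN conjunct2]
  proof (elim disjE exE conjE)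
    show ?thesis if "m = iter_ln i" "m' = iter_ln j" for i j
      unfolding that by (rule iter_ln_cmp)
    show ?thesis if "p < n" "is_logexp_height p M" "m = logexp_eval M" "m' = iter_ln j" for p M j
      unfolding that by (rule germ_cmp_sym[OF mixed[OF that(1,2)]])
    show ?thesis if "p < n" "is_logexp_height p M" "m' = logexp_eval M" "m = iter_ln j" for p M j
      unfolding that by (rule mixed[OF that(1,2)])
    show ?thesis if "p < n" "is_logexp_height p M" "m = logexp_eval M"
      "p' < n" "is_logexp_height p' M'" "m' = logexp_eval M'" for p M p' M'
      unfolding that by (rule IH[OF _ that(2,5), of "max p p'"]) (use that(1,4) in auto)
  qed
  show ?case
  proof (rule germ_cmp_of_ln_diff[OF logexp_pos logexp_pos], rule germ_span_trichotomy)
    show "germ_span (lower_monomial n) (\<lambda>x. ln (logexp_eval L x) - ln (logexp_eval L' x))"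
      by (intro germ_span_diff germ_span_mono[OF ln_logexp_lower_span[OF less.prems(1)]]
          germ_span_mono[OF ln_logexp_lower_span[OF less.prems(2)]])
        (use lower_monomial_mono less.prems in blast)+
  qed (simp add: lower_monomial_def, rule cmp)
qed

theorem logexp_cmp:
  assumes "is_logexp L" "is_logexp L'"
  shows "germ_cmp (logexp_eval L) (logexp_eval L')"
proof -
  obtain q q' where "is_logexp_height q L" "is_logexp_height q' L'"
    using assms by (auto simp: is_logexp_def)
  then show ?thesis by (rule logexp_height_cmp[of _ _ _ _ "max q q'"]) simp_all
qed

text \<open>The counterpart of \<open>lower_monomial\<close> once all heights are known to be
  comparable. Membership is up to \<open>germ_eq\<close>, so that x ln x, ln x and x itself qualify
  without being evaluations of expressions.\<close>

definition log_monomial :: "(real \<Rightarrow> real) \<Rightarrow> bool" where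
  "log_monomial m \<longleftrightarrow> filterlim m at_top at_top \<and> (\<exists>L. is_logexp L \<and> germ_eq m (logexp_eval L))"

lemma log_monomial_cmp:
  assumes "log_monomial m" "log_monomial m'"
  shows "germ_cmp m m'"
proof -
  obtain L L' where L: "is_logexp L" "germ_eq m (logexp_eval L)"
    and L': "is_logexp L'" "germ_eq m' (logexp_eval L')"
    using assms by (auto simp: log_monomial_def)
  show ?thesis
    by (rule germ_cmp_cong[OF germ_eq_sym[OF L(2)] germ_eq_sym[OF L'(2)] logexp_cmp[OF L(1) L'(1)]])
qed

lemma log_monomial_iter_ln: "log_monomial (iter_ln j)"
proof -
  obtain K where "is_logexp_height 0 K" "germ_eq (iter_ln j) (logexp_eval K)"
    by (rule iter_ln_as_logexp)
  then show ?thesis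
    unfolding log_monomial_def is_logexp_def using iter_ln_at_top by blast
qed

lemma ln_logexp_log_monomial_span:
  assumes "is_logexp L"
  shows "germ_span log_monomial (\<lambda>x. ln (logexp_eval L x))"
proof -
  obtain q where q: "is_logexp_height q L" using assms by (auto simp: is_logexp_def)
  show ?thesis
  proof (rule germ_span_mono[OF ln_logexp_lower_span[OF q]])
    fix m assume m: "lower_monomial q m"
    from m[THEN lower_monomial_def[THEN iffD1], THEN conjunct2] show "log_monomial m"
    proof (elim disjE exE conjE)
      show ?thesis if "m = iter_ln j" for j unfolding that by (rule log_monomial_iter_ln)
      show ?thesis if M: "is_logexp_height p M" "m = logexp_eval M" for p M
      proof -
        have "is_logexp M" using M(1) by (auto simp: is_logexp_def)
        with m M(2) show ?thesis by (auto simp: lower_monomial_def log_monomial_def intro!: exI[of _ M])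
      qed
    qed
  qed
qed

section \<open>Comparability of growth monomials\<close>

lemma Digamma_ln_bounds:
  fixes x :: real
  assumes "x > 0"
  shows "Digamma x \<le> ln x" "ln x \<le> Digamma x + 1 / x"
proof -
  \<comment> \<open>The left side equals ln x, so \<open>Digamma \<xi> = ln x\<close>; monotonicity
    of Digamma along x, \<xi>, x + 1 then yields both bounds.\<close>
  have "\<exists>\<xi>>x. \<xi> < x + 1 \<and> ln_Gamma (x + 1) - ln_Gamma x = (x + 1 - x) * Digamma \<xi>"
    by (rule MVT2) (use assms in \<open>auto intro!: derivative_eq_intros\<close>)
  then obtain \<xi> where \<xi>: "x < \<xi>" "\<xi> < x + 1" "ln_Gamma (x + 1) - ln_Gamma x = Digamma \<xi>"
    by auto
  have "x \<notin> \<int>\<^sub>\<le>\<^sub>0" using assms by (auto elim!: nonpos_Ints_cases)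
  then have "Gamma (x + 1) = x * Gamma x" by (rule Gamma_plus1)
  moreover have "Gamma x \<noteq> 0" using Gamma_real_pos[OF assms] by linarith
  ultimately have "ln_Gamma (x + 1) - ln_Gamma x = ln x"
    using assms by (simp add: ln_Gamma_real_pos ln_mult)
  with \<xi>(3) have eq: "Digamma \<xi> = ln x" by simp
  show "Digamma x \<le> ln x"
    using Digamma_real_mono[of x \<xi>] \<xi> assms eq by simp
  have "Digamma (x + 1) = Digamma x + 1 / x"
    using assms by (subst Digamma_plus1) auto
  then show "ln x \<le> Digamma x + 1 / x"
    using Digamma_real_mono[of \<xi> "x + 1"] \<xi> assms eq by simp
qed

text \<open>The error term of Stirling's formula, with limit half the logarithm of 2 pi. The
  comparison of monomials uses the existence of the limit.\<close>

definition stirling_remainder :: "real \<Rightarrow> real" where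
  "stirling_remainder x = ln_Gamma x - (x - 1 / 2) * ln x + x"

text \<open>The derivative at \<xi> is Digamma \<xi> - ln \<xi> + 1/(2 \<xi>). As Digamma \<xi> - ln
  \<xi> lies in [-1/\<xi>, 0], its modulus is at most 1/(2 \<xi>).\<close>

lemma stirling_remainder_lipschitz:
  assumes "0 < x" "x \<le> y"
  shows "\<bar>stirling_remainder y - stirling_remainder x\<bar> \<le> (y - x) / (2 * x)"
proof (cases "x = y")
  case False
  with assms have "x < y" by simp
  have "\<exists>\<xi>>x. \<xi> < y \<and> stirling_remainder y - stirling_remainder x =
      (y - x) * (Digamma \<xi> - (ln \<xi> + (\<xi> - 1 / 2) / \<xi>) + 1)"
    unfolding stirling_remainder_def
    by (rule MVT2) (use assms \<open>x < y\<close> in \<open>auto intro!: derivative_eq_intros simp: field_simps\<close>)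
  then obtain \<xi> where \<xi>: "x < \<xi>" "\<xi> < y"
    "stirling_remainder y - stirling_remainder x = (y - x) * (Digamma \<xi> - (ln \<xi> + (\<xi> - 1 / 2) / \<xi>) + 1)"
    by auto
  have "(\<xi> - 1 / 2) / \<xi> = 1 - 1 / (2 * \<xi>)" using \<xi> assms by (simp add: field_simps)
  moreover have "1 / \<xi> = 2 * (1 / (2 * \<xi>))" by simp
  ultimately have "\<bar>Digamma \<xi> - (ln \<xi> + (\<xi> - 1 / 2) / \<xi>) + 1\<bar> \<le> 1 / (2 * \<xi>)"
    using Digamma_ln_bounds[of \<xi>] \<xi>(1) assms by linarith
  also have "\<dots> \<le> 1 / (2 * x)" using \<xi> assms by (simp add: frac_le)
  finally have "\<bar>y - x\<bar> * \<bar>Digamma \<xi> - (ln \<xi> + (\<xi> - 1 / 2) / \<xi>) + 1\<bar> \<le> (y - x) * (1 / (2 * x))"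
    using assms by (intro mult_mono) auto
  then show ?thesis unfolding \<xi>(3) by (simp add: abs_mult)
qed simp

lemma stirling_remainder_nat_convergent:
  "\<exists>l. (\<lambda>n. stirling_remainder (real n)) \<longlonglongrightarrow> l"
proof -
  \<comment> \<open>In ln (1 + 1/n) = 1/n - 1/(2 n^2) + ... the second term is compensated by the
    shift 1/2, which leaves increments of order 1/n^2.\<close>
  have "(\<lambda>n. 1 - (real n + 1 / 2) * ln ((real n + 1) / real n)) \<in> O(\<lambda>n. 1 / real n ^ 2)"
    by real_asymp
  moreover have "\<forall>\<^sub>F n in sequentially. 1 - (real n + 1 / 2) * ln ((real n + 1) / real n) =
      stirling_remainder (real (Suc n)) - stirling_remainder (real n)"
    using eventually_gt_at_top[of 0]
  proof eventually_elim
    case (elim n)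
    have "Gamma (real n + 1) = real n * Gamma (real n)"
      by (rule Gamma_plus1) (use elim in \<open>auto elim!: nonpos_Ints_cases\<close>)
    moreover have "Gamma (real n) \<noteq> 0" using Gamma_real_pos[of "real n"] elim by linarith
    ultimately have "ln_Gamma (real n + 1) = ln (real n) + ln_Gamma (real n)"
      using elim by (simp add: ln_Gamma_real_pos ln_mult)
    then show ?case
      using elim by (simp add: stirling_remainder_def ln_div algebra_simps)
  qed
  ultimately have "(\<lambda>n. stirling_remainder (real (Suc n)) - stirling_remainder (real n)) \<in> O(\<lambda>n. 1 / real n ^ 2)"
    by (subst landau_o.big.in_cong[of _ _ sequentially]) (auto elim: eventually_mono)
  moreover have "summable (\<lambda>n. norm (1 / real n ^ 2))"
    using inverse_power_summable[of 2, where 'a = real] by (simp add: divide_inverse)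
  ultimately have "summable (\<lambda>n. stirling_remainder (real (Suc n)) - stirling_remainder (real n))"
    by (rule summable_comparison_test_bigo[rotated])
  then obtain s where "(\<lambda>n. stirling_remainder (real (Suc n)) - stirling_remainder (real n)) sums s"
    by (auto simp: summable_def)
  then have "(\<lambda>N. \<Sum>n<N. stirling_remainder (real (Suc n)) - stirling_remainder (real n)) \<longlonglongrightarrow> s"
    by (simp add: sums_def)
  \<comment> \<open>The value at 0 is fixed only by conventions; it enters as a constant and is
    added back at the end.\<close>
  moreover have "(\<Sum>n<N. stirling_remainder (real (Suc n)) - stirling_remainder (real n)) =
      stirling_remainder (real N) - stirling_remainder 0" for N
    by (subst sum_lessThan_telescope) simp
  ultimately have "(\<lambda>N. stirling_remainder (real N) - stirling_remainder 0) \<longlonglongrightarrow> s" by simp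
  from tendsto_add[OF this tendsto_const[of "stirling_remainder 0"]] show ?thesis by auto
qed

text \<open>Convergence along integers extends to reals because the Lipschitz bound lets the
  remainder change by at most 1/(2 (x - 1)) between the floor of x and x.\<close>

lemma stirling_remainder_convergent: "\<exists>l. (stirling_remainder \<longlongrightarrow> l) at_top"
proof -
  obtain l where l: "(\<lambda>n. stirling_remainder (real n)) \<longlonglongrightarrow> l"
    using stirling_remainder_nat_convergent by blast
  have fl: "filterlim (\<lambda>x::real. nat \<lfloor>x\<rfloor>) sequentially at_top"
    by (rule filterlim_compose[OF filterlim_nat_sequentially filterlim_floor_sequentially])
  have 1: "((\<lambda>x::real. stirling_remainder (real (nat \<lfloor>x\<rfloor>))) \<longlongrightarrow> l) at_top"
    by (rule filterlim_compose[OF l fl])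
  have 2: "((\<lambda>x::real. stirling_remainder x - stirling_remainder (real (nat \<lfloor>x\<rfloor>))) \<longlongrightarrow> 0) at_top"
  proof (rule Lim_null_comparison)
    show "\<forall>\<^sub>F x in at_top. norm (stirling_remainder x - stirling_remainder (real (nat \<lfloor>x\<rfloor>))) \<le> 1 / (2 * (x - 1))"
      using eventually_gt_at_top[of 2]
    proof eventually_elim
      case (elim x)
      have n: "real (nat \<lfloor>x\<rfloor>) \<le> x" "x - 1 < real (nat \<lfloor>x\<rfloor>)" using elim by linarith+
      have "norm (stirling_remainder x - stirling_remainder (real (nat \<lfloor>x\<rfloor>))) \<le> (x - real (nat \<lfloor>x\<rfloor>)) / (2 * real (nat \<lfloor>x\<rfloor>))"
        unfolding real_norm_def by (rule stirling_remainder_lipschitz) (use n elim in linarith)+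
      also have "\<dots> \<le> 1 / (2 * (x - 1))"
      proof (rule frac_le)
        show "x - real (nat \<lfloor>x\<rfloor>) \<le> 1" using n(2) by simp
        show "0 < 2 * (x - 1)" using elim by simp
        show "2 * (x - 1) \<le> 2 * real (nat \<lfloor>x\<rfloor>)" using n(2) by argo
      qed simp
      finally show ?case .
    qed
    show "((\<lambda>x::real. 1 / (2 * (x - 1))) \<longlongrightarrow> 0) at_top" by real_asymp
  qed
  from tendsto_add[OF 1 2] show ?thesis by auto
qed

section \<open>Gamma-type monomials on the logarithmic scale\<close>

lemma log_monomial_x_ln_x: "log_monomial (\<lambda>x. x * ln x)"
proof -
  have "is_logexp (LogExp [] [1, 1])"
    unfolding is_logexp_def by (rule exI) (rule is_logexp_height.zero)
  moreover have "germ_eq (\<lambda>x. x * ln x) (logexp_eval (LogExp [] [1, 1]))"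
    unfolding germ_eq_def using eventually_gt_at_top[of 1]
    by eventually_elim (simp add: lessThan_Suc numeral_2_eq_2)
  moreover have "filterlim (\<lambda>x::real. x * ln x) at_top at_top" by real_asymp
  ultimately show ?thesis unfolding log_monomial_def by blast
qed

lemma log_monomial_id: "log_monomial (\<lambda>x. x)"
proof -
  have "iter_ln 0 = (\<lambda>x::real. x)" by (rule ext) simp
  then show ?thesis using log_monomial_iter_ln[of 0] by simp
qed

lemma log_monomial_ln: "log_monomial ln"
proof -
  have "iter_ln 1 = (ln :: real \<Rightarrow> real)" by (rule ext) simp
  then show ?thesis using log_monomial_iter_ln[of 1] by simp
qed

text \<open>The logarithm of the gamma-type germ by Stirling's formula, without the parts that
  converge. What is left lies in the span of log-exp monomials tending to infinity, so the
  trichotomy applies to it.\<close>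

definition gamma_log_growth :: "real \<Rightarrow> logexp \<Rightarrow> real \<Rightarrow> real \<Rightarrow> real" where
  "gamma_log_growth \<theta> H \<kappa> x =
     \<kappa> * (x * ln x) + (\<theta> + \<kappa> * ln \<kappa> - \<kappa>) * x + 1 / 2 * ln x + ln (logexp_eval H x)"

lemma gamma_log_growth_span: "is_logexp H \<Longrightarrow> germ_span log_monomial (gamma_log_growth \<theta> H \<kappa>)"
  unfolding gamma_log_growth_def
  by (intro germ_span_add germ_span_cmult germ_span_base log_monomial_x_ln_x log_monomial_id log_monomial_ln
      ln_logexp_log_monomial_span)

lemma gamma_type_pos:
  assumes "\<kappa> > 0"
  shows "\<forall>\<^sub>F x::real in at_top. growth_eval (GammaType \<theta> H \<kappa>) x > 0"
  using logexp_pos[of H] eventually_gt_at_top[of 0]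
  by eventually_elim (use assms in \<open>auto intro!: mult_pos_pos Gamma_real_pos add_nonneg_pos\<close>)

lemma gamma_type_log_asymptotics:
  assumes "\<kappa> > 0"
  obtains l where "((\<lambda>x. ln (growth_eval (GammaType \<theta> H \<kappa>) x) - gamma_log_growth \<theta> H \<kappa> x) \<longlongrightarrow> l) at_top"
proof -
  obtain l where l: "(stirling_remainder \<longlongrightarrow> l) at_top" using stirling_remainder_convergent by blast
  have "filterlim (\<lambda>x. \<kappa> * x) at_top at_top" using assms by real_asymp
  \<comment> \<open>With y = \<kappa> x and Gamma (y + 1) = y Gamma y, the logarithm is (y + 1/2) ln
    y - y plus the remainder. Its constant term 1/2 ln \<kappa> is moved into the limit.\<close>
  from tendsto_add[OF filterlim_compose[OF l this] tendsto_const[of "1 / 2 * ln \<kappa>"]]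
  have "((\<lambda>x. stirling_remainder (\<kappa> * x) + 1 / 2 * ln \<kappa>) \<longlongrightarrow> l + 1 / 2 * ln \<kappa>) at_top" .
  moreover have "\<forall>\<^sub>F x in at_top. stirling_remainder (\<kappa> * x) + 1 / 2 * ln \<kappa> =
      ln (growth_eval (GammaType \<theta> H \<kappa>) x) - gamma_log_growth \<theta> H \<kappa> x"
    using logexp_pos[of H] eventually_gt_at_top[of 0]
  proof eventually_elim
    case (elim x)
    have \<kappa>x: "\<kappa> * x > 0" using assms elim by simp
    then have "\<kappa> * x \<notin> \<int>\<^sub>\<le>\<^sub>0" by (auto elim!: nonpos_Ints_cases)
    then have \<Gamma>: "Gamma (\<kappa> * x + 1) = \<kappa> * x * Gamma (\<kappa> * x)" by (rule Gamma_plus1)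
    have pos: "Gamma (\<kappa> * x) \<noteq> 0" using Gamma_real_pos[OF \<kappa>x] by linarith
    have "ln (growth_eval (GammaType \<theta> H \<kappa>) x) = ln (exp (\<theta> * x) * logexp_eval H x * (\<kappa> * x * Gamma (\<kappa> * x)))"
      by (simp add: \<Gamma>)
    also have "\<dots> = \<theta> * x + ln (logexp_eval H x) + (ln \<kappa> + ln x + ln (Gamma (\<kappa> * x)))"
      using elim pos assms by (simp add: ln_mult)
    finally have eq: "ln (growth_eval (GammaType \<theta> H \<kappa>) x) =
      \<theta> * x + ln (logexp_eval H x) + (ln \<kappa> + ln x + ln (Gamma (\<kappa> * x)))" .
    have "ln (\<kappa> * x) = ln \<kappa> + ln x" using elim assms by (simp add: ln_mult)
    then show ?case
      unfolding eq by (simp add: stirling_remainder_def gamma_log_growth_def ln_Gamma_real_pos[OF \<kappa>x] field_simps)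
  qed
  ultimately have "((\<lambda>x. ln (growth_eval (GammaType \<theta> H \<kappa>) x) - gamma_log_growth \<theta> H \<kappa> x) \<longlongrightarrow> l + 1 / 2 * ln \<kappa>) at_top"
    by (rule Lim_transform_eventually)
  then show ?thesis by (rule that)
qed

lemma growth_pos: "is_growth M \<Longrightarrow> \<forall>\<^sub>F x::real in at_top. growth_eval M x > 0"
proof (cases M)
  case (Pure L)
  then show ?thesis using logexp_pos[of L] by simp
next
  case (GammaType \<theta> H \<kappa>)
  assume "is_growth M"
  then show ?thesis unfolding GammaType by (intro gamma_type_pos) simp
qed

text \<open>D and E are the logarithms up to convergent errors, which cannot offset an infinite
  difference. Only a tie D = E leaves a finite limit of the quotient, and the shape of the monomials
  has to settle that case.\<close>

lemma growth_cmp_or_comparable: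
  assumes pos: "\<forall>\<^sub>F x in at_top. f x > 0" "\<forall>\<^sub>F x in at_top. g x > 0"
    and lim: "((\<lambda>x. ln (f x) - D x) \<longlongrightarrow> l) at_top" "((\<lambda>x. ln (g x) - E x) \<longlongrightarrow> k) at_top"
    and span: "germ_span log_monomial D" "germ_span log_monomial E"
  shows "germ_cmp f g \<or> (\<forall>\<^sub>F x in at_top. D x = E x) \<and> ((\<lambda>x. f x / g x) \<longlongrightarrow> exp (l - k)) at_top"
proof -
  have lim': "((\<lambda>x. (ln (f x) - ln (g x)) - (D x - E x)) \<longlongrightarrow> l - k) at_top"
    using tendsto_diff[OF lim] by (simp add: algebra_simps)
  have "(\<forall>\<^sub>F x in at_top. D x - E x = 0) \<or> filterlim (\<lambda>x. D x - E x) at_top at_top \<or>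
      filterlim (\<lambda>x. D x - E x) at_bot at_top"
    by (rule germ_span_trichotomy[OF _ log_monomial_cmp germ_span_diff[OF span]])
      (simp_all add: log_monomial_def)
  then show ?thesis
  proof (elim disjE)
    assume z: "\<forall>\<^sub>F x in at_top. D x - E x = 0"
    have "((\<lambda>x. exp (ln (f x) - ln (g x) - (D x - E x))) \<longlongrightarrow> exp (l - k)) at_top"
      by (rule tendsto_exp[OF lim'])
    moreover have "\<forall>\<^sub>F x in at_top. exp (ln (f x) - ln (g x) - (D x - E x)) = f x / g x"
      using z pos by eventually_elim (simp add: exp_diff)
    ultimately have "((\<lambda>x. f x / g x) \<longlongrightarrow> exp (l - k)) at_top" by (rule Lim_transform_eventually)
    with z show ?thesis by simp
  next
    assume "filterlim (\<lambda>x. D x - E x) at_top at_top"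
    from filterlim_tendsto_add_at_top[OF lim' this]
    have "filterlim (\<lambda>x. ln (f x) - ln (g x)) at_top at_top" by simp
    from germ_cmp_of_ln_diff[OF pos disjI2[OF disjI1[OF this]]] show ?thesis ..
  next
    assume "filterlim (\<lambda>x. D x - E x) at_bot at_top"
    then have "filterlim (\<lambda>x. - (D x - E x)) at_top at_top" by (simp add: filterlim_uminus_at_bot)
    from filterlim_tendsto_add_at_top[OF tendsto_minus[OF lim'] this]
    have "filterlim (\<lambda>x. - (ln (f x) - ln (g x))) at_top at_top" by simp
    then have "filterlim (\<lambda>x. ln (f x) - ln (g x)) at_bot at_top" by (simp add: filterlim_uminus_at_bot)
    from germ_cmp_of_ln_diff[OF pos disjI2[OF disjI2[OF this]]] show ?thesis ..
  qed
qed

text \<open>A finite nonzero limit of the quotient is excluded by the assumption that \<open>L\<close> is not gamma-resonant.\<close>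

lemma pure_gamma_cmp:
  assumes L: "is_growth (Pure L)" and G: "is_growth (GammaType \<theta> H \<kappa>)"
  shows "germ_cmp (growth_eval (Pure L)) (growth_eval (GammaType \<theta> H \<kappa>))"
proof -
  have \<kappa>: "\<kappa> > 0" and H: "is_logexp_sublinear H" "is_logexp H"
    using G by (auto simp: is_logexp_sublinear_def)
  obtain k where k: "((\<lambda>x. ln (growth_eval (GammaType \<theta> H \<kappa>) x) - gamma_log_growth \<theta> H \<kappa> x) \<longlongrightarrow> k) at_top"
    by (rule gamma_type_log_asymptotics[OF \<kappa>])
  have l: "((\<lambda>x. ln (growth_eval (Pure L) x) - ln (logexp_eval L x)) \<longlongrightarrow> 0) at_top" by simp
  have L': "is_logexp L" "\<not> gamma_resonant L" using L by auto
  have "\<not> ((\<lambda>x. growth_eval (Pure L) x / growth_eval (GammaType \<theta> H \<kappa>) x) \<longlongrightarrow> exp (0 - k)) at_top"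
  proof
    assume "((\<lambda>x. growth_eval (Pure L) x / growth_eval (GammaType \<theta> H \<kappa>) x) \<longlongrightarrow> exp (0 - k)) at_top"
    then have "gamma_resonant L"
      unfolding gamma_resonant_def
      by (intro exI[of _ \<theta>] exI[of _ H] exI[of _ \<kappa>] exI[of _ "exp (0 - k)"] conjI H \<kappa>) simp_all
    with L' show False by simp
  qed
  with growth_cmp_or_comparable[OF growth_pos[OF L] growth_pos[OF G] l k
      ln_logexp_log_monomial_span[OF L'(1)] gamma_log_growth_span[OF H(2)]]
  show ?thesis by (elim disjE conjE) (assumption, erule notE)
qed

text \<open>Coefficients are read off along the scale x ln x, x, o(x), where the last term is the
  contribution of H and H'. First \<kappa> is isolated; \<theta> comes second because the
  coefficient of x also contains \<kappa>.\<close>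

lemma gamma_log_growth_eqD:
  assumes eq: "\<forall>\<^sub>F x in at_top. gamma_log_growth \<theta> H \<kappa> x = gamma_log_growth \<theta>' H' \<kappa>' x"
    and H: "is_logexp_sublinear H" "is_logexp_sublinear H'"
  shows "\<kappa> = \<kappa>'" "\<theta> = \<theta>'"
proof -
  define d where "d x = ln (logexp_eval H x) - ln (logexp_eval H' x)" for x :: real
  have "d \<in> o[at_top](\<lambda>x. x)"
    unfolding d_def using H by (intro sum_in_smallo) (simp_all add: is_logexp_sublinear_def)
  then have d: "((\<lambda>x. d x / x) \<longlongrightarrow> 0) at_top" by (rule smalloD_tendsto)
  define \<mu> where "\<mu> = (\<theta> + \<kappa> * ln \<kappa> - \<kappa>) - (\<theta>' + \<kappa>' * ln \<kappa>' - \<kappa>')"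
  have eq': "\<forall>\<^sub>F x in at_top. (\<kappa> - \<kappa>') * (x * ln x) + \<mu> * x + d x = 0"
    using eq by eventually_elim (simp add: gamma_log_growth_def d_def \<mu>_def algebra_simps)
  have "((\<lambda>x::real. 1 / ln x) \<longlongrightarrow> 0) at_top" by real_asymp
  from tendsto_mult[OF tendsto_add[OF tendsto_const[of \<mu>] d] this]
  have "((\<lambda>x. (\<mu> + d x / x) * (1 / ln x)) \<longlongrightarrow> 0) at_top" by simp
  moreover have "\<forall>\<^sub>F x in at_top. (\<mu> + d x / x) * (1 / ln x) = - (\<kappa> - \<kappa>')"
    using eq' eventually_gt_at_top[of 1]
  proof eventually_elim
    case (elim x)
    then have "\<mu> * x + d x = - (\<kappa> - \<kappa>') * (x * ln x)" by (simp add: algebra_simps)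
    moreover have "(\<mu> + d x / x) * (1 / ln x) = (\<mu> * x + d x) / (x * ln x)"
      using elim by (simp add: field_simps)
    ultimately show ?case using elim by simp
  qed
  ultimately have "((\<lambda>x::real. - (\<kappa> - \<kappa>')) \<longlongrightarrow> 0) at_top" by (rule Lim_transform_eventually)
  then show \<kappa>: "\<kappa> = \<kappa>'" by (simp add: tendsto_const_iff)
  have "\<forall>\<^sub>F x in at_top. d x / x = - \<mu>"
    using eq' eventually_gt_at_top[of 0]
  proof eventually_elim
    case (elim x)
    then have "d x = - \<mu> * x" using \<kappa> by simp
    then show ?case using elim by simp
  qed
  from Lim_transform_eventually[OF d this] have "\<mu> = 0" by (simp add: tendsto_const_iff)
  then show "\<theta> = \<theta>'" using \<kappa> by (simp add: \<mu>_def)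
qed

text \<open>In a tie \<kappa> and \<theta> agree, and cancelling them leaves ln H = ln H'
  eventually, so the tie is an equality of germs.\<close>

lemma gamma_gamma_cmp:
  assumes G: "is_growth (GammaType \<theta> H \<kappa>)" and G': "is_growth (GammaType \<theta>' H' \<kappa>')"
  shows "germ_cmp (growth_eval (GammaType \<theta> H \<kappa>)) (growth_eval (GammaType \<theta>' H' \<kappa>'))"
proof -
  have \<kappa>: "\<kappa> > 0" "\<kappa>' > 0" and H: "is_logexp_sublinear H" "is_logexp_sublinear H'"
    and HL: "is_logexp H" "is_logexp H'"
    using G G' by (auto simp: is_logexp_sublinear_def)
  obtain l where l: "((\<lambda>x. ln (growth_eval (GammaType \<theta> H \<kappa>) x) - gamma_log_growth \<theta> H \<kappa> x) \<longlongrightarrow> l) at_top"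
    by (rule gamma_type_log_asymptotics[OF \<kappa>(1)])
  obtain k where k: "((\<lambda>x. ln (growth_eval (GammaType \<theta>' H' \<kappa>') x) - gamma_log_growth \<theta>' H' \<kappa>' x) \<longlongrightarrow> k) at_top"
    by (rule gamma_type_log_asymptotics[OF \<kappa>(2)])
  from growth_cmp_or_comparable[OF growth_pos[OF G] growth_pos[OF G'] l k
      gamma_log_growth_span[OF HL(1)] gamma_log_growth_span[OF HL(2)]]
  show ?thesis
  proof
    assume "(\<forall>\<^sub>F x in at_top. gamma_log_growth \<theta> H \<kappa> x = gamma_log_growth \<theta>' H' \<kappa>' x) \<and>
      ((\<lambda>x. growth_eval (GammaType \<theta> H \<kappa>) x / growth_eval (GammaType \<theta>' H' \<kappa>') x) \<longlongrightarrow> exp (l - k)) at_top"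
    then have eq: "\<forall>\<^sub>F x in at_top. gamma_log_growth \<theta> H \<kappa> x = gamma_log_growth \<theta>' H' \<kappa>' x" ..
    have same: "\<kappa> = \<kappa>'" "\<theta> = \<theta>'" by (rule gamma_log_growth_eqD[OF eq H])+
    have "germ_eq (logexp_eval H) (logexp_eval H')"
      unfolding germ_eq_def using eq logexp_pos[of H] logexp_pos[of H']
      by eventually_elim (simp add: same gamma_log_growth_def)
    then have "germ_eq (growth_eval (GammaType \<theta> H \<kappa>)) (growth_eval (GammaType \<theta>' H' \<kappa>'))"
      unfolding germ_eq_def by (auto simp: same elim: eventually_mono)
    then show ?thesis by (simp add: germ_cmp_def)
  qed
qed

theorem growth_cmp:
  assumes "is_growth M" "is_growth M'"
  shows "germ_cmp (growth_eval M) (growth_eval M')"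
proof (cases M; cases M')
  fix L L' assume M: "M = Pure L" "M' = Pure L'"
  have "germ_cmp (logexp_eval L) (logexp_eval L')"
    using assms unfolding M by (intro logexp_cmp) simp_all
  moreover have "growth_eval (Pure L) = (logexp_eval L :: real \<Rightarrow> real)" for L by (rule ext) simp
  ultimately show ?thesis unfolding M by simp
next
  fix L \<theta> H \<kappa> assume M: "M = Pure L" "M' = GammaType \<theta> H \<kappa>"
  show ?thesis using assms unfolding M by (rule pure_gamma_cmp)
next
  fix L \<theta> H \<kappa> assume M: "M = GammaType \<theta> H \<kappa>" "M' = Pure L"
  show ?thesis using assms unfolding M by (intro germ_cmp_sym[OF pure_gamma_cmp])
next
  fix \<theta> H \<kappa> \<theta>' H' \<kappa>' assume M: "M = GammaType \<theta> H \<kappa>" "M' = GammaType \<theta>' H' \<kappa>'"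
  show ?thesis using assms unfolding M by (rule gamma_gamma_cmp)
qed

section \<open>Uniqueness of phase germs\<close>

lemma Re_iter_ln_gt: "\<exists>\<sigma>. \<forall>z::complex. Re z > \<sigma> \<longrightarrow> Re (iter_ln j z) > c"
proof (induction j arbitrary: c)
  case 0
  show ?case by (rule exI[of _ c]) simp
next
  case (Suc j)
  from Suc[of "exp c"] obtain \<sigma> where \<sigma>: "\<forall>z::complex. Re z > \<sigma> \<longrightarrow> Re (iter_ln j z) > exp c" by (elim exE)
  have "Re (iter_ln (Suc j) z) > c" if "Re z > \<sigma>" for z :: complex
  proof -
    let ?w = "iter_ln j z"
    \<comment> \<open>The real part of the principal logarithm of w is the logarithm of its modulus,
      which is at least Re w. A bound exp c one level below thus gives c here, and so the induction
      must leave c arbitrary.\<close>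
    have "exp c < cmod ?w" using \<sigma>[rule_format, OF that] complex_Re_le_cmod[of ?w] by linarith
    moreover have "?w \<noteq> 0" using calculation exp_gt_zero[of c] by (intro notI) simp
    ultimately have "c < ln (cmod ?w)"
      using ln_less_cancel_iff[of "exp c" "cmod ?w"] by simp
    with \<open>?w \<noteq> 0\<close> show ?thesis by simp
  qed
  then show ?case by (intro exI[of _ \<sigma>] allI impI)
qed

text \<open>Positivity of the real part is carried along because it keeps the argument of the next
  logarithm, or of a power, off the branch cut.\<close>

lemma iter_ln_holomorphic:
  "\<exists>\<sigma>. iter_ln j holomorphic_on {z. Re z > \<sigma>} \<and> (\<forall>z. Re z > \<sigma> \<longrightarrow> Re (iter_ln j z) > 0)"
proof (induction j)
  case 0
  have "(\<lambda>z. iter_ln 0 z) holomorphic_on {z. Re z > 0}" by (simp add: holomorphic_intros)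
  then show ?case by (intro exI[of _ 0]) simp
next
  case (Suc j)
  then obtain \<sigma> where \<sigma>: "iter_ln j holomorphic_on {z. Re z > \<sigma>}" "\<forall>z. Re z > \<sigma> \<longrightarrow> Re (iter_ln j z) > 0"
    by (elim exE conjE)
  obtain \<tau> where \<tau>: "\<forall>z::complex. Re z > \<tau> \<longrightarrow> Re (iter_ln (Suc j) z) > 0"
    using Re_iter_ln_gt[where j = "Suc j" and c = 0] by (elim exE)
  have "(\<lambda>z. ln (iter_ln j z)) holomorphic_on {z. Re z > max \<sigma> \<tau>}"
  proof (rule holomorphic_on_Ln')
    show "iter_ln j holomorphic_on {z. Re z > max \<sigma> \<tau>}"
      by (rule holomorphic_on_subset[OF \<sigma>(1)]) auto
    show "iter_ln j z \<notin> \<real>\<^sub>\<le>\<^sub>0" if "z \<in> {z. Re z > max \<sigma> \<tau>}" for z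
      using \<sigma>(2)[rule_format, of z] that by (auto simp: complex_nonpos_Reals_iff)
  qed
  moreover have "iter_ln (Suc j) = (\<lambda>z. ln (iter_ln j z) :: complex)" by (rule ext) simp
  ultimately have "iter_ln (Suc j) holomorphic_on {z. Re z > max \<sigma> \<tau>}" by (simp only:)
  moreover have "\<forall>z::complex. Re z > max \<sigma> \<tau> \<longrightarrow> Re (iter_ln (Suc j) z) > 0"
    using \<tau> by (intro allI impI) (simp del: iter_ln.simps)
  ultimately show ?case by (intro exI conjI)
qed

lemma logexp_holomorphic: "\<exists>\<sigma>. logexp_eval L holomorphic_on {z. Re z > \<sigma>}"
proof (induction L)
  case (LogExp \<Phi> \<alpha>)
  have "\<exists>\<sigma>. (\<lambda>z. \<Sum>(c, M)\<leftarrow>\<Phi>. of_real c * logexp_eval M z) holomorphic_on {z. Re z > \<sigma>}"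
    using LogExp
  proof (induction \<Phi>)
    case Nil
    then show ?case by simp
  next
    case (Cons p \<Phi>)
    obtain c M where p: "p = (c, M)" by (cases p)
    have "\<exists>\<sigma>. (\<lambda>z. \<Sum>(c, M)\<leftarrow>\<Phi>. of_real c * logexp_eval M z) holomorphic_on {z. Re z > \<sigma>}"
    proof (rule Cons.IH)
      show "\<exists>\<sigma>. logexp_eval M holomorphic_on {z. Re z > \<sigma>}" if "q \<in> set \<Phi>" "M \<in> Basic_BNFs.snds q" for q M
        by (rule Cons.prems[of q]) (use that in simp_all)
    qed
    then obtain \<sigma> where \<sigma>: "(\<lambda>z. \<Sum>(c, M)\<leftarrow>\<Phi>. of_real c * logexp_eval M z) holomorphic_on {z. Re z > \<sigma>}" ..
    have "\<exists>\<tau>. logexp_eval M holomorphic_on {z. Re z > \<tau>}"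
      by (rule Cons.prems[of p]) (simp_all add: p)
    then obtain \<tau> where \<tau>: "logexp_eval M holomorphic_on {z. Re z > \<tau>}" ..
    have "(\<lambda>z. of_real c * logexp_eval M z + (\<Sum>(c, M)\<leftarrow>\<Phi>. of_real c * logexp_eval M z))
        holomorphic_on {z. Re z > max \<sigma> \<tau>}"
      by (intro holomorphic_intros holomorphic_on_subset[OF \<sigma>] holomorphic_on_subset[OF \<tau>]) auto
    then show ?case by (intro exI[of _ "max \<sigma> \<tau>"]) (simp add: p)
  qed
  then obtain \<sigma> where \<sigma>: "(\<lambda>z. \<Sum>(c, M)\<leftarrow>\<Phi>. of_real c * logexp_eval M z) holomorphic_on {z. Re z > \<sigma>}" ..
  have "\<exists>\<tau>. (\<lambda>z. \<Prod>j<n. iter_ln j z powr of_real (\<alpha> ! j)) holomorphic_on {z. Re z > \<tau>}" for n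
  proof (induction n)
    case 0
    then show ?case by simp
  next
    case (Suc n)
    then obtain \<tau> where \<tau>: "(\<lambda>z. \<Prod>j<n. iter_ln j z powr of_real (\<alpha> ! j)) holomorphic_on {z. Re z > \<tau>}" ..
    obtain \<upsilon> where \<upsilon>: "iter_ln n holomorphic_on {z. Re z > \<upsilon>}" "\<forall>z. Re z > \<upsilon> \<longrightarrow> Re (iter_ln n z) > 0"
      using iter_ln_holomorphic[of n] by (elim exE conjE)
    have "iter_ln n z \<notin> \<real>\<^sub>\<le>\<^sub>0" if "Re z > \<upsilon>" for z
      using \<upsilon>(2)[rule_format, OF that] by (auto simp: complex_nonpos_Reals_iff)
    then have "(\<lambda>z. (\<Prod>j<n. iter_ln j z powr of_real (\<alpha> ! j)) * iter_ln n z powr of_real (\<alpha> ! n))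
        holomorphic_on {z. Re z > max \<tau> \<upsilon>}"
      by (intro holomorphic_intros holomorphic_on_subset[OF \<tau>] holomorphic_on_subset[OF \<upsilon>(1)]) auto
    then show ?case by (intro exI[of _ "max \<tau> \<upsilon>"]) (simp add: lessThan_Suc mult.commute)
  qed
  from this[of "length \<alpha>"] obtain \<tau> where \<tau>: "(\<lambda>z. \<Prod>j<length \<alpha>. iter_ln j z powr of_real (\<alpha> ! j)) holomorphic_on {z. Re z > \<tau>}"
    by (elim exE)
  have "logexp_eval (LogExp \<Phi> \<alpha>) = (\<lambda>z::complex. exp (\<Sum>(c, M)\<leftarrow>\<Phi>. of_real c * logexp_eval M z) *
      (\<Prod>j<length \<alpha>. iter_ln j z powr of_real (\<alpha> ! j)))"
    by (rule ext) simp
  moreover have "(\<lambda>z. exp (\<Sum>(c, M)\<leftarrow>\<Phi>. of_real c * logexp_eval M z) *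
      (\<Prod>j<length \<alpha>. iter_ln j z powr of_real (\<alpha> ! j))) holomorphic_on {z. Re z > max \<sigma> \<tau>}"
    by (rule holomorphic_on_mult[OF holomorphic_on_exp' holomorphic_on_subset[OF \<tau>]],
        rule holomorphic_on_subset[OF \<sigma>]) auto
  ultimately show ?case by (intro exI[of _ "max \<sigma> \<tau>"]) (simp only:)
qed

lemma iter_ln_of_real: "\<forall>\<^sub>F x in at_top. iter_ln j (complex_of_real x) = of_real (iter_ln j x)"
proof (induction j)
  case (Suc j)
  then show ?case using eventually_iter_ln_gt[of 0 j]
    by eventually_elim (simp add: Ln_of_real)
qed simp

lemma logexp_of_real: "\<forall>\<^sub>F x in at_top. logexp_eval L (complex_of_real x) = of_real (logexp_eval L x)"
proof (induction L)
  case (LogExp \<Phi> \<alpha>)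
  have "\<forall>\<^sub>F x in at_top. \<forall>p\<in>set \<Phi>. logexp_eval (snd p) (complex_of_real x) = of_real (logexp_eval (snd p) x)"
    by (rule eventually_ball_finite) (use LogExp in \<open>auto \<close>)
  moreover have "\<forall>\<^sub>F x::real in at_top. \<forall>j\<in>{..<length \<alpha>}. iter_ln j x > 0"
    by (rule eventually_ball_finite) (auto intro: eventually_iter_ln_gt)
  moreover have "\<forall>\<^sub>F x in at_top. \<forall>j\<in>{..<length \<alpha>}. iter_ln j (complex_of_real x) = of_real (iter_ln j x)"
    by (rule eventually_ball_finite) (auto intro: iter_ln_of_real)
  ultimately show ?case
  proof eventually_elim
    case (elim x)
    have "(\<Sum>p\<leftarrow>\<Phi>. of_real (fst p) * logexp_eval (snd p) (complex_of_real x)) =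
        complex_of_real (\<Sum>p\<leftarrow>\<Phi>. fst p * logexp_eval (snd p) x)"
      using elim(1) by (induction \<Phi>) auto
    moreover have "(\<Prod>j<length \<alpha>. iter_ln j (complex_of_real x) powr of_real (\<alpha> ! j)) =
        complex_of_real (\<Prod>j<length \<alpha>. iter_ln j x powr (\<alpha> ! j))"
      unfolding of_real_prod
    proof (rule prod.cong[OF refl])
      fix j assume j: "j \<in> {..<length \<alpha>}"
      show "iter_ln j (complex_of_real x) powr of_real (\<alpha> ! j) = of_real (iter_ln j x powr \<alpha> ! j)"
        unfolding bspec[OF elim(3) j] using bspec[OF elim(2) j] by (subst powr_of_real) simp_all
    qed
    ultimately show ?case
      by (simp only: logexp_eval.simps case_prod_unfold of_real_mult exp_of_real of_real_eq_id id_apply)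
  qed
qed

lemma growth_holomorphic:
  assumes "is_growth M"
  shows "\<exists>\<sigma>. growth_eval M holomorphic_on {z. Re z > \<sigma>}"
proof (cases M)
  case (Pure L)
  have "growth_eval (Pure L) = (logexp_eval L :: complex \<Rightarrow> complex)" by (rule ext) simp
  then show ?thesis unfolding Pure using logexp_holomorphic[of L] by simp
next
  case (GammaType \<theta> H \<kappa>)
  with assms have \<kappa>: "\<kappa> > 0" by simp
  obtain \<sigma> where \<sigma>: "logexp_eval H holomorphic_on {z. Re z > \<sigma>}" using logexp_holomorphic[of H] ..
  have "of_real \<kappa> * z + 1 \<notin> \<int>\<^sub>\<le>\<^sub>0" if "Re z > 0" for z
  proof
    assume "of_real \<kappa> * z + 1 \<in> \<int>\<^sub>\<le>\<^sub>0"
    then obtain n where "of_real \<kappa> * z + 1 = of_int n" "n \<le> 0" by (elim nonpos_Ints_cases)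
    from arg_cong[OF this(1), of Re] this(2) have "\<kappa> * Re z + 1 \<le> 0" by simp
    moreover have "\<kappa> * Re z > 0" using \<kappa> that by simp
    ultimately show False by simp
  qed
  then have "(\<lambda>z. exp (of_real \<theta> * z) * logexp_eval H z * Gamma (of_real \<kappa> * z + 1)) holomorphic_on {z. Re z > max \<sigma> 0}"
    by (intro holomorphic_intros holomorphic_on_subset[OF \<sigma>]) auto
  moreover have "growth_eval M = (\<lambda>z::complex. exp (of_real \<theta> * z) * logexp_eval H z * Gamma (of_real \<kappa> * z + 1))"
    unfolding GammaType by (rule ext) simp
  ultimately show ?thesis by (intro exI[of _ "max \<sigma> 0"]) (simp only:)
qed

lemma growth_of_real:
  "\<forall>\<^sub>F x in at_top. growth_eval M (complex_of_real x) = of_real (growth_eval M x)"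
proof (cases M)
  case (Pure L)
  then show ?thesis using logexp_of_real[of L] by simp
next
  case (GammaType \<theta> H \<kappa>)
  have "Gamma (complex_of_real \<kappa> * complex_of_real x + 1) = of_real (Gamma (\<kappa> * x + 1))" for x
    using Gamma_complex_of_real[of "\<kappa> * x + 1"] by simp
  then show ?thesis using logexp_of_real[of H] unfolding GammaType
    by (auto simp: exp_of_real[symmetric] elim!: eventually_mono)
qed

lemma growth_sum_zero_continuation:
  fixes a :: "'i \<Rightarrow> complex"
  assumes M: "\<And>y. y \<in> set ys \<Longrightarrow> is_growth (M y)"
    and zero: "\<forall>\<^sub>F x in at_top. (\<Sum>y\<leftarrow>ys. growth_eval (M y) x *\<^sub>R a y) = 0"
  shows "\<exists>\<sigma>. \<forall>z. Re z > \<sigma> \<longrightarrow> (\<Sum>y\<leftarrow>ys. a y * growth_eval (M y) z) = 0"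
proof -
  have "\<exists>\<sigma>. (\<lambda>z. \<Sum>y\<leftarrow>ys. a y * growth_eval (M y) z) holomorphic_on {z. Re z > \<sigma>}"
    using M
  proof (induction ys)
    case Nil
    then show ?case by simp
  next
    case (Cons y ys)
    then obtain \<sigma> where \<sigma>: "(\<lambda>z. \<Sum>y\<leftarrow>ys. a y * growth_eval (M y) z) holomorphic_on {z. Re z > \<sigma>}" by auto
    obtain \<tau> where \<tau>: "growth_eval (M y) holomorphic_on {z. Re z > \<tau>}"
      using growth_holomorphic[OF Cons.prems[of y]] by auto
    have "(\<lambda>z. a y * growth_eval (M y) z + (\<Sum>y\<leftarrow>ys. a y * growth_eval (M y) z))
        holomorphic_on {z. Re z > max \<sigma> \<tau>}"
      by (intro holomorphic_intros holomorphic_on_subset[OF \<sigma>] holomorphic_on_subset[OF \<tau>]) auto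
    then show ?case by (intro exI[of _ "max \<sigma> \<tau>"]) simp
  qed
  then obtain \<sigma> where hol: "(\<lambda>z. \<Sum>y\<leftarrow>ys. a y * growth_eval (M y) z) holomorphic_on {z. Re z > \<sigma>}" ..
  have "\<forall>\<^sub>F x in at_top. \<forall>y\<in>set ys. growth_eval (M y) (complex_of_real x) = of_real (growth_eval (M y) x)"
    by (rule eventually_ball_finite) (auto intro: growth_of_real)
  with zero have "\<forall>\<^sub>F x in at_top. (\<Sum>y\<leftarrow>ys. a y * growth_eval (M y) (complex_of_real x)) = 0"
  proof eventually_elim
    case (elim x)
    have "(\<Sum>y\<leftarrow>ys. a y * growth_eval (M y) (complex_of_real x)) = (\<Sum>y\<leftarrow>ys. growth_eval (M y) x *\<^sub>R a y)"
      using elim(2) by (induction ys) (auto simp: scaleR_conv_of_real)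
    with elim(1) show ?case by simp
  qed
  then obtain x0 where x0: "\<And>x. x \<ge> x0 \<Longrightarrow> (\<Sum>y\<leftarrow>ys. a y * growth_eval (M y) (complex_of_real x)) = 0"
    by (auto simp: eventually_at_top_linorder)
  \<comment> \<open>Beyond both bounds, so that the half-line from s consists of zeros inside the
    half-plane; s is a limit point of it, as the identity theorem requires.\<close>
  define s where "s = max x0 (\<sigma> + 1)"
  have "(\<Sum>y\<leftarrow>ys. a y * growth_eval (M y) z) = 0" if "Re z > \<sigma>" for z
  proof (rule analytic_continuation[OF hol, of "of_real ` {s..}" "of_real s" z])
    show "open {z. \<sigma> < Re z}" by (rule open_halfspace_Re_gt)
    show "connected {z. \<sigma> < Re z}" by (intro convex_connected convex_halfspace_Re_gt)
    show "complex_of_real ` {s..} \<subseteq> {z. \<sigma> < Re z}" by (auto simp: s_def)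
    show "complex_of_real s \<in> {z. \<sigma> < Re z}" by (auto simp: s_def)
    show "complex_of_real s islimpt complex_of_real ` {s..}"
    proof (rule islimptI)
      fix T assume "complex_of_real s \<in> T" "open T"
      then obtain e where e: "e > 0" "ball (complex_of_real s) e \<subseteq> T" by (auto elim: openE)
      have "complex_of_real (s + e / 2) \<in> ball (complex_of_real s) e"
        using e(1) by (simp add: dist_norm)
      moreover have "complex_of_real (s + e / 2) \<in> complex_of_real ` {s..}"
        using e(1) by (intro imageI) simp
      moreover have "complex_of_real (s + e / 2) \<noteq> complex_of_real s"
        using e(1) unfolding of_real_eq_iff by simp
      ultimately show "\<exists>y\<in>complex_of_real ` {s..}. y \<in> T \<and> y \<noteq> complex_of_real s"
        using e(2) by (intro bexI[of _ "complex_of_real (s + e / 2)"] conjI) (rule subsetD)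
    qed
  qed (use that x0 in \<open>auto simp: s_def\<close>)
  then show ?thesis by blast
qed

text \<open>The two coefficients of a monomial form one vector in C x C. If the sum S were not
  eventually 0, it would have a leading vector v; even integers force
  \<open>fst v + snd v = 0\<close>, odd ones \<open>fst v - snd v = 0\<close>, hence v = 0. The list
  is arbitrary because the application is to a difference of two germs, which in general is not
  sorted.\<close>

theorem phase_germ_zero:
  assumes M: "\<And>A B M. (A, B, M) \<in> set c \<Longrightarrow> is_growth M"
    and zero: "\<forall>\<^sub>F N in sequentially. phase_eval c (of_nat N) = 0"
  shows "\<exists>\<sigma>. \<forall>z. Re z > \<sigma> \<longrightarrow> (\<Sum>(A, B, M)\<leftarrow>c. A * growth_eval M z) = 0 \<and> (\<Sum>(A, B, M)\<leftarrow>c. B * growth_eval M z) = 0"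
proof -
  define S where "S x = (\<Sum>(A, B, M)\<leftarrow>c. growth_eval M x *\<^sub>R (A, B))" for x :: real
  let ?xs = "map (\<lambda>(A, B, M). (growth_eval M :: real \<Rightarrow> real, (A, B))) c"
  have S_eq: "(\<Sum>(m, v)\<leftarrow>?xs. m x *\<^sub>R v) = S x" for x
    by (simp add: S_def o_def case_prod_unfold)
  have xs: "\<exists>M. is_growth M \<and> m = growth_eval M" if "m \<in> fst ` set ?xs" for m
    using that M by fastforce
  have fst_S: "fst (S x) = (\<Sum>y\<leftarrow>c. growth_eval (snd (snd y)) x *\<^sub>R fst y)"
    and snd_S: "snd (S x) = (\<Sum>y\<leftarrow>c. growth_eval (snd (snd y)) x *\<^sub>R fst (snd y))" for x
    unfolding S_def by (induction c) auto
  have "\<forall>\<^sub>F x in at_top. \<forall>y\<in>set c. growth_eval (snd (snd y)) (complex_of_real x) = of_real (growth_eval (snd (snd y)) x)"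
    by (rule eventually_ball_finite) (auto intro: growth_of_real)
  then have "\<forall>\<^sub>F N in sequentially. \<forall>y\<in>set c. growth_eval (snd (snd y)) (complex_of_real (real N)) = of_real (growth_eval (snd (snd y)) (real N))"
    by (rule eventually_compose_filterlim[OF _ filterlim_real_sequentially])
  with zero have Z: "\<forall>\<^sub>F N in sequentially. fst (S (real N)) + (-1) ^ N * snd (S (real N)) = 0"
  proof eventually_elim
    case (elim N)
    have "exp (\<i> * pi * of_nat N) = exp (\<i> * pi) ^ N"
      by (metis exp_of_nat2_mult)
    then have e: "exp (\<i> * complex_of_real pi * of_nat N) = (-1) ^ N" by simp
    have "phase_eval c (of_nat N) = (\<Sum>y\<leftarrow>c. (fst y + fst (snd y) * (-1) ^ N) * growth_eval (snd (snd y)) (of_nat N))"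
      unfolding phase_eval_def e by (simp add: case_prod_unfold)
    also have "\<dots> = fst (S (real N)) + (-1) ^ N * snd (S (real N))"
      unfolding fst_S snd_S using elim(2)
      by (induction c) (auto simp: scaleR_conv_of_real algebra_simps)
    finally show ?case using elim(1) by simp
  qed
  have "\<forall>\<^sub>F x in at_top. S x = 0"
  proof -
    have "(\<forall>\<^sub>F x in at_top. (\<Sum>(m, v)\<leftarrow>?xs. m x *\<^sub>R v) = 0) \<or>
       (\<exists>m\<in>fst ` set ?xs. \<exists>v. v \<noteq> 0 \<and> ((\<lambda>x. (\<Sum>(m, v)\<leftarrow>?xs. m x *\<^sub>R v) /\<^sub>R m x) \<longlongrightarrow> v) at_top)"
    proof (rule leading_term_list)
      show "\<forall>\<^sub>F x in at_top. m x > 0" if "m \<in> fst ` set ?xs" for m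
        using xs[OF that] growth_pos by auto
      show "germ_cmp m m'" if "m \<in> fst ` set ?xs" "m' \<in> fst ` set ?xs" for m m'
        using xs[OF that(1)] xs[OF that(2)] growth_cmp by auto
    qed
    then show ?thesis
      unfolding S_eq
    proof (elim disjE bexE exE conjE)
      fix m v assume v: "v \<noteq> 0" and lim: "((\<lambda>x. S x /\<^sub>R m x) \<longlongrightarrow> v) at_top"
      have "filterlim (\<lambda>N::nat. real (2 * N)) at_top sequentially" "filterlim (\<lambda>N::nat. real (2 * N + 1)) at_top sequentially"
        by real_asymp+
      from this[THEN filterlim_compose[OF lim]]
      have l: "(\<lambda>N. S (real (2 * N)) /\<^sub>R m (real (2 * N))) \<longlonglongrightarrow> v" "(\<lambda>N. S (real (2 * N + 1)) /\<^sub>R m (real (2 * N + 1))) \<longlonglongrightarrow> v"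
        by simp_all
      have ev: "filterlim (\<lambda>N::nat. 2 * N) sequentially sequentially" "filterlim (\<lambda>N::nat. 2 * N + 1) sequentially sequentially"
        by real_asymp+
      have "(\<lambda>N. fst (S (real (2 * N)) /\<^sub>R m (real (2 * N))) + snd (S (real (2 * N)) /\<^sub>R m (real (2 * N)))) \<longlonglongrightarrow> fst v + snd v"
        by (intro tendsto_intros l)
      moreover have "\<forall>\<^sub>F N in sequentially. fst (S (real (2 * N)) /\<^sub>R m (real (2 * N))) + snd (S (real (2 * N)) /\<^sub>R m (real (2 * N))) = 0"
        using eventually_compose_filterlim[OF Z ev(1)]
        by eventually_elim (simp add: scaleR_add_right[symmetric])
      ultimately have "(\<lambda>N::nat. 0) \<longlonglongrightarrow> fst v + snd v" by (rule Lim_transform_eventually)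
      then have 1: "fst v + snd v = 0" by (simp add: LIMSEQ_const_iff)
      have "(\<lambda>N. fst (S (real (2 * N + 1)) /\<^sub>R m (real (2 * N + 1))) - snd (S (real (2 * N + 1)) /\<^sub>R m (real (2 * N + 1)))) \<longlonglongrightarrow> fst v - snd v"
        by (intro tendsto_intros l)
      moreover have "\<forall>\<^sub>F N in sequentially. fst (S (real (2 * N + 1)) /\<^sub>R m (real (2 * N + 1))) - snd (S (real (2 * N + 1)) /\<^sub>R m (real (2 * N + 1))) = 0"
        using eventually_compose_filterlim[OF Z ev(2)]
        by eventually_elim simp
      ultimately have "(\<lambda>N::nat. 0) \<longlonglongrightarrow> fst v - snd v" by (rule Lim_transform_eventually)
      then have 2: "fst v - snd v = 0" by (simp add: LIMSEQ_const_iff)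
      from 1 2 have "v = 0" by (simp add: prod_eq_iff)
      with v show ?thesis by simp
    qed
  qed
  then have z: "\<forall>\<^sub>F x in at_top. (\<Sum>y\<leftarrow>c. growth_eval (snd (snd y)) x *\<^sub>R fst y) = 0"
     "\<forall>\<^sub>F x in at_top. (\<Sum>y\<leftarrow>c. growth_eval (snd (snd y)) x *\<^sub>R fst (snd y)) = 0"
    unfolding fst_S[symmetric] snd_S[symmetric] by (auto elim: eventually_mono)
  have M': "is_growth (snd (snd y))" if "y \<in> set c" for y
    using M[of "fst y" "fst (snd y)" "snd (snd y)"] that by simp
  obtain \<sigma> where \<sigma>: "\<And>z. Re z > \<sigma> \<Longrightarrow> (\<Sum>y\<leftarrow>c. fst y * growth_eval (snd (snd y)) z) = 0"
    using growth_sum_zero_continuation[OF M' z(1)] by blast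
  obtain \<tau> where \<tau>: "\<And>z. Re z > \<tau> \<Longrightarrow> (\<Sum>y\<leftarrow>c. fst (snd y) * growth_eval (snd (snd y)) z) = 0"
    using growth_sum_zero_continuation[OF M' z(2)] by blast
  show ?thesis
    by (rule exI[of _ "max \<sigma> \<tau>"]) (simp add: case_prod_unfold \<sigma> \<tau>)
qed

section \<open>Fourier inversion and shifts of vertical lines\<close>

lemma integrable_inverse_cube:
  "integrable lborel (\<lambda>t::real. 1 / (1 + \<bar>t\<bar>) ^ 3)"
proof (rule Bochner_Integration.integrable_bound)
  have "set_integrable lborel (einterval (-\<infinity>) \<infinity>) (\<lambda>x. inverse (1 + x^2))"
    by (rule integrable_inverse_1_plus_square)
  then show "integrable lborel (\<lambda>x::real. inverse (1 + x^2))"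
    by (simp add: set_integrable_def)
  show "AE t in lborel. norm (1 / (1 + \<bar>t::real\<bar>) ^ 3) \<le> norm (inverse (1 + t\<^sup>2))"
  proof (rule AE_I2)
    fix t :: real
    have "1 + t\<^sup>2 \<le> 1 + t\<^sup>2 + (3 * \<bar>t\<bar> + 2 * t\<^sup>2 + \<bar>t\<bar> ^ 3)" by simp
    also have "\<dots> = (1 + \<bar>t\<bar>) ^ 3" by (simp add: power3_eq_cube power2_eq_square algebra_simps)
    finally show "norm (1 / (1 + \<bar>t\<bar>) ^ 3) \<le> norm (inverse (1 + t\<^sup>2))"
      by (simp add: divide_inverse) (intro le_imp_inverse_le, auto intro: add_pos_nonneg)
  qed
qed simp

lemma gaussian_fourier:
  fixes t :: real
  shows "(LINT x|lborel. std_normal_density x *\<^sub>R iexp (t * x)) = exp (- (t\<^sup>2) / 2)"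
proof -
  have "(LINT x|lborel. std_normal_density x *\<^sub>R iexp (t * x)) = char std_normal_distribution t"
    unfolding char_def by (subst integral_density) (auto simp: normal_density_nonneg)
  then show ?thesis by (simp add: char_std_normal_distribution exp_of_real[symmetric])
qed

lemma gaussian_fourier_scaled:
  fixes t c :: real
  assumes "c > 0"
  shows "(LINT u|lborel. std_normal_density (u / c) *\<^sub>R iexp (- (u * t))) = (c * sqrt (2 * pi) * std_normal_density (c * t))"
proof -
  have "(LINT u|lborel. std_normal_density (u / c) *\<^sub>R iexp (- (u * t))) =
      \<bar>c\<bar> *\<^sub>R (LINT x|lborel. std_normal_density ((0 + c * x) / c) *\<^sub>R iexp (- ((0 + c * x) * t)))"
    using assms by (intro lborel_integral_real_affine) simp
  also have "(\<lambda>x. std_normal_density ((0 + c * x) / c) *\<^sub>R iexp (- ((0 + c * x) * t))) =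
      (\<lambda>x. std_normal_density x *\<^sub>R iexp ((- (c * t)) * x))"
    using assms by (intro ext) (simp add: algebra_simps)
  also have "(LINT x|lborel. std_normal_density x *\<^sub>R iexp ((- (c * t)) * x)) = exp (- ((- (c * t))\<^sup>2) / 2)"
    by (rule gaussian_fourier)
  finally show ?thesis
    using assms by (simp add: std_normal_density_def scaleR_conv_of_real exp_of_real[symmetric])
qed

text \<open>Gaussian regularisation of the outer integral, followed by Fubini.\<close>

lemma fourier_inversion_at_0:
  fixes G :: "real \<Rightarrow> complex"
  assumes cont: "continuous_on UNIV G" and bdd: "\<And>t. norm (G t) \<le> B" and int: "integrable lborel G"
    and int': "integrable lborel (\<lambda>u. LINT t|lborel. G t * iexp (- (u * t)))"
  shows "(LINT u|lborel. LINT t|lborel. G t * iexp (- (u * t))) = 2 * pi * G 0"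
proof -
  define Gh where "Gh u = (LINT t|lborel. G t * iexp (- (u * t)))" for u :: real
  \<comment> \<open>The widths of the Gaussians: \<open>std_normal_density (u / c n)\<close> tends
    to 1 / sqrt (2 pi) for each u, while its Fourier transform concentrates at t = 0.\<close>
  define c where "c n = real (Suc n)" for n
  have c: "c n > 0" for n by (simp add: c_def)
  have [measurable]: "G \<in> borel_measurable borel" using cont by (rule borel_measurable_continuous_onI)
  have [measurable]: "Gh \<in> borel_measurable borel"
    using borel_measurable_integrable[OF int'] unfolding Gh_def by simp
  have dens_int: "integrable lborel (\<lambda>u. std_normal_density (u / c n))" for n
    using lborel_integrable_real_affine[OF integrable_normal_density[of 1 0], of "1 / c n" 0] c[of n] by simp
  have swap: "(LINT u|lborel. std_normal_density (u / c n) *\<^sub>R Gh u) =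
      (LINT t|lborel. G t * (c n * sqrt (2 * pi) * std_normal_density (c n * t)))" for n
  proof -
    have "(LINT u|lborel. std_normal_density (u / c n) *\<^sub>R Gh u) =
        (LINT u|lborel. LINT t|lborel. std_normal_density (u / c n) *\<^sub>R (G t * iexp (- (u * t))))"
      unfolding Gh_def by simp
    also have "\<dots> = (LINT t|lborel. LINT u|lborel. std_normal_density (u / c n) *\<^sub>R (G t * iexp (- (u * t))))"
    proof (rule lborel_pair.Fubini_integral)
      show "integrable (lborel \<Otimes>\<^sub>M lborel)
          (\<lambda>(t, u). std_normal_density (u / c n) *\<^sub>R (G t * iexp (- (u * t))))"
      proof (rule lborel_pair.Fubini_integrable)
        show "(\<lambda>(t, u). std_normal_density (u / c n) *\<^sub>R (G t * iexp (- (u * t))))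
            \<in> borel_measurable (lborel \<Otimes>\<^sub>M lborel)" by measurable
        have "(\<lambda>t. LINT u|lborel. norm (case (t, u) of (t, u) \<Rightarrow> std_normal_density (u / c n) *\<^sub>R (G t * iexp (- (u * t))))) =
            (\<lambda>t. norm (G t) * (LINT u|lborel. std_normal_density (u / c n)))"
          by (simp add: norm_mult normal_density_nonneg mult.commute)
        then show "integrable lborel (\<lambda>t. LINT u|lborel. norm (case (t, u) of (t, u) \<Rightarrow> std_normal_density (u / c n) *\<^sub>R (G t * iexp (- (u * t)))))"
          using int by simp
        show "AE t in lborel. integrable lborel (\<lambda>u. case (t, u) of (t, u) \<Rightarrow> std_normal_density (u / c n) *\<^sub>R (G t * iexp (- (u * t))))"
        proof (rule AE_I2)
          fix t
          have "integrable lborel (\<lambda>u. norm (G t) * std_normal_density (u / c n))" using dens_int by simp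
          then show "integrable lborel (\<lambda>u. case (t, u) of (t, u) \<Rightarrow> std_normal_density (u / c n) *\<^sub>R (G t * iexp (- (u * t))))"
          proof (rule Bochner_Integration.integrable_bound)
            show "(\<lambda>u. case (t, u) of (t, u) \<Rightarrow> std_normal_density (u / c n) *\<^sub>R (G t * iexp (- (u * t)))) \<in> borel_measurable lborel"
              unfolding prod.case by measurable
          qed (simp add: norm_mult normal_density_nonneg)
        qed
      qed
    qed
    also have "\<dots> = (LINT t|lborel. G t * (c n * sqrt (2 * pi) * std_normal_density (c n * t)))"
    proof (rule Bochner_Integration.integral_cong[OF refl])
      fix t
      have "(LINT u|lborel. std_normal_density (u / c n) *\<^sub>R (G t * iexp (- (u * t)))) =
          (LINT u|lborel. G t * (std_normal_density (u / c n) *\<^sub>R iexp (- (u * t))))"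
        by simp
      also have "\<dots> = G t * (LINT u|lborel. std_normal_density (u / c n) *\<^sub>R iexp (- (u * t)))"
        by (rule integral_mult_right_zero)
      also have "\<dots> = G t * (c n * sqrt (2 * pi) * std_normal_density (c n * t))"
        unfolding gaussian_fourier_scaled[OF c] ..
      finally show "(LINT u|lborel. std_normal_density (u / c n) *\<^sub>R (G t * iexp (- (u * t)))) =
          G t * (c n * sqrt (2 * pi) * std_normal_density (c n * t))" .
    qed
    finally show ?thesis .
  qed
  have rescale: "(LINT t|lborel. G t * (c n * sqrt (2 * pi) * std_normal_density (c n * t))) =
      sqrt (2 * pi) * (LINT s|lborel. std_normal_density s *\<^sub>R G (s / c n))" for n
  proof -
    have "(LINT t|lborel. G t * (c n * sqrt (2 * pi) * std_normal_density (c n * t))) =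
        \<bar>1 / c n\<bar> *\<^sub>R (LINT s|lborel. G (0 + 1 / c n * s) * (c n * sqrt (2 * pi) * std_normal_density (c n * (0 + 1 / c n * s))))"
      using c[of n] by (intro lborel_integral_real_affine) simp
    also have "\<dots> = (LINT s|lborel. \<bar>1 / c n\<bar> *\<^sub>R (G (0 + 1 / c n * s) * (c n * sqrt (2 * pi) * std_normal_density (c n * (0 + 1 / c n * s)))))"
      by simp
    also have "(\<lambda>s. \<bar>1 / c n\<bar> *\<^sub>R (G (0 + 1 / c n * s) * (c n * sqrt (2 * pi) * std_normal_density (c n * (0 + 1 / c n * s))))) =
        (\<lambda>s. sqrt (2 * pi) * (std_normal_density s *\<^sub>R G (s / c n)))"
      using c[of n] by (intro ext) (simp add: scaleR_conv_of_real field_simps)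
    also have "(LINT s|lborel. sqrt (2 * pi) * (std_normal_density s *\<^sub>R G (s / c n))) =
        sqrt (2 * pi) * (LINT s|lborel. std_normal_density s *\<^sub>R G (s / c n))"
      by (rule integral_mult_right_zero)
    finally show ?thesis .
  qed
  have "(\<lambda>n. LINT u|lborel. std_normal_density (u / c n) *\<^sub>R Gh u) \<longlonglongrightarrow>
      (LINT u|lborel. (1 / sqrt (2 * pi)) *\<^sub>R Gh u)"
  proof (rule integral_dominated_convergence)
    show "integrable lborel (\<lambda>u. norm (Gh u))" using int' unfolding Gh_def by simp
    show "AE u in lborel. norm (std_normal_density (u / c n) *\<^sub>R Gh u) \<le> norm (Gh u)" for n
    proof (rule AE_I2)
      fix u
      have "std_normal_density (u / c n) \<le> 1 / sqrt (2 * pi) * 1"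
        unfolding std_normal_density_def by (intro mult_left_mono) simp_all
      also have "\<dots> \<le> 1"
        using pi_ge_two by (simp add: real_le_rsqrt)
      finally show "norm (std_normal_density (u / c n) *\<^sub>R Gh u) \<le> norm (Gh u)"
        by (simp add: normal_density_nonneg mult_left_le_one_le)
    qed
    show "AE u in lborel. (\<lambda>n. std_normal_density (u / c n) *\<^sub>R Gh u) \<longlonglongrightarrow> (1 / sqrt (2 * pi)) *\<^sub>R Gh u"
    proof (rule AE_I2)
      fix u
      have "(\<lambda>n. u / c n) \<longlonglongrightarrow> 0" unfolding c_def by real_asymp
      then have "(\<lambda>n. (1 / sqrt (2 * pi)) * exp (- (u / c n)\<^sup>2 / 2)) \<longlonglongrightarrow> (1 / sqrt (2 * pi)) * exp (- 0\<^sup>2 / 2)"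
        by (intro tendsto_intros) auto
      then show "(\<lambda>n. std_normal_density (u / c n) *\<^sub>R Gh u) \<longlonglongrightarrow> (1 / sqrt (2 * pi)) *\<^sub>R Gh u"
        unfolding std_normal_density_def by (intro tendsto_intros) simp
    qed
  qed (auto simp: std_normal_density_def)
  \<comment> \<open>On the other side of Fubini the Gaussians form an approximate identity:
    continuity of G at 0 gives the pointwise limit and the bound B the domination.\<close>
  moreover have "(\<lambda>n. LINT s|lborel. std_normal_density s *\<^sub>R G (s / c n)) \<longlonglongrightarrow> (LINT s|lborel. std_normal_density s *\<^sub>R G 0)"
  proof (rule integral_dominated_convergence)
    show "integrable lborel (\<lambda>s. B * std_normal_density s)" by simp
    show "AE s in lborel. norm (std_normal_density s *\<^sub>R G (s / c n)) \<le> B * std_normal_density s" for n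
      by (rule AE_I2) (simp add: normal_density_nonneg mult.commute[of B] mult_left_mono bdd)
    show "AE s in lborel. (\<lambda>n. std_normal_density s *\<^sub>R G (s / c n)) \<longlonglongrightarrow> std_normal_density s *\<^sub>R G 0"
    proof (rule AE_I2)
      fix s
      have "(\<lambda>n. s / c n) \<longlonglongrightarrow> 0" unfolding c_def by real_asymp
      moreover have "isCont G 0" using cont by (simp add: continuous_on_eq_continuous_at)
      ultimately have "(\<lambda>n. G (s / c n)) \<longlonglongrightarrow> G 0" by (rule isCont_tendsto_compose[rotated])
      then show "(\<lambda>n. std_normal_density s *\<^sub>R G (s / c n)) \<longlonglongrightarrow> std_normal_density s *\<^sub>R G 0"
        by (intro tendsto_intros)
    qed
  qed auto
  then have "(\<lambda>n. sqrt (2 * pi) * (LINT s|lborel. std_normal_density s *\<^sub>R G (s / c n))) \<longlonglongrightarrow>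
      sqrt (2 * pi) * (LINT s|lborel. std_normal_density s *\<^sub>R G 0)"
    by (intro tendsto_intros)
  ultimately have "(LINT u|lborel. (1 / sqrt (2 * pi)) *\<^sub>R Gh u) = sqrt (2 * pi) * (LINT s|lborel. std_normal_density s *\<^sub>R G 0)"
    unfolding swap rescale by (rule LIMSEQ_unique)
  moreover have "(LINT s|lborel. std_normal_density s *\<^sub>R G 0) = G 0"
    by (subst integral_scaleR_left) simp_all
  ultimately have eq: "(1 / sqrt (2 * pi)) *\<^sub>R (LINT u|lborel. Gh u) = sqrt (2 * pi) * G 0"
    by simp
  \<comment> \<open>One factor sqrt (2 pi) stems from the limiting weight in u, the other from the
    transform of the Gaussian.\<close>
  have "(LINT u|lborel. Gh u) = sqrt (2 * pi) *\<^sub>R ((1 / sqrt (2 * pi)) *\<^sub>R (LINT u|lborel. Gh u))"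
    by simp
  also have "\<dots> = complex_of_real (sqrt (2 * pi) * sqrt (2 * pi)) * G 0"
    unfolding eq by (simp add: scaleR_conv_of_real del: real_sqrt_mult_self)
  also have "\<dots> = 2 * pi * G 0" by simp
  finally show ?thesis by (simp add: Gh_def)
qed

section \<open>Integrals along vertical lines\<close>

lemma exp_Complex: "exp (- (complex_of_real u * Complex \<sigma> t)) = of_real (exp (- u * \<sigma>)) * iexp (- (u * t))"
proof -
  have "- (complex_of_real u * Complex \<sigma> t) = of_real (- u * \<sigma>) + \<i> * of_real (- (u * t))"
    by (simp add: complex_eq_iff)
  then show ?thesis by (simp only: exp_add exp_of_real)
qed

lemma continuous_on_Complex [continuous_intros]: "continuous_on A (\<lambda>t. Complex \<sigma> t)"
proof -
  have "Complex \<sigma> = (\<lambda>t. of_real \<sigma> + \<i> * of_real t)"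
    by (rule ext) (simp add: complex_eq_iff)
  then show ?thesis by (simp only:) (intro continuous_intros)
qed

lemma line_integrable:
  fixes F :: "complex \<Rightarrow> complex"
  assumes cont: "continuous_on {z. Re z > 0} F" and "\<sigma> > 0"
    and decay: "\<And>t. norm (F (Complex \<sigma> t)) \<le> C / (1 + \<bar>t\<bar>) ^ 3"
  shows "continuous_on UNIV (\<lambda>t. F (Complex \<sigma> t))" "integrable lborel (\<lambda>t. F (Complex \<sigma> t))"
    "norm (F (Complex \<sigma> t)) \<le> C"
proof -
  show c: "continuous_on UNIV (\<lambda>t. F (Complex \<sigma> t))"
    by (rule continuous_on_compose2[OF cont continuous_on_Complex]) (use assms in auto)
  have "integrable lborel (\<lambda>t::real. C * (1 / (1 + \<bar>t\<bar>) ^ 3))"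
    by (rule integrable_mult_right[OF integrable_inverse_cube])
  then show "integrable lborel (\<lambda>t. F (Complex \<sigma> t))"
  proof (rule Bochner_Integration.integrable_bound)
    show "AE t in lborel. norm (F (Complex \<sigma> t)) \<le> norm (C * (1 / (1 + \<bar>t\<bar>) ^ 3))"
      using decay order_trans[OF norm_ge_zero decay[of 0]] by (intro AE_I2) simp
  qed (use borel_measurable_continuous_onI[OF c] in simp)
  have C: "C \<ge> 0" using order_trans[OF norm_ge_zero decay[of 0]] by simp
  have "norm (F (Complex \<sigma> t)) \<le> C / (1 + \<bar>t\<bar>) ^ 3" by (rule decay)
  also have "\<dots> \<le> C / 1" by (rule divide_left_mono) (use C in \<open>auto intro: one_le_power\<close>)
  finally show "norm (F (Complex \<sigma> t)) \<le> C" by simp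
qed

lemma line_integral_truncation:
  fixes h :: "real \<Rightarrow> complex"
  assumes "integrable lborel h"
  shows "(\<lambda>n. LINT t|lborel. indicator {- real n..real n} t *\<^sub>R h t) \<longlonglongrightarrow> (LINT t|lborel. h t)"
proof (rule integral_dominated_convergence)
  show "integrable lborel (\<lambda>t. norm (h t))" using assms by simp
  have [measurable]: "h \<in> borel_measurable borel" using borel_measurable_integrable[OF assms] by simp
  show "h \<in> borel_measurable lborel" "(\<lambda>t. indicator {- real n..real n} t *\<^sub>R h t) \<in> borel_measurable lborel" for n
    by measurable
  show "AE t in lborel. norm (indicator {- real n..real n} t *\<^sub>R h t) \<le> norm (h t)" for n
    by (rule AE_I2) (simp add: indicator_def)
  show "AE t in lborel. (\<lambda>n. indicator {- real n..real n} t *\<^sub>R h t) \<longlonglongrightarrow> h t"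
  proof (rule AE_I2)
    fix t
    obtain N where N: "\<bar>t\<bar> \<le> real N" using real_arch_simple by blast
    have "\<forall>\<^sub>F n in sequentially. h t = indicator {- real n..real n} t *\<^sub>R h t"
      using eventually_ge_at_top[of N]
    proof eventually_elim
      case (elim n)
      with N have "t \<in> {- real n..real n}" by (auto simp: abs_le_iff)
      then show ?case by simp
    qed
    then show "(\<lambda>n. indicator {- real n..real n} t *\<^sub>R h t) \<longlonglongrightarrow> h t"
      by (rule Lim_transform_eventually[OF tendsto_const])
  qed
qed

text \<open>Instead of a rectangle contour, a primitive of the integrand on the open half-plane is used: its
  increments along the horizontal edges tend to zero.\<close>

lemma line_integral_shift:
  assumes holo: "F holomorphic_on {z. Re z > 0}" and \<sigma>: "0 < \<sigma>1" "\<sigma>1 \<le> \<sigma>2"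
    and decay: "\<And>\<sigma> t. \<sigma>1 \<le> \<sigma> \<Longrightarrow> \<sigma> \<le> \<sigma>2 \<Longrightarrow> norm (F (Complex \<sigma> t)) \<le> C / (1 + \<bar>t\<bar>) ^ 3"
  shows "(LINT t|lborel. F (Complex \<sigma>1 t) * exp (- (of_real u * Complex \<sigma>1 t)) * \<i>) =
         (LINT t|lborel. F (Complex \<sigma>2 t) * exp (- (of_real u * Complex \<sigma>2 t)) * \<i>)"
proof -
  define h where "h z = F z * exp (- (of_real u * z))" for z
  let ?S = "{z. Re z > 0}"
  have conv: "convex ?S" and op: "open ?S" by (rule convex_halfspace_Re_gt, rule open_halfspace_Re_gt)
  have h_holo: "h holomorphic_on ?S" unfolding h_def by (intro holomorphic_intros holo)
  have "\<exists>H. \<forall>z\<in>?S. (H has_field_derivative h z) (at z within ?S)"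
    by (rule holomorphic_convex_primitive'[OF conv op h_holo]) (intro exI ballI)
  then obtain H where H: "\<forall>z\<in>?S. (H has_field_derivative h z) (at z within ?S)" by (elim exE)
  have H': "(H has_field_derivative h z) (at z)" if "Re z > 0" for z
    using bspec[OF H, of z] that at_within_open[OF _ op, of z] by simp
  have norm_h: "norm (h (Complex \<sigma> t)) \<le> C / (1 + \<bar>t\<bar>) ^ 3 * exp (\<bar>u\<bar> * \<sigma>2)"
    if "\<sigma>1 \<le> \<sigma>" "\<sigma> \<le> \<sigma>2" for \<sigma> t
  proof -
    have "- u * \<sigma> \<le> \<bar>u\<bar> * \<sigma>" using that \<sigma> by (intro mult_right_mono) auto
    also have "\<dots> \<le> \<bar>u\<bar> * \<sigma>2" using that by (intro mult_left_mono) auto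
    finally have "norm (exp (- (complex_of_real u * Complex \<sigma> t))) \<le> exp (\<bar>u\<bar> * \<sigma>2)"
      by (simp add: norm_exp_eq_Re)
    moreover have "0 \<le> C / (1 + \<bar>t\<bar>) ^ 3" by (rule order_trans[OF norm_ge_zero decay[OF that]])
    ultimately show ?thesis unfolding h_def norm_mult
      by (intro mult_mono decay that) simp_all
  qed
  have C: "C \<ge> 0" using order_trans[OF norm_ge_zero decay[of \<sigma>1 0]] \<sigma> by simp
  have trunc: "(LINT t|lborel. indicator {- real n..real n} t *\<^sub>R (h (Complex \<sigma> t) * \<i>)) = H (Complex \<sigma> (real n)) - H (Complex \<sigma> (- real n))"
    if "\<sigma> > 0" for \<sigma> and n :: nat
  proof (rule integral_FTC_Icc[where F = "\<lambda>s. H (Complex \<sigma> s)"])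
    fix t :: real
    have "((\<lambda>s. Complex \<sigma> s) has_vector_derivative \<i>) (at t within {- real n..real n})"
    proof -
      have "Complex \<sigma> = (\<lambda>t. of_real \<sigma> + \<i> * of_real t)" by (rule ext) (simp add: complex_eq_iff)
      moreover have "((\<lambda>t. of_real \<sigma> + \<i> * of_real t) has_vector_derivative \<i>) (at t within {- real n..real n})"
        by (auto intro!: derivative_eq_intros simp: has_vector_derivative_def scaleR_conv_of_real)
      ultimately show ?thesis by simp
    qed
    from field_vector_diff_chain_within[OF this, of H "h (Complex \<sigma> t)"] H'[of "Complex \<sigma> t"] that
    show "((\<lambda>s. H (Complex \<sigma> s)) has_vector_derivative h (Complex \<sigma> t) * \<i>) (at t within {- real n..real n})"
      by (simp add: o_def mult.commute has_field_derivative_at_within)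
  next
    have "continuous_on ?S h" using h_holo by (rule holomorphic_on_imp_continuous_on)
    then have "continuous_on {- real n..real n} (\<lambda>t. h (Complex \<sigma> t))"
      by (rule continuous_on_compose2[OF _ continuous_on_Complex]) (use that in auto)
    then show "continuous_on {- real n..real n} (\<lambda>t. h (Complex \<sigma> t) * \<i>)"
      by (rule continuous_on_mult_right)
  qed simp
  have int: "integrable lborel (\<lambda>t. h (Complex \<sigma> t) * \<i>)" if "\<sigma>1 \<le> \<sigma>" "\<sigma> \<le> \<sigma>2" for \<sigma>
  proof -
    have "integrable lborel (\<lambda>t. h (Complex \<sigma> t))"
      by (rule line_integrable(2)[where C = "C * exp (\<bar>u\<bar> * \<sigma>2)"])
        (use that \<sigma> norm_h in \<open>auto intro: holomorphic_on_imp_continuous_on h_holo\<close>)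
    then show ?thesis by simp
  qed
  \<comment> \<open>The values s = 1 and s = -1 stand for the upper and the lower edge. The
    increment of H is at most the length of the edge times a bound for h, and for fixed u this bound
    is uniform between \<sigma>1 and \<sigma>2.\<close>
  have edge: "(\<lambda>n. H (Complex \<sigma>2 (s * real n)) - H (Complex \<sigma>1 (s * real n))) \<longlonglongrightarrow> 0" if "\<bar>s\<bar> = 1" for s :: real
  proof (rule Lim_null_comparison)
    show "\<forall>\<^sub>F n in sequentially. norm (H (Complex \<sigma>2 (s * real n)) - H (Complex \<sigma>1 (s * real n)))
        \<le> C / (1 + real n) ^ 3 * exp (\<bar>u\<bar> * \<sigma>2) * (\<sigma>2 - \<sigma>1)"
    proof (rule always_eventually, rule allI)
      fix n :: nat
      let ?T = "closed_segment (Complex \<sigma>1 (s * real n)) (Complex \<sigma>2 (s * real n))"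
      have seg: "\<exists>\<sigma>. z = Complex \<sigma> (s * real n) \<and> \<sigma>1 \<le> \<sigma> \<and> \<sigma> \<le> \<sigma>2" if "z \<in> ?T" for z
      proof (intro exI[of _ "Re z"])
        have "z \<in> {z. Im z = s * real n \<and> Re z \<in> closed_segment \<sigma>1 \<sigma>2}"
          using that by (subst (asm) closed_segment_same_Im) simp_all
        then show "z = Complex (Re z) (s * real n) \<and> \<sigma>1 \<le> Re z \<and> Re z \<le> \<sigma>2"
          using \<sigma>(2) by (simp add: complex_eq_iff closed_segment_eq_real_ivl)
      qed
      have "norm (H (Complex \<sigma>2 (s * real n)) - H (Complex \<sigma>1 (s * real n)))
        \<le> C / (1 + real n) ^ 3 * exp (\<bar>u\<bar> * \<sigma>2) * norm (Complex \<sigma>2 (s * real n) - Complex \<sigma>1 (s * real n))"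
      proof (rule field_differentiable_bound[of ?T])
        fix z assume "z \<in> ?T"
        from seg[OF this] obtain \<sigma> where z: "z = Complex \<sigma> (s * real n)" "\<sigma>1 \<le> \<sigma>" "\<sigma> \<le> \<sigma>2"
          by (elim exE conjE)
        show "(H has_field_derivative h z) (at z within ?T)"
          using z \<sigma> by (intro has_field_derivative_at_within[OF H']) simp
        show "norm (h z) \<le> C / (1 + real n) ^ 3 * exp (\<bar>u\<bar> * \<sigma>2)"
          using norm_h[OF z(2,3), of "s * real n"] \<open>\<bar>s\<bar> = 1\<close> by (simp add: z(1) abs_mult)
      qed simp_all
      also have "norm (Complex \<sigma>2 (s * real n) - Complex \<sigma>1 (s * real n)) = \<sigma>2 - \<sigma>1"
        using \<sigma> by (simp add: cmod_def)
      finally show "norm (H (Complex \<sigma>2 (s * real n)) - H (Complex \<sigma>1 (s * real n)))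
        \<le> C / (1 + real n) ^ 3 * exp (\<bar>u\<bar> * \<sigma>2) * (\<sigma>2 - \<sigma>1)" .
    qed
    show "(\<lambda>n. C / (1 + real n) ^ 3 * exp (\<bar>u\<bar> * \<sigma>2) * (\<sigma>2 - \<sigma>1)) \<longlonglongrightarrow> 0"
    proof -
      have "(\<lambda>n. 1 / (1 + real n) ^ 3) \<longlonglongrightarrow> 0" by real_asymp
      from tendsto_mult_left[OF this, of "C * exp (\<bar>u\<bar> * \<sigma>2) * (\<sigma>2 - \<sigma>1)"]
      show ?thesis by (simp add: mult_ac)
    qed
  qed
  have "(\<lambda>n. (LINT t|lborel. indicator {- real n..real n} t *\<^sub>R (h (Complex \<sigma>2 t) * \<i>)) -
      (LINT t|lborel. indicator {- real n..real n} t *\<^sub>R (h (Complex \<sigma>1 t) * \<i>))) \<longlonglongrightarrow>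
      (LINT t|lborel. h (Complex \<sigma>2 t) * \<i>) - (LINT t|lborel. h (Complex \<sigma>1 t) * \<i>)"
    using \<sigma> by (intro tendsto_diff line_integral_truncation int) auto
  moreover have "(\<lambda>n. (LINT t|lborel. indicator {- real n..real n} t *\<^sub>R (h (Complex \<sigma>2 t) * \<i>)) -
      (LINT t|lborel. indicator {- real n..real n} t *\<^sub>R (h (Complex \<sigma>1 t) * \<i>))) \<longlonglongrightarrow> 0"
  proof -
    \<comment> \<open>The same four corner values of H, regrouped from vertical into horizontal
      increments.\<close>
    have "(\<lambda>n. (H (Complex \<sigma>2 (1 * real n)) - H (Complex \<sigma>1 (1 * real n))) -
        (H (Complex \<sigma>2 (- 1 * real n)) - H (Complex \<sigma>1 (- 1 * real n)))) \<longlonglongrightarrow> 0 - 0"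
      by (intro tendsto_diff edge) simp_all
    moreover have "0 < \<sigma>2" using \<sigma> by simp
    ultimately show ?thesis by (simp only: trunc \<sigma>(1)) (simp add: algebra_simps)
  qed
  ultimately have "(LINT t|lborel. h (Complex \<sigma>2 t) * \<i>) - (LINT t|lborel. h (Complex \<sigma>1 t) * \<i>) = 0"
    by (rule LIMSEQ_unique)
  then show ?thesis by (simp add: h_def)
qed

section \<open>The Bromwich transform of a rapidly decaying germ\<close>

lemma one_plus_exp_nonzero: "1 + exp (complex_of_real u) \<noteq> 0"
proof -
  have "1 + exp (complex_of_real u) = of_real (1 + exp u)" by (simp add: exp_of_real)
  moreover have "1 + exp u \<noteq> 0" using exp_gt_zero[of u] by linarith
  then have "complex_of_real (1 + exp u) \<noteq> 0" unfolding of_real_eq_0_iff .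
  ultimately show ?thesis by argo
qed

lemma norm_exp_exp: "norm (exp (- t * complex_of_real (exp u))) \<le> exp (norm t * exp u)"
proof -
  have "- Re t \<le> norm t" using abs_Re_le_cmod[of t] by linarith
  then have "- (Re t * exp u) \<le> norm t * exp u"
    using mult_right_mono[of "- Re t" "norm t" "exp u"] by simp
  then show ?thesis by (simp add: norm_exp_eq_Re)
qed

lemma laplace_exponential:
  assumes "c > 0"
  shows "set_integrable lborel {0..} (\<lambda>t::real. exp (- (c * t)))" "(LINT t:{0..}|lborel. exp (- (c * t))) = 1 / c"
proof -
  have "(\<integral>\<^sup>+t. ennreal (exp (- (c * t))) * indicator {0..} t \<partial>lborel) = 0 - - exp (- (c * 0)) / c"
  proof (rule nn_integral_FTC_atLeast[where F = "\<lambda>t. - exp (- (c * t)) / c"])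
    show "((\<lambda>t. - exp (- (c * t)) / c) has_real_derivative exp (- (c * t))) (at t)" for t
      using assms by (auto intro!: derivative_eq_intros)
    show "((\<lambda>t. - exp (- (c * t)) / c) \<longlongrightarrow> 0) at_top" using assms by real_asymp
  qed auto
  then have "(\<integral>\<^sup>+t. ennreal (exp (- (c * t)) * indicator {0..} t) \<partial>lborel) = ennreal (1 / c)"
    by (simp add: ennreal_mult ennreal_indicator)
  then have "has_bochner_integral lborel (\<lambda>t. exp (- (c * t)) * indicator {0..} t) (1 / c)"
    using assms by (intro has_bochner_integral_nn_integral) auto
  then show "set_integrable lborel {0..} (\<lambda>t::real. exp (- (c * t)))" "(LINT t:{0..}|lborel. exp (- (c * t))) = 1 / c"
    by (auto simp: has_bochner_integral_iff set_integrable_def set_lebesgue_integral_def mult.commute)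
qed

text \<open>\<open>F\<close> is kept apart from \<open>flat_eval f\<close> because the two are known
  to agree only far to the right, while moments are wanted for all n >= 0. Holomorphy on the open
  half-plane serves the shift of lines, continuity on the closed one the moment at n = 0.\<close>

locale laplace_germ =
  fixes f :: flat_germ and F :: "complex \<Rightarrow> complex" and s0 \<rho> :: real
  assumes flat: "\<And>z. Re z > s0 \<Longrightarrow> F z = flat_eval f z"
    and holo: "F holomorphic_on {z. Re z > 0}"
    and cont: "continuous_on {z. Re z \<ge> 0} F"
    and decay: "\<And>A. A > 0 \<Longrightarrow> \<exists>C. \<forall>\<sigma> t. 0 \<le> \<sigma> \<and> \<sigma> \<le> A \<longrightarrow> norm (F (Complex \<sigma> t)) \<le> C / (1 + \<bar>t\<bar>) ^ 3"
    and rho_pos: "\<rho> > 0"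
    and bromwich_integrable: "integrable lborel (\<lambda>u. norm (bromwich f u) * exp (\<rho> * exp u))"
begin

lemma cont_pos: "continuous_on {z. Re z > 0} F"
  by (rule continuous_on_subset[OF cont]) auto

lemma line_decay:
  assumes "\<sigma> \<ge> 0"
  obtains C where "\<And>t. norm (F (Complex \<sigma> t)) \<le> C / (1 + \<bar>t\<bar>) ^ 3"
proof -
  obtain C where C: "\<forall>\<sigma>' t. 0 \<le> \<sigma>' \<and> \<sigma>' \<le> \<sigma> + 1 \<longrightarrow> norm (F (Complex \<sigma>' t)) \<le> C / (1 + \<bar>t\<bar>) ^ 3"
    using decay[of "\<sigma> + 1"] assms by auto
  show ?thesis by (rule that[of C]) (use C assms in simp)
qed

lemma line_integral_indep:
  assumes "0 < \<sigma>" "0 < \<tau>"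
  shows "(LINT t|lborel. F (Complex \<sigma> t) * exp (- (of_real u * Complex \<sigma> t)) * \<i>) =
         (LINT t|lborel. F (Complex \<tau> t) * exp (- (of_real u * Complex \<tau> t)) * \<i>)"
proof -
  have *: "(LINT t|lborel. F (Complex \<sigma> t) * exp (- (of_real u * Complex \<sigma> t)) * \<i>) =
         (LINT t|lborel. F (Complex \<tau> t) * exp (- (of_real u * Complex \<tau> t)) * \<i>)"
    if \<sigma>: "0 < \<sigma>" "\<sigma> \<le> \<tau>" for \<sigma> \<tau>
  proof -
    obtain C where C: "\<forall>\<sigma>' t. 0 \<le> \<sigma>' \<and> \<sigma>' \<le> \<tau> \<longrightarrow> norm (F (Complex \<sigma>' t)) \<le> C / (1 + \<bar>t\<bar>) ^ 3"
      using decay[of \<tau>] \<sigma> by auto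
    show ?thesis by (rule line_integral_shift[OF holo \<sigma>, of C]) (use C \<sigma> in simp)
  qed
  show ?thesis
  proof (cases "\<sigma> \<le> \<tau>")
    case True
    show ?thesis by (rule *[OF assms(1) True])
  next
    case False
    then have "\<tau> \<le> \<sigma>" by simp
    show ?thesis by (rule *[OF assms(2) \<open>\<tau> \<le> \<sigma>\<close>, symmetric])
  qed
qed

text \<open>The transform is defined by lines far to the right, where \<open>F\<close> may replace
  \<open>flat_eval f\<close>; shifting the line then reaches every \<tau> > 0.\<close>

lemma bromwich_line_eq:
  assumes "\<sigma> > max s0 0" "\<tau> > 0"
  shows "bromwich_line f \<sigma> u =
    1 / (2 * pi * \<i>) * (LINT t|lborel. F (Complex \<tau> t) * exp (- (of_real u * Complex \<tau> t)) * \<i>)"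
proof -
  have "bromwich_integrand f \<sigma> u = (\<lambda>t. F (Complex \<sigma> t) * exp (- (of_real u * Complex \<sigma> t)) * \<i>)"
    using assms by (intro ext) (simp add: bromwich_integrand_def flat)
  then show ?thesis
    using line_integral_indep[of \<sigma> \<tau> u] assms by (simp add: bromwich_line_def)
qed

lemma bromwich_eq:
  assumes "\<tau> > 0"
  shows "bromwich f u =
    1 / (2 * pi * \<i>) * (LINT t|lborel. F (Complex \<tau> t) * exp (- (of_real u * Complex \<tau> t)) * \<i>)"
    (is "_ = ?w")
proof -
  have ev: "\<forall>\<^sub>F \<sigma> in at_top. bromwich_line f \<sigma> u = ?w"
    using eventually_gt_at_top[of "max s0 0"] by eventually_elim (rule bromwich_line_eq[OF _ assms])
  show ?thesis unfolding bromwich_def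
  proof (rule the_equality[where P = "\<lambda>w. \<forall>\<^sub>F \<sigma> in at_top. bromwich_line f \<sigma> u = w", OF ev])
    fix w assume "\<forall>\<^sub>F \<sigma> in at_top. bromwich_line f \<sigma> u = w"
    with ev have "\<forall>\<^sub>F \<sigma>::real in at_top. w = ?w" by eventually_elim simp
    then show "w = ?w" by simp
  qed
qed

lemma bromwich_measurable [measurable]: "bromwich f \<in> borel_measurable borel"
proof -
  have c: "continuous_on UNIV (\<lambda>t. F (Complex 1 t))"
    by (rule continuous_on_compose2[OF cont_pos continuous_on_Complex]) auto
  have [measurable]: "(\<lambda>t. F (Complex 1 t)) \<in> borel_measurable borel" "Complex 1 \<in> borel_measurable borel"
    by (rule borel_measurable_continuous_onI[OF c], rule borel_measurable_continuous_onI[OF continuous_on_Complex])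
  have "(\<lambda>u. LINT t|lborel. F (Complex 1 t) * exp (- (of_real u * Complex 1 t)) * \<i>) \<in> borel_measurable borel"
    by measurable
  moreover have "bromwich f = (\<lambda>u. 1 / (2 * pi * \<i>) * (LINT t|lborel. F (Complex 1 t) * exp (- (of_real u * Complex 1 t)) * \<i>))"
    by (rule ext) (rule bromwich_eq, simp)
  ultimately show ?thesis by simp
qed

text \<open>For u >= 0 combine exp u >= u^2/2 with (x - \<rho> u)^2 >= 0; completing this square
  produces the constant x^2/(2 \<rho>).\<close>

lemma exponent_bound: "x * u \<le> \<rho> * exp u + x\<^sup>2 / (2 * \<rho>)" if "x \<ge> 0" for x u :: real
proof (cases "u \<ge> 0")
  case True
  have "u\<^sup>2 / 2 \<le> exp u" using exp_lower_Taylor_quadratic[OF True] True by simp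
  then have "\<rho> * (u\<^sup>2 / 2) \<le> \<rho> * exp u" using rho_pos by (intro mult_left_mono) auto
  moreover have "x * u \<le> \<rho> * (u\<^sup>2 / 2) + x\<^sup>2 / (2 * \<rho>)"
  proof -
    have "0 \<le> (x - \<rho> * u)\<^sup>2 / (2 * \<rho>)" using rho_pos by simp
    also have "\<dots> = \<rho> * (u\<^sup>2 / 2) + x\<^sup>2 / (2 * \<rho>) - x * u"
      using rho_pos by (simp add: power2_eq_square field_simps)
    finally show ?thesis by simp
  qed
  ultimately show ?thesis by linarith
next
  case False
  then have "x * u \<le> 0" using that by (simp add: mult_nonneg_nonpos)
  moreover have "0 \<le> \<rho> * exp u + x\<^sup>2 / (2 * \<rho>)" using rho_pos by simp
  ultimately show ?thesis by linarith
qed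

lemma dominated_integrable:
  fixes g :: "real \<Rightarrow> complex"
  assumes [measurable]: "g \<in> borel_measurable borel" and g: "\<And>u. norm (g u) \<le> K * exp (\<rho> * exp u)"
  shows "integrable lborel (\<lambda>u. bromwich f u * g u)"
proof (rule Bochner_Integration.integrable_bound)
  show "integrable lborel (\<lambda>u. K * (norm (bromwich f u) * exp (\<rho> * exp u)))"
    using bromwich_integrable by simp
  show "AE u in lborel. norm (bromwich f u * g u) \<le> norm (K * (norm (bromwich f u) * exp (\<rho> * exp u)))"
  proof (rule AE_I2)
    fix u :: real
    have "norm (bromwich f u * g u) \<le> norm (bromwich f u) * (K * exp (\<rho> * exp u))"
      unfolding norm_mult by (intro mult_left_mono g) simp
    also have "\<dots> = K * (norm (bromwich f u) * exp (\<rho> * exp u))" by simp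
    also have "\<dots> \<le> norm (K * (norm (bromwich f u) * exp (\<rho> * exp u)))" by simp
    finally show "norm (bromwich f u * g u) \<le> norm (K * (norm (bromwich f u) * exp (\<rho> * exp u)))" .
  qed
qed measurable

text \<open>Uniform for x up to y, so that one dominating function serves a whole sequence of
  exponents tending to 0.\<close>

lemma norm_exp_bound:
  assumes "0 \<le> x" "x \<le> y"
  shows "norm (exp (complex_of_real (x * u))) \<le> exp (y\<^sup>2 / (2 * \<rho>)) * exp (\<rho> * exp u)"
proof -
  have "x * u \<le> \<rho> * exp u + x\<^sup>2 / (2 * \<rho>)" by (rule exponent_bound) fact
  also have "x\<^sup>2 / (2 * \<rho>) \<le> y\<^sup>2 / (2 * \<rho>)"
    using assms rho_pos by (intro divide_right_mono power_mono) auto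
  finally have "exp (x * u) \<le> exp (y\<^sup>2 / (2 * \<rho>) + \<rho> * exp u)" by simp
  then show ?thesis by (simp add: exp_add norm_exp_eq_Re)
qed

lemma laplace_integrable: "x \<ge> 0 \<Longrightarrow> integrable lborel (\<lambda>u. bromwich f u * exp (complex_of_real (x * u)))"
  by (rule dominated_integrable[OF _ norm_exp_bound[OF _ order_refl]]) simp_all

text \<open>On the line through \<sigma> the Fourier transform of \<open>F\<close> is 2 pi times the
  Bromwich transform times exp (\<sigma> u). The weight makes this integrable, so inversion at t = 0
  applies.\<close>

lemma laplace_inversion:
  assumes "\<sigma> > 0"
  shows "F (of_real \<sigma>) = (LINT u|lborel. bromwich f u * exp (complex_of_real (\<sigma> * u)))"
proof -
  obtain C where C: "\<And>t. norm (F (Complex \<sigma> t)) \<le> C / (1 + \<bar>t\<bar>) ^ 3"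
    using line_decay[of \<sigma>] assms by auto
  define G where "G t = F (Complex \<sigma> t)" for t
  note G = line_integrable[OF cont_pos assms C, folded G_def]
  have hat: "(LINT t|lborel. G t * iexp (- (u * t))) = 2 * pi * (bromwich f u * exp (complex_of_real (\<sigma> * u)))" for u
  proof -
    have "(LINT t|lborel. F (Complex \<sigma> t) * exp (- (of_real u * Complex \<sigma> t)) * \<i>) =
        (LINT t|lborel. \<i> * of_real (exp (- u * \<sigma>)) * (G t * iexp (- (u * t))))"
      by (simp only: exp_Complex G_def mult_ac)
    also have "\<dots> = \<i> * of_real (exp (- u * \<sigma>)) * (LINT t|lborel. G t * iexp (- (u * t)))"
      by (rule integral_mult_right_zero)
    finally have "bromwich f u = of_real (exp (- u * \<sigma>)) / (2 * pi) * (LINT t|lborel. G t * iexp (- (u * t)))"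
      unfolding bromwich_eq[OF assms] by simp
    then have "2 * pi * (bromwich f u * exp (complex_of_real (\<sigma> * u))) =
        of_real (exp (- u * \<sigma>) * exp (\<sigma> * u)) * (LINT t|lborel. G t * iexp (- (u * t)))"
      unfolding exp_of_real by simp
    also have "exp (- u * \<sigma>) * exp (\<sigma> * u) = 1" by (simp add: exp_add[symmetric] mult.commute)
    finally show ?thesis by simp
  qed
  have "(LINT u|lborel. LINT t|lborel. G t * iexp (- (u * t))) = 2 * pi * G 0"
    by (rule fourier_inversion_at_0[OF G(1,3,2)])
      (unfold hat, use laplace_integrable[of \<sigma>] assms in simp)
  moreover have "(LINT u|lborel. LINT t|lborel. G t * iexp (- (u * t))) =
      2 * pi * (LINT u|lborel. bromwich f u * exp (complex_of_real (\<sigma> * u)))"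
    unfolding hat by (rule integral_mult_right_zero)
  moreover have "G 0 = F (of_real \<sigma>)" by (simp add: G_def complex_of_real_def)
  ultimately show ?thesis by simp
qed

text \<open>Inversion is available for \<sigma> > 0 only, but the series has a term at n = 0; its
  value is reached along \<sigma> = 1/(n + 1), by continuity of F on one side and dominated
  convergence on the other.\<close>

lemma laplace_inversion_0: "F 0 = (LINT u|lborel. bromwich f u)"
proof (rule LIMSEQ_unique)
  define x where "x n = 1 / real (Suc n)" for n
  have x: "0 < x n" "x n \<le> 1" for n by (simp_all add: x_def)
  have x_lim: "x \<longlonglongrightarrow> 0" unfolding x_def by real_asymp
  have "(\<lambda>n. complex_of_real (x n)) \<longlonglongrightarrow> of_real 0" by (intro tendsto_of_real x_lim)
  then have "(\<lambda>n. F (of_real (x n))) \<longlonglongrightarrow> F (of_real 0)"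
    by (rule continuous_on_tendsto_compose[OF cont]) (use x in \<open>auto intro!: always_eventually less_imp_le\<close>)
  then show "(\<lambda>n. LINT u|lborel. bromwich f u * exp (complex_of_real (x n * u))) \<longlonglongrightarrow> F 0"
    by (simp add: laplace_inversion x)
  show "(\<lambda>n. LINT u|lborel. bromwich f u * exp (complex_of_real (x n * u))) \<longlonglongrightarrow> (LINT u|lborel. bromwich f u)"
  proof (rule integral_dominated_convergence)
    show "integrable lborel (\<lambda>u. exp (1\<^sup>2 / (2 * \<rho>)) * (norm (bromwich f u) * exp (\<rho> * exp u)))"
      using bromwich_integrable by simp
    show "AE u in lborel. norm (bromwich f u * exp (complex_of_real (x n * u)))
        \<le> exp (1\<^sup>2 / (2 * \<rho>)) * (norm (bromwich f u) * exp (\<rho> * exp u))" for n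
    proof (rule AE_I2)
      fix u :: real
      have "norm (bromwich f u * exp (complex_of_real (x n * u))) \<le>
          norm (bromwich f u) * (exp (1\<^sup>2 / (2 * \<rho>)) * exp (\<rho> * exp u))"
        unfolding norm_mult by (intro mult_left_mono norm_exp_bound) (use x[of n] in simp_all)
      then show "norm (bromwich f u * exp (complex_of_real (x n * u)))
          \<le> exp (1\<^sup>2 / (2 * \<rho>)) * (norm (bromwich f u) * exp (\<rho> * exp u))" by (simp add: mult_ac)
    qed
    show "AE u in lborel. (\<lambda>n. bromwich f u * exp (complex_of_real (x n * u))) \<longlonglongrightarrow> bromwich f u"
    proof (rule AE_I2)
      fix u :: real
      have "(\<lambda>n. bromwich f u * exp (complex_of_real (x n * u))) \<longlonglongrightarrow> bromwich f u * exp (complex_of_real (0 * u))"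
        by (intro tendsto_intros x_lim)
      then show "(\<lambda>n. bromwich f u * exp (complex_of_real (x n * u))) \<longlonglongrightarrow> bromwich f u" by simp
    qed
  qed measurable
qed

lemma moment_integrable: "integrable lborel (\<lambda>u. bromwich f u * exp (of_nat n * complex_of_real u))"
  using laplace_integrable[of "real n"] by simp

lemma moment: "(LINT u|lborel. bromwich f u * exp (of_nat n * complex_of_real u)) = F (of_nat n)"
proof (cases "n = 0")
  case True
  then show ?thesis by (simp add: laplace_inversion_0)
next
  case False
  then show ?thesis using laplace_inversion[of "real n"] by simp
qed

lemma bromwich_admissible_germ: "bromwich_admissible f"
  unfolding bromwich_admissible_def
proof (intro exI[of _ "max s0 0"] allI impI conjI)
  fix \<sigma> assume \<sigma>: "\<sigma> > max s0 0"
  then have pos: "\<sigma> > 0" by simp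
  obtain C where C: "\<And>t. norm (F (Complex \<sigma> t)) \<le> C / (1 + \<bar>t\<bar>) ^ 3"
    using line_decay[of \<sigma>] pos by auto
  show "AE u in lborel. integrable lborel (bromwich_integrand f \<sigma> u)"
  proof (rule AE_I2)
    fix u :: real
    have eq: "bromwich_integrand f \<sigma> u = (\<lambda>t. F (Complex \<sigma> t) * exp (- (of_real u * Complex \<sigma> t)) * \<i>)"
      using \<sigma> by (intro ext) (simp add: bromwich_integrand_def flat)
    have c: "continuous_on UNIV (\<lambda>t. F (Complex \<sigma> t))"
      by (rule line_integrable(1)[OF cont_pos pos C])
    have "continuous_on UNIV (bromwich_integrand f \<sigma> u)"
      unfolding eq by (intro continuous_intros c)
    then have m: "bromwich_integrand f \<sigma> u \<in> borel_measurable lborel"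
      using borel_measurable_continuous_onI by simp
    have i: "integrable lborel (\<lambda>t. exp (- u * \<sigma>) *\<^sub>R F (Complex \<sigma> t))"
      using line_integrable(2)[OF cont_pos pos C] by simp
    show "integrable lborel (bromwich_integrand f \<sigma> u)"
      by (rule Bochner_Integration.integrable_bound[OF i m])
        (simp add: eq exp_Complex norm_mult mult.commute)
  qed
next
  fix \<sigma> u assume "\<sigma> > max s0 0"
  then show "bromwich_line f \<sigma> u = bromwich f u"
    using bromwich_line_eq[of \<sigma> 1 u] bromwich_eq[of 1 u] by simp
next
  show "\<forall>\<^sub>F N in sequentially. integrable lborel (\<lambda>u. bromwich f u * exp (of_nat N * complex_of_real u)) \<and>
      (LINT u|lborel. bromwich f u * exp (of_nat N * complex_of_real u)) = flat_eval f (of_nat N)"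
  proof -
    have "\<forall>\<^sub>F N in sequentially. real N > s0"
      using filterlim_real_sequentially by (simp add: filterlim_at_top_dense)
    then show ?thesis
      by eventually_elim (simp add: moment_integrable moment flat)
  qed
qed

section \<open>The minus selector and its recurrence\<close>

lemma sel_minus_integrable: "integrable lborel (sel_minus_integrand f N)"
proof (rule Bochner_Integration.integrable_bound[OF moment_integrable[of N]])
  show "sel_minus_integrand f N \<in> borel_measurable lborel"
    unfolding sel_minus_integrand_def by measurable
  show "AE u in lborel. norm (sel_minus_integrand f N u) \<le> norm (bromwich f u * exp (of_nat N * complex_of_real u))"
  proof (rule AE_I2)
    fix u :: real
    have "norm (1 + exp (complex_of_real u)) = norm (complex_of_real (1 + exp u))" by (simp add: exp_of_real)
    also have "\<dots> = 1 + exp u" unfolding norm_of_real using exp_gt_zero[of u] by linarith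
    finally have "norm (1 + exp (complex_of_real u)) \<ge> 1" by simp
    then show "norm (sel_minus_integrand f N u) \<le> norm (bromwich f u * exp (of_nat N * complex_of_real u))"
      unfolding sel_minus_integrand_def norm_divide
      using frac_le[of "norm (bromwich f u * exp (of_nat N * complex_of_real u))" _ 1 "norm (1 + exp (complex_of_real u))"]
      by simp
  qed
qed

text \<open>Consecutive integrands add up to a factor 1 + exp u, which cancels the denominator and
  leaves a moment. This holds for every N, not just eventually, which lets the presentation start at
  index 0.\<close>

lemma sel_minus_step: "sel_minus f N + sel_minus f (N + 1) = F (of_nat N)"
proof -
  have "sel_minus f N + sel_minus f (N + 1) = (LINT u|lborel. sel_minus_integrand f N u + sel_minus_integrand f (N + 1) u)"
    unfolding sel_minus_def by (rule Bochner_Integration.integral_add[symmetric]) (rule sel_minus_integrable)+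
  also have "(\<lambda>u. sel_minus_integrand f N u + sel_minus_integrand f (N + 1) u) =
      (\<lambda>u. bromwich f u * exp (of_nat N * complex_of_real u))"
  proof (rule ext)
    fix u :: real
    have "exp (of_nat (N + 1) * complex_of_real u) = exp (of_nat N * complex_of_real u) * exp (of_real u)"
      by (simp add: exp_add[symmetric] algebra_simps)
    then have "sel_minus_integrand f N u + sel_minus_integrand f (N + 1) u =
        bromwich f u * exp (of_nat N * complex_of_real u) * (1 + exp (of_real u)) / (1 + exp (of_real u))"
      unfolding sel_minus_integrand_def by (simp only: add_divide_distrib[symmetric]) (simp add: algebra_simps)
    then show "sel_minus_integrand f N u + sel_minus_integrand f (N + 1) u = bromwich f u * exp (of_nat N * complex_of_real u)"
      using one_plus_exp_nonzero by simp
  qed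
  finally show ?thesis by (simp add: moment)
qed

section \<open>The Borel transform and its Laplace integral\<close>

lemma borel_integrable:
  assumes "norm t \<le> \<rho>"
  shows "integrable lborel (\<lambda>u. bromwich f u * exp (- t * complex_of_real (exp u)))"
proof (rule dominated_integrable[where K = 1])
  fix u
  have "norm t * exp u \<le> \<rho> * exp u" using assms by (intro mult_right_mono) auto
  then show "norm (exp (- t * complex_of_real (exp u))) \<le> 1 * exp (\<rho> * exp u)"
    using norm_exp_exp[of t u] by (simp add: order_trans)
qed measurable

text \<open>For real t >= 0 the exponential has modulus at most 1, so the bound \<rho> on t
  disappears and the whole half-line is available for the Laplace integral.\<close>

lemma borel_integrable_nonneg:
  assumes "t \<ge> 0"
  shows "integrable lborel (\<lambda>u. bromwich f u * exp (- complex_of_real t * complex_of_real (exp u)))"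
proof (rule dominated_integrable[where K = 1])
  fix u
  have "- (t * exp u) \<le> \<rho> * exp u" using assms rho_pos by (simp add: order_trans[of _ 0])
  then show "norm (exp (- complex_of_real t * complex_of_real (exp u))) \<le> 1 * exp (\<rho> * exp u)"
    by (simp add: norm_exp_eq_Re)
qed measurable

text \<open>Partial sums of the exponential series are bounded by exp (norm t * exp u), which the
  weight dominates for norm t <= \<rho>. Thus sum and integral may be exchanged, and \<rho> is a
  lower bound for the radius of convergence.\<close>

lemma borel_sums:
  assumes t: "norm t \<le> \<rho>"
  shows "(\<lambda>n. (- 1) ^ n * F (of_nat n) * t ^ n / fact n) sums
    (LINT u|lborel. bromwich f u * exp (- t * complex_of_real (exp u)))"
proof -
  define g where "g n u = bromwich f u * ((- t * complex_of_real (exp u)) ^ n /\<^sub>R fact n)" for n u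
  have g_eq: "g n u = (- t) ^ n / fact n * (bromwich f u * exp (of_nat n * complex_of_real u))" for n u
  proof -
    have "(- t * complex_of_real (exp u)) ^ n = (- t) ^ n * exp (of_nat n * complex_of_real u)"
      by (simp only: power_mult_distrib exp_of_nat_mult exp_of_real)
    then show ?thesis unfolding g_def by (simp add: scaleR_conv_of_real divide_inverse)
  qed
  have g_int: "integrable lborel (g n)" for n
    unfolding g_eq by (intro integrable_mult_right moment_integrable)
  have g_moment: "(LINT u|lborel. g n u) = (- 1) ^ n * F (of_nat n) * t ^ n / fact n" for n
  proof -
    have "(LINT u|lborel. g n u) = (- t) ^ n / fact n * F (of_nat n)"
      unfolding g_eq moment[symmetric] by (rule integral_mult_right_zero)
    then show ?thesis by (simp add: power_minus[of t] mult_ac)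
  qed
  have "(\<lambda>N. LINT u|lborel. (\<Sum>n<N. g n u)) \<longlonglongrightarrow> (LINT u|lborel. bromwich f u * exp (- t * complex_of_real (exp u)))"
  proof (rule integral_dominated_convergence)
    show "integrable lborel (\<lambda>u. norm (bromwich f u) * exp (\<rho> * exp u))" by (rule bromwich_integrable)
    show "AE u in lborel. (\<lambda>N. \<Sum>n<N. g n u) \<longlonglongrightarrow> bromwich f u * exp (- t * complex_of_real (exp u))"
      unfolding g_def sum_distrib_left[symmetric]
      by (intro AE_I2 tendsto_mult_left) (use exp_converges in \<open>simp add: sums_def\<close>)
    show "AE u in lborel. norm (\<Sum>n<N. g n u) \<le> norm (bromwich f u) * exp (\<rho> * exp u)" for N
    proof (rule AE_I2)
      fix u :: real
      let ?y = "- t * complex_of_real (exp u)"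
      have "norm (\<Sum>n<N. ?y ^ n /\<^sub>R fact n) \<le> (\<Sum>n<N. norm (?y ^ n /\<^sub>R fact n))"
        by (rule norm_sum)
      also have "\<dots> = (\<Sum>n<N. norm ?y ^ n /\<^sub>R fact n)" by (simp add: norm_power)
      also have "\<dots> \<le> exp (norm ?y)"
        using exp_converges[of "norm ?y"] unfolding sums_iff
        by (elim conjE) (drule sum_le_suminf[of _ "{..<N}"], simp_all)
      also have "\<dots> \<le> exp (\<rho> * exp u)"
        using t by (simp add: norm_mult mult_right_mono)
      finally show "norm (\<Sum>n<N. g n u) \<le> norm (bromwich f u) * exp (\<rho> * exp u)"
        unfolding g_def sum_distrib_left[symmetric] norm_mult by (intro mult_left_mono) auto
    qed
  qed (use g_int in \<open>auto simp: g_def\<close>)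
  moreover have "(LINT u|lborel. (\<Sum>n<N. g n u)) = (\<Sum>n<N. (- 1) ^ n * F (of_nat n) * t ^ n / fact n)" for N
    by (subst Bochner_Integration.integral_sum) (simp_all add: g_int g_moment)
  ultimately show ?thesis by (simp add: sums_def)
qed

lemma borel_laplace:
  defines "A \<equiv> \<lambda>t::real. LINT u|lborel. bromwich f u * exp (- complex_of_real t * complex_of_real (exp u))"
  shows "set_integrable lborel {0..} (\<lambda>t. exp (- complex_of_real t) * A t)"
    "(LINT t:{0..}|lborel. exp (- complex_of_real t) * A t) = sel_minus f 0"
proof -
  \<comment> \<open>exp (-t) and exp (-t exp u) merged into one nonnegative kernel, cut off to t >=
    0 so that Fubini runs over the whole plane. Its integral over t is the factor 1 / (1 + exp u) of
    the minus selector.\<close>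
  define k where "k u t = indicator {0..} t *\<^sub>R exp (- ((1 + exp u) * t))" for u t :: real
  have k_eq: "k u = (\<lambda>t. indicator {0..} t *\<^sub>R exp (- ((1 + exp u) * t)))" for u
    by (rule ext) (simp add: k_def)
  have k_int: "integrable lborel (k u)" "(LINT t|lborel. k u t) = 1 / (1 + exp u)" for u
    using laplace_exponential[of "1 + exp u"] exp_gt_zero[of u]
    unfolding k_eq by (simp_all add: set_integrable_def set_lebesgue_integral_def add_pos_pos)
  have k_nonneg: "k u t \<ge> 0" for u t by (simp add: k_def)
  have [measurable]: "(\<lambda>x. k (fst x) (snd x)) \<in> borel_measurable (borel \<Otimes>\<^sub>M borel)"
    unfolding k_def by measurable
  have int: "integrable (lborel \<Otimes>\<^sub>M lborel) (\<lambda>(u, t). bromwich f u * complex_of_real (k u t))"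
  proof (rule lborel_pair.Fubini_integrable)
    show "(\<lambda>(u, t). bromwich f u * complex_of_real (k u t)) \<in> borel_measurable (lborel \<Otimes>\<^sub>M lborel)"
      unfolding case_prod_beta by measurable
    have eq: "(\<lambda>u. LINT t|lborel. norm (case (u, t) of (u, t) \<Rightarrow> bromwich f u * complex_of_real (k u t))) =
        (\<lambda>u. norm (bromwich f u) * (1 / (1 + exp u)))"
      by (simp add: norm_mult k_nonneg k_int)
    show "integrable lborel (\<lambda>u. LINT t|lborel. norm (case (u, t) of (u, t) \<Rightarrow> bromwich f u * complex_of_real (k u t)))"
      unfolding eq
    proof (rule Bochner_Integration.integrable_bound)
      show "integrable lborel (bromwich f)" using moment_integrable[of 0] by simp
      show "AE u in lborel. norm (norm (bromwich f u) * (1 / (1 + exp u))) \<le> norm (bromwich f u)"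
        by (rule AE_I2) (simp add: divide_le_eq mult_le_cancel_left1 add_pos_pos)
    qed measurable
    show "AE u in lborel. integrable lborel (\<lambda>t. case (u, t) of (u, t) \<Rightarrow> bromwich f u * complex_of_real (k u t))"
      using k_int by simp
  qed
  have inner: "(LINT u|lborel. bromwich f u * complex_of_real (k u t)) =
      indicator {0..} t *\<^sub>R (exp (- complex_of_real t) * A t)" for t
  proof -
    have "(\<lambda>u. bromwich f u * complex_of_real (k u t)) =
        (\<lambda>u. (indicator {0..} t *\<^sub>R exp (- complex_of_real t)) * (bromwich f u * exp (- complex_of_real t * complex_of_real (exp u))))"
    proof (rule ext)
      fix u
      have "exp (complex_of_real (- ((1 + exp u) * t))) = exp (- complex_of_real t) * exp (- complex_of_real t * complex_of_real (exp u))"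
        unfolding exp_add[symmetric] by (simp add: algebra_simps)
      then have "complex_of_real (exp (- ((1 + exp u) * t))) = exp (- complex_of_real t) * exp (- complex_of_real t * complex_of_real (exp u))"
        by (simp only: exp_of_real)
      then show "bromwich f u * complex_of_real (k u t) =
          (indicator {0..} t *\<^sub>R exp (- complex_of_real t)) * (bromwich f u * exp (- complex_of_real t * complex_of_real (exp u)))"
        by (simp add: k_def scaleR_conv_of_real)
    qed
    then show ?thesis unfolding A_def by simp
  qed
  have "integrable lborel (\<lambda>t. LINT u|lborel. bromwich f u * complex_of_real (k u t))"
    using lborel_pair.integrable_snd[OF int] by simp
  then show "set_integrable lborel {0..} (\<lambda>t. exp (- complex_of_real t) * A t)"
    unfolding inner set_integrable_def .
  have "(LINT t|lborel. LINT u|lborel. bromwich f u * complex_of_real (k u t)) =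
      (LINT u|lborel. LINT t|lborel. bromwich f u * complex_of_real (k u t))"
    by (rule lborel_pair.Fubini_integral[OF int])
  also have "\<dots> = (LINT u|lborel. sel_minus_integrand f 0 u)"
  proof (rule Bochner_Integration.integral_cong[OF refl])
    fix u
    have "(LINT t|lborel. bromwich f u * complex_of_real (k u t)) = bromwich f u * complex_of_real (1 / (1 + exp u))"
      by (subst integral_mult_right_zero) (simp only: integral_complex_of_real k_int)
    then show "(LINT t|lborel. bromwich f u * complex_of_real (k u t)) = sel_minus_integrand f 0 u"
      by (simp add: sel_minus_integrand_def exp_of_real)
  qed
  finally show "(LINT t:{0..}|lborel. exp (- complex_of_real t) * A t) = sel_minus f 0"
    unfolding inner set_lebesgue_integral_def sel_minus_def .
qed

end

section \<open>Selectors and C-sums\<close>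

lemma flat_eval_phase_plus: "flat_eval (phase_plus c) z = (\<Sum>(A, B, M)\<leftarrow>c. A * growth_eval M z)"
  by (induction c) (auto simp: phase_plus_def flat_eval_def)

lemma flat_eval_phase_minus: "flat_eval (phase_minus c) z = (\<Sum>(A, B, M)\<leftarrow>c. B * growth_eval M z)"
  by (induction c) (auto simp: phase_minus_def flat_eval_def)

text \<open>The definition looks only at lines far to the right, so agreement on some half-plane
  makes the two definite descriptions identical, whether or not the integrals converge.\<close>

lemma bromwich_cong:
  assumes "\<And>z. Re z > \<sigma> \<Longrightarrow> flat_eval a z = flat_eval b z"
  shows "bromwich a = bromwich b"
proof (rule ext)
  fix u
  have "\<forall>\<^sub>F \<tau> in at_top. bromwich_line a \<tau> u = bromwich_line b \<tau> u"
    using eventually_gt_at_top[of \<sigma>]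
  proof eventually_elim
    case (elim \<tau>)
    then have "bromwich_integrand a \<tau> u = bromwich_integrand b \<tau> u"
      by (intro ext) (simp add: bromwich_integrand_def assms)
    then show ?case by (simp add: bromwich_line_def)
  qed
  then have "(\<forall>\<^sub>F \<tau> in at_top. bromwich_line a \<tau> u = w) \<longleftrightarrow> (\<forall>\<^sub>F \<tau> in at_top. bromwich_line b \<tau> u = w)" for w
    by (intro eventually_cong) (auto elim: eventually_mono)
  then show "bromwich a u = bromwich b u" unfolding bromwich_def by simp
qed

lemma sel_plus_cong: "bromwich a = bromwich b \<Longrightarrow> sel_plus a = sel_plus b"
  by (simp add: fun_eq_iff sel_plus_def sel_plus_trunc_def[abs_def] sel_plus_integrand_def[abs_def])

lemma sel_minus_cong: "bromwich a = bromwich b \<Longrightarrow> sel_minus a = sel_minus b"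
  by (simp add: fun_eq_iff sel_minus_def sel_minus_integrand_def[abs_def])

text \<open>Integer values determine both phase parts on a half-plane, and the selector is a
  function of the Bromwich transforms of these parts. The underlying lists may still differ, since
  equal germs can have different expressions.\<close>

lemma selector_unique:
  assumes c: "is_phase_germ c" and d: "is_phase_germ d"
    and eq: "\<forall>\<^sub>F N in sequentially. phase_eval c (of_nat N) = phase_eval d (of_nat N)"
  shows "selector c = selector d"
proof -
  \<comment> \<open>The formal difference of the two germs; it may repeat monomials and need not be
    ordered by growth.\<close>
  let ?e = "c @ map (\<lambda>(A, B, M). (- A, - B, M)) d"
  have neg: "(\<Sum>(A, B, M)\<leftarrow>map (\<lambda>(A, B, M). (- A, - B, M)) d. A * growth_eval M z) = - (\<Sum>(A, B, M)\<leftarrow>d. A * growth_eval M z)"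
    "(\<Sum>(A, B, M)\<leftarrow>map (\<lambda>(A, B, M). (- A, - B, M)) d. B * growth_eval M z) = - (\<Sum>(A, B, M)\<leftarrow>d. B * growth_eval M z)"
    "phase_eval (map (\<lambda>(A, B, M). (- A, - B, M)) d) z = - phase_eval d z" for z
    by (induction d) (auto simp: phase_eval_def algebra_simps)
  have growth: "is_growth M" if "(A, B, M) \<in> set ?e" for A B M
  proof -
    from that consider "(A, B, M) \<in> set c" | "(- A, - B, M) \<in> set d" by auto
    then show ?thesis
    proof cases
      case 1
      with c show ?thesis unfolding is_phase_germ_def by (elim conjE) (drule bspec, assumption, simp)
    next
      case 2
      with d show ?thesis unfolding is_phase_germ_def by (elim conjE) (drule bspec, assumption, simp)
    qed
  qed
  have "phase_eval ?e z = phase_eval c z - phase_eval d z" for z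
    using neg(3)[of z] by (simp add: phase_eval_def)
  with eq have zero: "\<forall>\<^sub>F N in sequentially. phase_eval ?e (of_nat N) = 0"
    by (simp only: right_minus_eq)
  have "\<exists>\<sigma>. \<forall>z. Re z > \<sigma> \<longrightarrow> (\<Sum>(A, B, M)\<leftarrow>?e. A * growth_eval M z) = 0 \<and>
      (\<Sum>(A, B, M)\<leftarrow>?e. B * growth_eval M z) = 0"
    by (rule phase_germ_zero[OF _ zero]) (rule growth)
  then obtain \<sigma> where \<sigma>: "\<forall>z. Re z > \<sigma> \<longrightarrow> (\<Sum>(A, B, M)\<leftarrow>?e. A * growth_eval M z) = 0 \<and>
      (\<Sum>(A, B, M)\<leftarrow>?e. B * growth_eval M z) = 0"
    by (elim exE)
  have plus: "flat_eval (phase_plus c) z = flat_eval (phase_plus d) z"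
    and minus: "flat_eval (phase_minus c) z = flat_eval (phase_minus d) z" if "Re z > \<sigma>" for z
    using \<sigma>[rule_format, OF that] unfolding flat_eval_phase_plus flat_eval_phase_minus map_append sum_list_append neg
    by simp_all
  have "sel_plus (phase_plus c) = sel_plus (phase_plus d)"
    by (rule sel_plus_cong[OF bromwich_cong[OF plus]])
  moreover have "sel_minus (phase_minus c) = sel_minus (phase_minus d)"
    by (rule sel_minus_cong[OF bromwich_cong[OF minus]])
  ultimately show ?thesis by (intro ext) (simp only: selector_def)
qed

section \<open>The zero germ and the germ exp (i pi x) f\<close>

lemma bromwich_Nil [simp]: "bromwich [] = (\<lambda>u. 0)"
proof (rule ext)
  fix u
  have "bromwich_line [] \<sigma> u = 0" for \<sigma>
    by (simp add: bromwich_line_def bromwich_integrand_def flat_eval_def)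
  then show "bromwich [] u = 0" unfolding bromwich_def by simp
qed

lemma bromwich_admissible_Nil: "bromwich_admissible []"
  by (simp add: bromwich_admissible_def bromwich_line_def bromwich_integrand_def[abs_def] flat_eval_def)

lemma sel_plus_Nil: "sel_plus_exists [] N" "sel_plus [] N = 0"
proof -
  have t: "sel_plus_trunc [] N = (\<lambda>\<epsilon>. 0)"
    by (rule ext) (simp add: sel_plus_trunc_def sel_plus_integrand_def[abs_def] set_lebesgue_integral_def)
  show "sel_plus_exists [] N"
    unfolding sel_plus_exists_def t
    by (auto simp: set_integrable_def sel_plus_integrand_def[abs_def])
  show "sel_plus [] N = 0"
    unfolding sel_plus_def t by (rule tendsto_Lim) simp_all
qed

definition alternating_phase :: "flat_germ \<Rightarrow> phase_germ" where
  "alternating_phase f = map (\<lambda>(C, M). (0, C, M)) f"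

lemma alternating_phase_plus: "phase_plus (alternating_phase f) = []"
  by (induction f) (auto simp: phase_plus_def alternating_phase_def)

text \<open>\<open>phase_minus\<close> filters out zero coefficients, of which a flat germ has
  none.\<close>

lemma alternating_phase_minus: "is_flat_germ f \<Longrightarrow> phase_minus (alternating_phase f) = f"
  by (induction f) (auto simp: phase_minus_def alternating_phase_def is_flat_germ_def)

lemma alternating_phase_germ:
  assumes "is_flat_germ f"
  shows "is_phase_germ (alternating_phase f)"
proof -
  have "sorted_wrt (\<lambda>(_, _, M) (_, _, M'). M \<succ> M') (alternating_phase f)"
    using assms unfolding alternating_phase_def is_flat_germ_def sorted_wrt_map
    by (auto simp: case_prod_unfold)
  then show ?thesis using assms
    by (auto simp: is_phase_germ_def is_flat_germ_def alternating_phase_def)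
qed

lemma exp_pi_of_nat: "exp (\<i> * complex_of_real pi * of_nat N) = (- 1) ^ N"
proof -
  have "exp (of_nat N * (\<i> * complex_of_real pi)) = exp (\<i> * complex_of_real pi) ^ N"
    by (rule exp_of_nat_mult)
  then show ?thesis by (simp add: mult.commute)
qed

lemma alternating_phase_eval: "phase_eval (alternating_phase f) (of_nat N) = (- 1) ^ N * flat_eval f (of_nat N)"
  unfolding phase_eval_def exp_pi_of_nat alternating_phase_def flat_eval_def
  by (induction f) (auto simp: algebra_simps)

text \<open>The purpose of the normalization: increments of the tail are the terms of the series for
  every presentation and every solution, so any two tails of one series differ by a
  constant.\<close>

lemma normalized_tail_step:
  assumes pres: "recurrence_presentation n0 a b \<mu> c" and sol: "recurrence_solution n0 a b \<mu> I"
  shows "normalized_tail n0 a b I N - normalized_tail n0 a b I (N + 1) = c N"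
proof -
  have nz: "a n \<noteq> 0" "b n \<noteq> 0" if "n \<ge> n0" for n
    using pres that by (auto simp: recurrence_presentation_def)
  define P where "P N = (\<Prod>k=n0..<n0 + N. - a k / b k)" for N
  have P_Suc: "P (Suc N) = P N * (- a (n0 + N) / b (n0 + N))" for N
    unfolding P_def by simp
  have P_nz: "P N \<noteq> 0" for N
    using nz by (induction N) (auto simp: P_Suc, simp add: P_def)
  \<comment> \<open>The product of the two finite products telescopes to (-1)^N a(n0) / a(n0 + N);
    denominators are cleared for the induction.\<close>
  have prod_eq: "(\<Prod>j<N. b (n0 + j) / a (n0 + j + 1)) * P N * a (n0 + N) = (- 1) ^ N * a n0" for N
  proof (induction N)
    case 0
    then show ?case by (simp add: P_def)
  next
    case (Suc N)
    have "(\<Prod>j<Suc N. b (n0 + j) / a (n0 + j + 1)) * P (Suc N) * a (n0 + Suc N) =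
        - ((\<Prod>j<N. b (n0 + j) / a (n0 + j + 1)) * P N * a (n0 + N))"
      using nz[of "n0 + N"] nz[of "n0 + N + 1"] by (simp add: P_Suc)
    with Suc show ?case by simp
  qed
  have rec: "a (n0 + N) * I (n0 + N) + b (n0 + N) * I (n0 + N + 1) = \<mu> (n0 + N)"
    using sol by (simp add: recurrence_solution_def)
  have cN: "c N = (- 1) ^ N * \<mu> (n0 + N) * (\<Prod>j<N. b (n0 + j) / a (n0 + j + 1))"
    using pres by (simp add: recurrence_presentation_def)
  have aN: "a (n0 + N) \<noteq> 0" "b (n0 + N) \<noteq> 0" using nz by simp_all
  have "normalized_tail n0 a b I N - normalized_tail n0 a b I (N + 1) =
      a n0 * I (n0 + N) / P N - a n0 * I (n0 + N + 1) / P (Suc N)"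
    by (simp add: normalized_tail_def P_def)
  also have "\<dots> = a n0 / (P N * a (n0 + N)) * \<mu> (n0 + N)"
    unfolding P_Suc rec[symmetric] using aN P_nz[of N] by (simp add: field_simps)
  also have "a n0 / (P N * a (n0 + N)) = (- 1) ^ N * (\<Prod>j<N. b (n0 + j) / a (n0 + j + 1))"
  proof -
    have "(- 1) ^ N * ((- 1) ^ N * a n0) = a n0"
      by (simp add: mult.assoc[symmetric] power_add[symmetric])
    then have "a n0 = (- 1) ^ N * ((\<Prod>j<N. b (n0 + j) / a (n0 + j + 1)) * P N * a (n0 + N))"
      unfolding prod_eq by simp
    then show ?thesis using aN P_nz[of N] by (simp add: field_simps)
  qed
  finally show ?thesis unfolding cN by simp
qed

text \<open>Increments that grow at least geometrically dominate the sum of all earlier ones, so U_N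
  is bounded by a constant plus half the increment at N, hence eventually by that increment, and
  \<epsilon> = 1 works.\<close>

lemma shift_nonresonant_superexponential:
  assumes ratio: "filterlim (\<lambda>N. norm (U (N + 1) - U (N + 2)) / norm (U N - U (N + 1))) at_top sequentially"
  shows "shift_nonresonant U"
proof -
  define g where "g N = norm (U N - U (N + 1))" for N
  \<comment> \<open>The induction for \<open>bound\<close> needs 1/2 + 1 to be at most half of this
    factor, and 4 satisfies that.\<close>
  have "\<forall>\<^sub>F N in sequentially. g (N + 1) / g N \<ge> 4"
    using ratio unfolding filterlim_at_top g_def by simp
  then obtain N0 where N0: "\<And>N. N \<ge> N0 \<Longrightarrow> g (N + 1) / g N \<ge> 4"
    by (auto simp: eventually_sequentially)
  have g0: "g N \<ge> 0" for N by (simp add: g_def)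
  \<comment> \<open>Division by 0 gives 0, so a ratio of at least 4 excludes a vanishing
    increment.\<close>
  have gpos: "g N > 0" if "N \<ge> N0" for N
    using N0[OF that] g0[of N] by (cases "g N = 0") auto
  have step: "4 * g N \<le> g (N + 1)" if "N \<ge> N0" for N
    using N0[OF that] gpos[OF that] by (simp add: field_simps)
  define K where "K = norm (U N0)"
  have bound: "norm (U (N0 + k)) \<le> K + g (N0 + k) / 2" for k
  proof (induction k)
    case 0
    then show ?case using g0[of N0] by (simp add: K_def)
  next
    case (Suc k)
    have "norm (U (N0 + Suc k)) \<le> norm (U (N0 + k)) + g (N0 + k)"
      using norm_triangle_ineq4[of "U (N0 + k)" "U (N0 + k) - U (N0 + Suc k)"] by (simp add: g_def)
    also have "\<dots> \<le> K + g (N0 + k) / 2 + g (N0 + k)" using Suc by simp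
    also have "\<dots> \<le> K + g (N0 + Suc k) / 2" using step[of "N0 + k"] g0[of "N0 + k"] by simp
    finally show ?case .
  qed
  have growth: "4 ^ k * g N0 \<le> g (N0 + k)" for k
  proof (induction k)
    case (Suc k)
    then show ?case using step[of "N0 + k"] by simp
  qed simp
  have "filterlim (\<lambda>k. 4 ^ k * g N0) at_top sequentially"
    using gpos[of N0] by real_asymp
  then have "\<forall>\<^sub>F k in sequentially. 2 * K \<le> 4 ^ k * g N0" by (simp add: filterlim_at_top)
  then have "\<forall>\<^sub>F k in sequentially. norm (U (k + N0)) \<le> g (k + N0)"
  proof eventually_elim
    case (elim k)
    with growth[of k] bound[of k] show ?case by (simp add: add.commute)
  qed
  then have "\<forall>\<^sub>F N in sequentially. norm (U N) \<le> g N"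
    by (rule eventually_sequentially_seg[THEN iffD1])
  then have "\<forall>\<^sub>F N in sequentially. norm (U N - U (N + 1)) \<ge> 1 * norm (U N)"
    by (simp add: g_def)
  then show ?thesis unfolding shift_nonresonant_def by (intro disjI2 exI[of _ 1] conjI) simp_all
qed

text \<open>\<open>F\<close> extends the canonical continuation from a far half-plane to
  \<open>W\<close>. Integrals are accompanied by their integrability, because the integral of a
  non-integrable function is 0 by convention.\<close>

theorem theorem8p4:
  fixes f :: flat_germ and F :: "complex \<Rightarrow> complex" and W :: "complex set"
    and \<Phi> :: "real \<Rightarrow> complex" and \<rho> :: real
    and a :: "nat \<Rightarrow> complex" and Ahat :: "complex \<Rightarrow> complex"
  assumes f: "is_flat_germ f"
    and cont: "\<exists>\<sigma>. \<forall>z. Re z > \<sigma> \<longrightarrow> F z = flat_eval f z"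
    and W: "open W" "{z. Re z \<ge> 0} \<subseteq> W"
    and holo: "F holomorphic_on W"
    and decay: "\<And>A. A > 0 \<Longrightarrow> \<exists>C. \<forall>j\<in>{0, 1, 2::nat}. \<forall>\<sigma> t. 0 \<le> \<sigma> \<and> \<sigma> \<le> A \<longrightarrow>
       norm (((\<lambda>g s. vector_derivative g (at s)) ^^ j) (\<lambda>s::real. F (Complex \<sigma> s)) t)
         \<le> C / (1 + \<bar>t\<bar>) ^ 3"
    and ratio: "filterlim (\<lambda>N::nat. norm (F (of_nat (N + 1))) / norm (F (of_nat N))) at_top sequentially"
    and \<Phi>: "\<Phi> = bromwich f"
    and \<rho>: "\<rho> > 0" "integrable lborel (\<lambda>u. norm (\<Phi> u) * exp (\<rho> * exp u))"
    and a: "\<And>n. a n = (-1) ^ n * F (of_nat n)"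
    and Ahat: "\<And>t. Ahat t = (LINT u|lborel. \<Phi> u * exp (- t * of_real (exp u)))"
  shows "(\<exists>\<delta>>0. \<forall>t. norm t < \<delta> \<longrightarrow>
            integrable lborel (\<lambda>u. \<Phi> u * exp (- t * of_real (exp u))) \<and>
            (\<lambda>n. a n * t ^ n / fact n) sums Ahat t) \<and>
         (\<forall>t::real. t \<ge> 0 \<longrightarrow>
            integrable lborel (\<lambda>u. \<Phi> u * exp (- of_real t * of_real (exp u)))) \<and>
         set_integrable lborel {0..} (\<lambda>t::real. exp (- of_real t) * Ahat (of_real t)) \<and>
         C_summable a \<and>
         C_sum a = (LINT t:{0..}|lborel. exp (- of_real t) * Ahat (of_real t))"
proof -
  obtain s0 where s0: "\<forall>z. Re z > s0 \<longrightarrow> F z = flat_eval f z" using cont by (elim exE)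
  interpret laplace_germ f F s0 \<rho>
  proof
    show "F z = flat_eval f z" if "Re z > s0" for z using s0 that by simp
    show "F holomorphic_on {z. Re z > 0}"
      by (rule holomorphic_on_subset[OF holo]) (use W(2) in force)
    show "continuous_on {z. Re z \<ge> 0} F"
      by (rule continuous_on_subset[OF holomorphic_on_imp_continuous_on[OF holo] W(2)])
    show "\<exists>C. \<forall>\<sigma> t. 0 \<le> \<sigma> \<and> \<sigma> \<le> A \<longrightarrow> norm (F (Complex \<sigma> t)) \<le> C / (1 + \<bar>t\<bar>) ^ 3" if A: "A > 0" for A
    proof -
      obtain C where C: "\<forall>j\<in>{0, 1, 2::nat}. \<forall>\<sigma> t. 0 \<le> \<sigma> \<and> \<sigma> \<le> A \<longrightarrow>
       norm (((\<lambda>g s. vector_derivative g (at s)) ^^ j) (\<lambda>s::real. F (Complex \<sigma> s)) t) \<le> C / (1 + \<bar>t\<bar>) ^ 3"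
        using decay[OF A] by (elim exE)
      have "\<forall>\<sigma> t. 0 \<le> \<sigma> \<and> \<sigma> \<le> A \<longrightarrow> norm (F (Complex \<sigma> t)) \<le> C / (1 + \<bar>t\<bar>) ^ 3"
        using bspec[OF C, of 0] by simp
      then show ?thesis by (rule exI)
    qed
    show "0 < \<rho>" by (rule \<rho>(1))
    show "integrable lborel (\<lambda>u. norm (bromwich f u) * exp (\<rho> * exp u))" using \<rho>(2) unfolding \<Phi> .
  qed
  define U where "U N = (- 1) ^ N * sel_minus f N" for N
  have U_step: "U N - U (N + 1) = a N" for N
    using sel_minus_step[of N] by (simp add: U_def a flip: distrib_left)
  have selector_U: "selector (alternating_phase f) = U"
    by (rule ext) (simp add: selector_def alternating_phase_plus alternating_phase_minus[OF f] sel_plus_Nil U_def)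
  have phase_eval_a: "\<forall>\<^sub>F N in sequentially. phase_eval (alternating_phase f) (of_nat N) = a N"
  proof -
    have "\<forall>\<^sub>F N in sequentially. real N > s0"
      using filterlim_real_sequentially by (simp add: filterlim_at_top_dense)
    then show ?thesis by eventually_elim (use s0 in \<open>simp add: alternating_phase_eval a\<close>)
  qed
  have norm_a: "norm (a N) = norm (F (of_nat N))" for N by (simp add: a norm_mult norm_power)
  have nonres: "shift_nonresonant U"
  proof (rule shift_nonresonant_superexponential)
    have "U (N + 1) - U (N + 2) = a (N + 1)" for N using U_step[of "N + 1"] by simp
    then show "filterlim (\<lambda>N. norm (U (N + 1) - U (N + 2)) / norm (U N - U (N + 1))) at_top sequentially"
      using ratio by (simp only: U_step norm_a)
  qed
  \<comment> \<open>As x / 0 = 0, a positive ratio forces F(N) to be nonzero. This keeps every tail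
    out of the eventually constant case of \<open>finite_part\<close>.\<close>
  have a_nonzero: "\<forall>\<^sub>F N in sequentially. a N \<noteq> 0"
  proof -
    have "\<forall>\<^sub>F N in sequentially. norm (F (of_nat (N + 1))) / norm (F (of_nat N)) > 0"
      using ratio unfolding filterlim_at_top_dense by blast
    then show ?thesis by eventually_elim (auto simp: a)
  qed
  have not_const: "\<not> eventually_const R" if R: "\<And>N. R N - R (N + 1) = a N" for R
  proof
    assume "eventually_const R"
    then have "\<forall>\<^sub>F N in sequentially. a N = 0" by (simp only: eventually_const_def R)
    with a_nonzero have "\<forall>\<^sub>F N::nat in sequentially. False" by eventually_elim simp
    then show False by simp
  qed
  have by_alternating: "admissible_by R (alternating_phase f)" if R: "\<And>N. R N - R (N + 1) = a N" for R
    unfolding admissible_by_def admits_selector_def selector_U R alternating_phase_plus alternating_phase_minus[OF f]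
    using phase_eval_a nonres
    by (simp add: alternating_phase_germ[OF f] bromwich_admissible_Nil bromwich_admissible_germ sel_plus_Nil
        sel_minus_exists_def sel_minus_integrable)
  have by_unique: "selector c = U" if R: "\<And>N. R N - R (N + 1) = a N" and c: "admissible_by R c" for R c
  proof -
    have "\<forall>\<^sub>F N in sequentially. phase_eval c (of_nat N) = a N" "is_phase_germ c"
      using c unfolding admissible_by_def R by simp_all
    from this(1) phase_eval_a
    have "\<forall>\<^sub>F N in sequentially. phase_eval c (of_nat N) = phase_eval (alternating_phase f) (of_nat N)"
      by eventually_elim simp
    from selector_unique[OF \<open>is_phase_germ c\<close> alternating_phase_germ[OF f] this] show ?thesis
      by (simp only: selector_U)
  qed
  \<comment> \<open>Tail and selector have equal increments at every N, so their difference is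
    already at N = 0 the constant that \<open>finite_part\<close> describes.\<close>
  have fp: "finite_part R = R 0 - U 0" if R: "\<And>N. R N - R (N + 1) = a N" for R
  proof -
    have const: "R N - U N = R 0 - U 0" for N
    proof (induction N)
      case (Suc N)
      have "R (N + 1) - U (N + 1) = R N - U N" using R[of N] U_step[of N] by (simp add: algebra_simps)
      with Suc show ?case by simp
    qed simp
    have "(THE v. \<exists>c. admissible_by R c \<and> (\<forall>\<^sub>F N in sequentially. R N - selector c N = v)) = R 0 - U 0"
    proof (rule the_equality)
      show "\<exists>c. admissible_by R c \<and> (\<forall>\<^sub>F N in sequentially. R N - selector c N = R 0 - U 0)"
        unfolding selector_U[symmetric]
        by (intro exI[of _ "alternating_phase f"] conjI by_alternating[OF R] always_eventually allI)
          (unfold selector_U, rule const)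
      fix v assume "\<exists>c. admissible_by R c \<and> (\<forall>\<^sub>F N in sequentially. R N - selector c N = v)"
      then obtain c where c: "admissible_by R c" "\<forall>\<^sub>F N in sequentially. R N - selector c N = v" by (elim exE conjE)
      from c(2) obtain N where "R N - U N = v"
        unfolding by_unique[OF R c(1)] eventually_sequentially by auto
      with const[of N] show "v = R 0 - U 0" by simp
    qed
    then show ?thesis using not_const[OF R] by (simp add: finite_part_def)
  qed
  define I where "I = sel_minus f"
  have data: "C_summation_data a 0 (\<lambda>_. 1) (\<lambda>_. 1) (\<lambda>n. F (of_nat n)) I"
  proof -
    have pres: "recurrence_presentation 0 (\<lambda>_. 1) (\<lambda>_. 1) (\<lambda>n. F (of_nat n)) a"
      by (simp add: recurrence_presentation_def a)
    have sol: "recurrence_solution 0 (\<lambda>_. 1) (\<lambda>_. 1) (\<lambda>n. F (of_nat n)) I"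
      using sel_minus_step by (simp add: recurrence_solution_def I_def)
    have "admissible_by (normalized_tail 0 (\<lambda>_. 1) (\<lambda>_. 1) I) (alternating_phase f)"
      by (rule by_alternating[OF normalized_tail_step[OF pres sol]])
    then show ?thesis
      unfolding C_summation_data_def admissible_def by (intro conjI pres sol disjI2 exI)
  qed
  \<comment> \<open>The tail at N = 0 is a'(n0) I'(n0), which cancels and leaves U 0 for every
    presentation and solution.\<close>
  have val: "a' n0 * I' n0 - finite_part (normalized_tail n0 a' b' I') = U 0"
    if "C_summation_data a n0 a' b' \<mu>' I'" for n0 a' b' \<mu>' I'
  proof -
    have pres: "recurrence_presentation n0 a' b' \<mu>' a" and sol: "recurrence_solution n0 a' b' \<mu>' I'"
      using that by (simp_all add: C_summation_data_def)
    have "normalized_tail n0 a' b' I' 0 = a' n0 * I' n0" by (simp add: normalized_tail_def)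
    then show ?thesis unfolding fp[OF normalized_tail_step[OF pres sol]] by simp
  qed
  have sum: "C_sum a = U 0"
    unfolding C_sum_def
  proof (rule the_equality)
    show "\<exists>n\<^sub>0 a' b \<mu> I. C_summation_data a n\<^sub>0 a' b \<mu> I \<and> U 0 = a' n\<^sub>0 * I n\<^sub>0 - finite_part (normalized_tail n\<^sub>0 a' b I)"
      by (intro exI conjI) (rule data, rule val[OF data, symmetric])
  next
    fix s assume "\<exists>n\<^sub>0 a' b \<mu> I. C_summation_data a n\<^sub>0 a' b \<mu> I \<and> s = a' n\<^sub>0 * I n\<^sub>0 - finite_part (normalized_tail n\<^sub>0 a' b I)"
    then show "s = U 0" using val by (elim exE conjE) simp
  qed
  have summable: "C_summable a" unfolding C_summable_def by (intro exI) (rule data)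
  have Ahat_real: "(\<lambda>t::real. exp (- of_real t) * Ahat (of_real t)) =
      (\<lambda>t. exp (- complex_of_real t) * (LINT u|lborel. bromwich f u * exp (- complex_of_real t * complex_of_real (exp u))))"
    by (simp only: Ahat \<Phi>)
  show ?thesis
  proof (intro conjI)
    show "\<exists>\<delta>>0. \<forall>t. norm t < \<delta> \<longrightarrow>
            integrable lborel (\<lambda>u. \<Phi> u * exp (- t * of_real (exp u))) \<and>
            (\<lambda>n. a n * t ^ n / fact n) sums Ahat t"
    proof (intro exI[of _ \<rho>] conjI allI impI)
      show "0 < \<rho>" by (rule \<rho>(1))
      fix t :: complex assume "norm t < \<rho>"
      then have t: "norm t \<le> \<rho>" by simp
      show "integrable lborel (\<lambda>u. \<Phi> u * exp (- t * of_real (exp u)))"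
        unfolding \<Phi> by (rule borel_integrable[OF t])
      show "(\<lambda>n. a n * t ^ n / fact n) sums Ahat t"
        unfolding a Ahat \<Phi> by (rule borel_sums[OF t])
    qed
    show "\<forall>t::real. t \<ge> 0 \<longrightarrow> integrable lborel (\<lambda>u. \<Phi> u * exp (- of_real t * of_real (exp u)))"
      unfolding \<Phi> by (intro allI impI borel_integrable_nonneg)
    show "set_integrable lborel {0..} (\<lambda>t::real. exp (- of_real t) * Ahat (of_real t))"
      unfolding Ahat_real by (rule borel_laplace(1))
    show "C_summable a" by (rule summable)
    show "C_sum a = (LINT t:{0..}|lborel. exp (- of_real t) * Ahat (of_real t))"
      unfolding Ahat_real borel_laplace(2) sum by (simp add: U_def)
  qed
qed

end
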